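(* Let $n,m\ge 1$ and let $\alpha_1,\dots,\alpha_n,\beta_1,\dots,\beta_m$ be weight functions (as defined in the context) which are all quasimultiplicative. Let $g:[1,\infty)\to(0,\infty)$ be a non-increasing function. Then the set of $(g,\underline{\alpha},\underline{\beta})$-Dirichlet pairs $(\Theta,\pmb{\eta})\in \mathbf{M}_{n,m}\times\mathbb{R}^n\cong\mathbb{R}^{nm+n}$ has Lebesgue measure zero if the series $$\sum_{l=1}^{\infty}\frac{1}{l\cdot\prod_{j=1}^m\beta_j(l)\cdot\prod_{i=1}^n\alpha_i(g(l))}$$ diverges, and has full Lebesgue measure if it converges.
   Context: A weight function is a function $h:[0,\infty)\to[0,\infty)$ such that on $[1,\infty)$ it is positive, increasing, continuous, with $h(1)=1$ and $h(T)\to\infty$ as $T\to\infty$, and which is extended by $h(T)=1/h(1/T)$ for $0<T\le1$ and $h(0)=0$. $\mathbf{M}_{n,m}$ denotes the real $n\times m$ matrices; $\Theta_i$ is the $i$-th row of $\Theta$; $\|x\|$ denotes the distance from a real number $x$ to the nearest integer. An increasing function $h:(0,\infty)\to(0,\infty)$ is quasimultiplicative if there are $M>1$ and constants $1<c_1\le c_2$ such that $c_1h(M^k)\le h(M^{k+1})\le c_2h(M^k)$ for all integers $k$ with $|k|$ sufficiently large. For $\underline{\alpha}=(\alpha_1,\dots,\alpha_n)$, $\underline{\beta}=(\beta_1,\dots,\beta_m)$ and a function $g$, a pair $(\Theta,\pmb{\eta})$ with $\Theta\in\mathbf{M}_{n,m}$, $\pmb{\eta}=(\eta_1,\dots,\eta_n)\in\mathbb{R}^n$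 is $(g,\underline{\alpha},\underline{\beta})$-Dirichlet if for every sufficiently large $T$ there exists $\mathbf{q}=(q_1,\dots,q_m)\in\mathbb{Z}^m\setminus\{\mathbf 0\}$ with $\|\Theta_i\mathbf q-\eta_i\|\le\alpha_i(g(T))$ for $i=1,\dots,n$ and $|q_j|\le\beta_j(T)$ for $j=1,\dots,m$. *)

theory Defs
  imports "HOL-Analysis.Analysis"
begin

text \<open>Only the values on \<open>[0, \<infinity>)\<close> matter. Here and below ``increasing'' is read in the weak
  sense, so the strictly increasing functions are included as a special case.\<close>

definition weight_function :: "(real \<Rightarrow> real) \<Rightarrow> bool" where
  "weight_function h \<longleftrightarrow>
     (\<forall>T\<ge>0. h T \<ge> 0) \<and>
     (\<forall>T\<ge>1. h T > 0) \<and> mono_on {1..} h \<and> continuous_on {1..} h \<and>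
     h 1 = 1 \<and> filterlim h at_top at_top \<and>
     (\<forall>T. 0 < T \<and> T \<le> 1 \<longrightarrow> h T = 1 / h (1 / T)) \<and> h 0 = 0"

definition quasimultiplicative :: "(real \<Rightarrow> real) \<Rightarrow> bool" where
  "quasimultiplicative h \<longleftrightarrow>
     (\<forall>T>0. h T > 0) \<and> mono_on {0<..} h \<and>
     (\<exists>M>1. \<exists>c\<^sub>1 c\<^sub>2. 1 < c\<^sub>1 \<and> c\<^sub>1 \<le> c\<^sub>2 \<and>
        (\<exists>K::int. \<forall>k::int. \<bar>k\<bar> \<ge> K \<longrightarrow>
           c\<^sub>1 * h (M powi k) \<le> h (M powi (k + 1)) \<and> h (M powi (k + 1)) \<le> c\<^sub>2 * h (M powi k)))"

definition nearest_int_dist :: "real \<Rightarrow> real" where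
  "nearest_int_dist x = \<bar>x - of_int (round x)\<bar>"

text \<open>The index types \<open>'n\<close> and \<open>'m\<close> have \<open>n\<close> and \<open>m\<close> elements, so that an \<open>n \<times> m\<close> matrix has
  type \<open>real ^ 'm ^ 'n\<close> and its \<open>i\<close>-th row is \<open>\<Theta> $ i\<close>.\<close>

definition dirichlet_pair ::
  "(real \<Rightarrow> real) \<Rightarrow> ('n::finite \<Rightarrow> real \<Rightarrow> real) \<Rightarrow> ('m::finite \<Rightarrow> real \<Rightarrow> real) \<Rightarrow>
   real ^ 'm ^ 'n \<Rightarrow> real ^ 'n \<Rightarrow> bool" where
  "dirichlet_pair g \<alpha> \<beta> \<Theta> \<eta> \<longleftrightarrow>
     (\<forall>\<^sub>F T in at_top. \<exists>q :: int ^ 'm. q \<noteq> 0 \<and>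
        (\<forall>i. nearest_int_dist ((\<Sum>j\<in>UNIV. \<Theta> $ i $ j * of_int (q $ j)) - \<eta> $ i) \<le> \<alpha> i (g T)) \<and>
        (\<forall>j. \<bar>of_int (q $ j)\<bar> \<le> \<beta> j T))"

end

theory Submission
  imports Defs "HOL-Probability.Probability_Measure"
begin

text \<open>Along a geometric sequence \<open>T = B\<^sup>k\<close> the series becomes \<open>\<Sum>\<^sub>k 1 / V\<^sub>k\<close>, where
  \<open>V\<^sub>k = \<Prod>\<^sub>j \<beta>\<^sub>j(B\<^sup>k) \<cdot> \<Prod>\<^sub>i \<alpha>\<^sub>i(g(B\<^sup>k))\<close>, up to constants.

  Convergence: for uniformly random \<open>(\<Theta>, \<eta>)\<close> the points \<open>\<Theta> q - \<eta>\<close> of the torus are pairwise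
  independent, so by the second moment method the probability that none of about \<open>\<Prod>\<^sub>j \<beta>\<^sub>j(B\<^sup>k)\<close> of them
  hits the target box is \<open>O(1 / V\<^sub>k)\<close>, and Borel--Cantelli applies.

  Divergence: if \<open>p\<close> is a nonzero integer vector with \<open>\<bar>p\<^sub>i\<bar> \<le> c / \<alpha>\<^sub>i(g(T))\<close> and every \<open>(\<Theta>\<^sup>T p)\<^sub>j\<close> is
  within \<open>c / \<beta>\<^sub>j(T)\<close> of an integer, then solvability at \<open>T\<close> forces \<open>\<eta> \<cdot> p\<close> to be within
  \<open>(n + m) c\<close> of an integer, which has probability \<open>O(c)\<close>. It remains to show that almost every
  \<open>\<Theta>\<close> admits, for every \<open>c > 0\<close>, such vectors \<open>p\<close> at infinitely many \<open>T = B\<^sup>k\<close>. The second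
  moment method gives a positive lower bound for the measure of these \<open>\<Theta>\<close> that does not depend on
  \<open>c\<close>, and the set of \<open>\<Theta>\<close> that are good for all \<open>c\<close> is invariant under rational translations, hence
  of full measure.\<close>

section \<open>Integration on the torus\<close>

text \<open>The second moment bound depends only on how pair probabilities compare with products of
  single ones, not on the size of the targets. Shrinking everything by \<open>c\<close> multiplies
  the divergent series by a power of \<open>c\<close>, so the same lower bound holds for every
  \<open>c\<close>. Translating \<Theta> by a point with denominator \<open>N\<close> turns a good
  \<open>p\<close> with parameter \<open>c\<close> into a good \<open>N p\<close> with parameter
  \<open>N c\<close>; hence only the intersection over all \<open>c\<close> is invariant. Two
  obstacles shape the second moment. The same \<open>p\<close> is admissible at many levels
  \<open>k\<close>, where its events are nested instead of independent; since the \<beta> at least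
  double from one level to the next, these overlaps form geometric sums, linear in the expected
  count. And with one row all \<open>p\<close> are parallel, so there reduced fractions and an
  average of Euler's function take the place of primitive vectors. All the counting rests on the sum
  of \<open>1 / d^2\<close> over \<open>d \<ge> 2\<close> being at most 3/4, which is less than 1.
  As \<open>g\<close> is merely monotone, the values of \<open>\<alpha> i (g T)\<close> at
  consecutive powers of \<open>B\<close> need not be comparable. This is why indices shift by one
  wherever a block of the series or a range of \<open>T\<close> is replaced by an endpoint.\<close>

definition unit_cube :: "'a::euclidean_space set" where
  "unit_cube = {x. \<forall>b\<in>Basis. 0 \<le> x \<bullet> b \<and> x \<bullet> b < 1}"

definition int_points :: "'a::euclidean_space set" where
  "int_points = {z. \<forall>b\<in>Basis. z \<bullet> b \<in> \<int>}"

text \<open>A measure on the whole space concentrated on a fundamental domain, instead of one on a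
  quotient: translations and linear maps then apply without reduction modulo 1, and
  \<open>periodic\<close> expresses being a function on the torus.\<close>

definition torus :: "'a::euclidean_space measure" where
  "torus = density lborel (indicator unit_cube)"

definition periodic :: "('a::euclidean_space \<Rightarrow> 'b) \<Rightarrow> bool" where
  "periodic f \<longleftrightarrow> (\<forall>z\<in>int_points. \<forall>x. f (x + z) = f x)"

lemma unit_cube_borel [measurable]: "unit_cube \<in> sets borel"
  unfolding unit_cube_def by measurable

lemma sets_torus [simp, measurable_cong]: "sets torus = sets borel"
  by (simp add: torus_def)

lemma space_torus [simp]: "space torus = UNIV"
  by (simp add: torus_def)

lemma nn_integral_torus:
  "f \<in> borel_measurable borel \<Longrightarrow>
    (\<integral>\<^sup>+x. f x \<partial>torus) = (\<integral>\<^sup>+x. indicator unit_cube x * f x \<partial>lborel)"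
  unfolding torus_def by (subst nn_integral_density) auto

lemma emeasure_torus:
  "A \<in> sets borel \<Longrightarrow> emeasure torus A = emeasure lborel (unit_cube \<inter> A)"
  unfolding torus_def by (subst emeasure_density) (auto simp flip: indicator_inter_arith)

lemma emeasure_unit_cube: "emeasure lborel (unit_cube :: 'a::euclidean_space set) = 1"
proof -
  have "emeasure lborel (unit_cube :: 'a set)
      = (\<integral>\<^sup>+x. (\<Prod>b\<in>Basis. indicator {0..<1} (x \<bullet> b)) \<partial>(lborel :: 'a measure))"
    by (subst nn_integral_indicator[symmetric], measurable, rule nn_integral_cong)
       (auto simp: unit_cube_def indicator_def)
  also have "\<dots> = 1"
    by (subst nn_integral_lborel_prod) auto
  finally show ?thesis .
qed

lemma prob_space_torus: "prob_space (torus :: 'a::euclidean_space measure)"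
  by standard (simp add: emeasure_torus emeasure_unit_cube)

lemma sigma_finite_torus: "sigma_finite_measure (torus :: 'a::euclidean_space measure)"
  using prob_space_torus by (rule prob_space_imp_sigma_finite)

lemma int_points_uminus [simp]: "- z \<in> int_points \<longleftrightarrow> z \<in> int_points"
  by (simp add: int_points_def)

lemma countable_int_points: "countable (int_points :: 'a::euclidean_space set)"
proof -
  have "(int_points :: 'a set) \<subseteq> (\<lambda>f. \<Sum>b\<in>Basis. of_int (f b) *\<^sub>R b) ` (Basis \<rightarrow>\<^sub>E (UNIV :: int set))"
  proof
    fix z assume z: "z \<in> (int_points :: 'a set)"
    define f where "f = restrict (\<lambda>b. \<lfloor>z \<bullet> b\<rfloor>) Basis"
    have "(\<Sum>b\<in>Basis. of_int (f b) *\<^sub>R b) = (\<Sum>b\<in>Basis. (z \<bullet> b) *\<^sub>R b)"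
      using z by (intro sum.cong) (auto simp: f_def int_points_def elim!: Ints_cases)
    then have "z = (\<Sum>b\<in>Basis. of_int (f b) *\<^sub>R b)"
      by (simp add: euclidean_representation)
    then show "z \<in> (\<lambda>f. \<Sum>b\<in>Basis. of_int (f b) *\<^sub>R b) ` (Basis \<rightarrow>\<^sub>E (UNIV :: int set))"
      by (intro image_eqI[of _ _ f]) (auto simp: f_def)
  qed
  then show ?thesis
    by (rule countable_subset) (intro countable_image countable_PiE, auto)
qed

text \<open>The cube is half-open, so its integer translates partition the space exactly; the right
  translation is by minus the coordinatewise floor.\<close>

lemma int_translate_unit_cube_unique:
  "\<exists>!z. z \<in> int_points \<and> x + z \<in> (unit_cube :: 'a::euclidean_space set)"
proof
  define z where "z = (\<Sum>b\<in>Basis. of_int (- \<lfloor>x \<bullet> b\<rfloor>) *\<^sub>R b)"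
  have zb: "z \<bullet> b = of_int (- \<lfloor>x \<bullet> b\<rfloor>)" if "b \<in> Basis" for b
    using that unfolding z_def by (rule inner_sum_left_Basis)
  show "z \<in> int_points \<and> x + z \<in> unit_cube"
    by (simp add: int_points_def unit_cube_def zb inner_add_left) (auto, linarith)
  fix y assume y: "y \<in> int_points \<and> x + y \<in> unit_cube"
  show "y = z"
  proof (rule euclidean_eqI)
    fix b :: 'a assume b: "b \<in> Basis"
    obtain k where k: "y \<bullet> b = of_int k"
      using y b by (auto simp: int_points_def elim: Ints_cases)
    have "0 \<le> x \<bullet> b + of_int k" "x \<bullet> b + of_int k < 1"
      using y b by (auto simp: unit_cube_def inner_add_left k[symmetric])
    then have "\<lfloor>x \<bullet> b\<rfloor> = - k" by linarith
    then show "y \<bullet> b = z \<bullet> b" using k b by (simp add: zb)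
  qed
qed

lemma nn_integral_indicator_int_translates:
  fixes x :: "'a::euclidean_space"
  shows "(\<integral>\<^sup>+z. indicator unit_cube (x + z) \<partial>count_space int_points) = (1 :: ennreal)"
proof -
  obtain z where z: "z \<in> int_points" "x + z \<in> unit_cube"
    and u: "\<And>y. y \<in> int_points \<Longrightarrow> x + y \<in> unit_cube \<Longrightarrow> y = z"
    using int_translate_unit_cube_unique[of x] by blast
  have "(\<integral>\<^sup>+y. indicator unit_cube (x + y) \<partial>count_space int_points)
      = (\<integral>\<^sup>+y. indicator {z} y \<partial>count_space int_points)"
  proof (rule nn_integral_cong)
    fix y assume "y \<in> space (count_space (int_points :: 'a set))"
    then have "x + y \<in> unit_cube \<longleftrightarrow> y = z" using z u[of y] by auto
    then show "indicator unit_cube (x + y) = (indicator {z} y :: ennreal)"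
      by (simp add: indicator_def)
  qed
  also have "\<dots> = 1" using z by simp
  finally show ?thesis .
qed

lemma nn_integral_lborel_translate:
  fixes f :: "'a::euclidean_space \<Rightarrow> ennreal"
  assumes [measurable]: "f \<in> borel_measurable borel"
  shows "(\<integral>\<^sup>+x. f (x + v) \<partial>lborel) = (\<integral>\<^sup>+x. f x \<partial>lborel)"
  by (subst (2) lborel_distr_plus[of v, symmetric])
     (simp add: nn_integral_distr add.commute)

text \<open>Unfolding: insert 1 as the sum of the indicators of all integer translates of the cube,
  swap sum and integral, shift each summand back using periodicity of \<open>f\<close>, and sum the
  translates of the other indicator, which again give 1.\<close>

lemma nn_integral_torus_translate:
  fixes f :: "'a::euclidean_space \<Rightarrow> ennreal"
  assumes [measurable]: "f \<in> borel_measurable borel" and per: "periodic f"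
  shows "(\<integral>\<^sup>+x. f (x + v) \<partial>torus) = (\<integral>\<^sup>+x. f x \<partial>torus)"
proof -
  let ?c = "indicator (unit_cube :: 'a set) :: 'a \<Rightarrow> ennreal"
  have "(\<integral>\<^sup>+x. f (x + v) \<partial>torus) = (\<integral>\<^sup>+x. ?c x * f (x + v) \<partial>lborel)"
    by (rule nn_integral_torus) measurable
  also have "\<dots> = (\<integral>\<^sup>+x. ?c (x - v) * f x \<partial>lborel)"
    using nn_integral_lborel_translate[of "\<lambda>x. ?c (x - v) * f x" v] by simp
  also have "\<dots> = (\<integral>\<^sup>+x. \<integral>\<^sup>+z. ?c (x + z) * (?c (x - v) * f x) \<partial>count_space int_points \<partial>lborel)"
    by (simp add: nn_integral_multc nn_integral_indicator_int_translates)
  also have "\<dots> = (\<integral>\<^sup>+z. \<integral>\<^sup>+x. ?c (x + z) * (?c (x - v) * f x) \<partial>lborel \<partial>count_space int_points)"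
    by (rule nn_integral_count_space_nn_integral[OF countable_int_points]) measurable
  also have "\<dots> = (\<integral>\<^sup>+z. \<integral>\<^sup>+x. ?c x * (?c (x - v - z) * f x) \<partial>lborel \<partial>count_space int_points)"
  proof (rule nn_integral_cong)
    fix z :: 'a assume "z \<in> space (count_space int_points)"
    then have z: "- z \<in> int_points" by simp
    have "(\<integral>\<^sup>+x. ?c (x + z) * (?c (x - v) * f x) \<partial>lborel)
        = (\<integral>\<^sup>+x. ?c (x + z) * (?c (x + z - v - z) * f (x + z)) \<partial>lborel)"
    proof (rule nn_integral_cong)
      fix x
      have "x + z - v - z = x - v" "f (x + z) = f x"
        using per z by (auto simp: periodic_def)
      then show "?c (x + z) * (?c (x - v) * f x)
          = ?c (x + z) * (?c (x + z - v - z) * f (x + z))" by simp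
    qed
    also have "\<dots> = (\<integral>\<^sup>+x. ?c x * (?c (x - v - z) * f x) \<partial>lborel)"
      by (rule nn_integral_lborel_translate[of "\<lambda>x. ?c x * (?c (x - v - z) * f x)"]) measurable
    finally show "(\<integral>\<^sup>+x. ?c (x + z) * (?c (x - v) * f x) \<partial>lborel)
        = (\<integral>\<^sup>+x. ?c x * (?c (x - v - z) * f x) \<partial>lborel)" .
  qed
  also have "\<dots> = (\<integral>\<^sup>+x. \<integral>\<^sup>+z. ?c x * (?c (x - v - z) * f x) \<partial>count_space int_points \<partial>lborel)"
    by (rule nn_integral_count_space_nn_integral[OF countable_int_points, symmetric]) measurable
  also have "\<dots> = (\<integral>\<^sup>+x. ?c x * f x \<partial>lborel)"
  proof (rule nn_integral_cong)
    fix x :: 'a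
    have "(\<integral>\<^sup>+z. ?c (x - v - z) \<partial>count_space int_points) = (\<integral>\<^sup>+z. ?c (x - v + z) \<partial>count_space int_points)"
      using nn_integral_bij_count_space[of uminus int_points int_points "\<lambda>z. ?c (x - v + z)"]
      by (simp add: bij_betw_byWitness[of _ uminus] image_subset_iff)
    then show "(\<integral>\<^sup>+z. ?c x * (?c (x - v - z) * f x) \<partial>count_space int_points) = ?c x * f x"
      by (simp add: nn_integral_multc nn_integral_cmult nn_integral_indicator_int_translates)
  qed
  also have "\<dots> = (\<integral>\<^sup>+x. f x \<partial>torus)"
    by (rule nn_integral_torus[symmetric]) measurable
  finally show ?thesis .
qed

text \<open>Averaging over all translates replaces the pushforward under \<open>L\<close> by the uniform measure, so
  only surjectivity of \<open>L\<close> is needed, not the index of \<open>L ` int_points\<close>.\<close>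

lemma nn_integral_torus_linear:
  fixes L :: "'a::euclidean_space \<Rightarrow> 'b::euclidean_space" and f :: "'b \<Rightarrow> ennreal"
  assumes L: "linear L" "surj L" "L ` int_points \<subseteq> int_points"
    and f [measurable]: "f \<in> borel_measurable borel" and per: "periodic f"
  shows "(\<integral>\<^sup>+x. f (L x) \<partial>torus) = (\<integral>\<^sup>+y. f y \<partial>torus)"
proof -
  interpret a: sigma_finite_measure "torus :: 'a measure" by (rule sigma_finite_torus)
  interpret b: sigma_finite_measure "torus :: 'b measure" by (rule sigma_finite_torus)
  interpret ab: pair_sigma_finite "torus :: 'a measure" "torus :: 'b measure" ..
  have [measurable]: "L \<in> borel_measurable borel"
    using L(1) by (intro borel_measurable_continuous_onI linear_continuous_on)
      (simp add: linear_conv_bounded_linear)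
  have pL: "periodic (\<lambda>x. f (L x))"
    using per L by (auto simp: periodic_def linear_add)
  have one: "emeasure torus (UNIV :: 'x::euclidean_space set) = 1"
    using prob_space.emeasure_space_1[OF prob_space_torus] by simp
  have eq: "(\<integral>\<^sup>+x. f (y + L x) \<partial>torus) = (\<integral>\<^sup>+x. f (L x) \<partial>torus)" for y
  proof -
    obtain v where "L v = y" using L(2) by (metis surjD)
    with nn_integral_torus_translate[OF _ pL, of v] L(1) show ?thesis
      by (simp add: linear_add add.commute)
  qed
  have "(\<integral>\<^sup>+x. f (L x) \<partial>torus) = (\<integral>\<^sup>+y. \<integral>\<^sup>+x. f (y + L x) \<partial>(torus :: 'a measure) \<partial>(torus :: 'b measure))"
    by (simp add: eq one)
  also have "\<dots> = (\<integral>\<^sup>+x. \<integral>\<^sup>+y. f (y + L x) \<partial>(torus :: 'b measure) \<partial>(torus :: 'a measure))"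
    by (rule ab.Fubini') measurable
  also have "\<dots> = (\<integral>\<^sup>+y. f y \<partial>torus)"
    by (simp add: nn_integral_torus_translate per one)
  finally show ?thesis .
qed

text \<open>By periodicity the exceptional points lie in countably many integer translates of a null
  set that covers those in the cube.\<close>

lemma AE_lborel_of_torus:
  fixes P :: "'a::euclidean_space \<Rightarrow> bool"
  assumes AE: "AE x in torus. P x" and per: "periodic P"
  shows "AE x in lborel. P x"
proof -
  have "AE x in lborel. x \<in> unit_cube \<longrightarrow> P x"
    using AE unfolding torus_def by (subst (asm) AE_density) (auto simp: indicator_def)
  then obtain N where N: "{x. \<not> (x \<in> unit_cube \<longrightarrow> P x)} \<subseteq> N" "N \<in> null_sets lborel"
    by (auto simp: eventually_ae_filter)
  have "AE x in lborel. x + z \<notin> N" for z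
  proof -
    have [measurable]: "N \<in> sets borel" using N(2) by auto
    have "AE x in distr lborel borel ((+) z). x \<notin> N"
      using AE_not_in[OF N(2)] unfolding lborel_distr_plus .
    then show ?thesis by (subst (asm) AE_distr_iff) (auto simp: add.commute)
  qed
  then have "AE x in lborel. \<forall>z\<in>int_points. x + z \<notin> N"
    by (intro AE_ball_countable[OF countable_int_points, THEN iffD2]) auto
  then show ?thesis
  proof (rule AE_mp, intro AE_I2 impI)
    fix x :: 'a assume x: "\<forall>z\<in>int_points. x + z \<notin> N"
    obtain z where z: "z \<in> int_points" "x + z \<in> unit_cube"
      using int_translate_unit_cube_unique by blast
    then have "P (x + z)" using x N(1) by blast
    then show "P x" using per z(1) by (auto simp: periodic_def)
  qed
qed

section \<open>A zero-one law for rational translations\<close>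

lemma rational_translates_dense:
  fixes t :: "'a::euclidean_space"
  obtains z where "\<And>n::nat. z n \<in> (int_points :: 'a set)" "(\<lambda>n. z n /\<^sub>R real (Suc n)) \<longlonglongrightarrow> t"
proof -
  define z where "z n = (\<Sum>b\<in>Basis. of_int \<lfloor>real (Suc n) * (t \<bullet> b)\<rfloor> *\<^sub>R b)" for n
  have zb: "z n \<bullet> b = of_int \<lfloor>real (Suc n) * (t \<bullet> b)\<rfloor>" if "b \<in> Basis" for n b
    using that unfolding z_def by (rule inner_sum_left_Basis)
  have "(\<lambda>n. z n /\<^sub>R real (Suc n)) \<longlonglongrightarrow> t"
  proof (rule tendsto_componentwise_iff[THEN iffD2], rule ballI)
    fix b :: 'a assume b: "b \<in> Basis"
    have "(\<lambda>n. inverse (real (Suc n)) * of_int \<lfloor>real (Suc n) * (t \<bullet> b)\<rfloor>) \<longlonglongrightarrow> t \<bullet> b"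
    proof (rule tendsto_sandwich)
      show "\<forall>\<^sub>F n in sequentially. t \<bullet> b - inverse (real (Suc n))
          \<le> inverse (real (Suc n)) * of_int \<lfloor>real (Suc n) * (t \<bullet> b)\<rfloor>"
      proof (rule always_eventually, rule allI)
        fix n
        have "real (Suc n) * (t \<bullet> b) - 1 \<le> of_int \<lfloor>real (Suc n) * (t \<bullet> b)\<rfloor>" by linarith
        from mult_left_mono[OF this, of "inverse (real (Suc n))"]
        show "t \<bullet> b - inverse (real (Suc n)) \<le> inverse (real (Suc n)) * of_int \<lfloor>real (Suc n) * (t \<bullet> b)\<rfloor>"
          by (simp add: right_diff_distrib flip: mult.assoc del: of_nat_Suc)
      qed
      show "\<forall>\<^sub>F n in sequentially.
          inverse (real (Suc n)) * of_int \<lfloor>real (Suc n) * (t \<bullet> b)\<rfloor> \<le> t \<bullet> b"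
      proof (rule always_eventually, rule allI)
        fix n
        have "of_int \<lfloor>real (Suc n) * (t \<bullet> b)\<rfloor> \<le> real (Suc n) * (t \<bullet> b)" by linarith
        from mult_left_mono[OF this, of "inverse (real (Suc n))"]
        show "inverse (real (Suc n)) * of_int \<lfloor>real (Suc n) * (t \<bullet> b)\<rfloor> \<le> t \<bullet> b"
          by (simp flip: mult.assoc del: of_nat_Suc)
      qed
      show "(\<lambda>n. t \<bullet> b - inverse (real (Suc n))) \<longlonglongrightarrow> t \<bullet> b"
        using tendsto_diff[OF tendsto_const LIMSEQ_inverse_real_of_nat] by simp
    qed auto
    then show "(\<lambda>n. (z n /\<^sub>R real (Suc n)) \<bullet> b) \<longlonglongrightarrow> t \<bullet> b"
      using b by (simp add: zb)
  qed
  moreover have "z n \<in> int_points" for n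
    by (simp add: int_points_def zb)
  ultimately show ?thesis using that by blast
qed

text \<open>For \<open>t = z / (n + 1)\<close> equality holds by invariance, and every
  \<open>t\<close> is a limit of such translations. Openness makes the indicator of \<open>U\<close>
  lower semicontinuous, so Fatou's lemma gives the inequality in the limit.\<close>

lemma rational_invariant_open_inter_le:
  fixes W :: "'a::euclidean_space set"
  assumes [measurable]: "W \<in> sets borel"
    and inv: "\<And>n z x. z \<in> int_points \<Longrightarrow> x + z /\<^sub>R real (Suc n) \<in> W \<longleftrightarrow> x \<in> W"
    and "open U"
  shows "(\<integral>\<^sup>+x. indicator W (x + t) * indicator U x \<partial>lborel) \<le> emeasure lborel (W \<inter> U)"
proof -
  have [measurable]: "U \<in> sets borel" using \<open>open U\<close> by auto
  let ?f = "indicator W :: 'a \<Rightarrow> ennreal" and ?u = "indicator U :: 'a \<Rightarrow> ennreal"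
  obtain z where z: "\<And>n. z n \<in> (int_points :: 'a set)" "(\<lambda>n. z n /\<^sub>R real (Suc n)) \<longlonglongrightarrow> t"
    using rational_translates_dense[of t] by blast
  define s where "s n = z n /\<^sub>R real (Suc n)" for n
  have eq: "(\<integral>\<^sup>+x. ?f x * ?u (x - s n) \<partial>lborel) = emeasure lborel (W \<inter> U)" for n
  proof -
    have "(\<integral>\<^sup>+x. ?f x * ?u (x - s n) \<partial>lborel) = (\<integral>\<^sup>+x. ?f (x + s n) * ?u (x + s n - s n) \<partial>lborel)"
      by (rule nn_integral_lborel_translate[symmetric]) measurable
    also have "\<dots> = (\<integral>\<^sup>+x. indicator (W \<inter> U) x \<partial>lborel)"
      using inv[OF z(1)] by (intro nn_integral_cong) (simp add: s_def indicator_def)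
    finally show ?thesis by simp
  qed
  have "(\<integral>\<^sup>+x. ?f (x + t) * ?u x \<partial>lborel) = (\<integral>\<^sup>+x. ?f x * ?u (x - t) \<partial>lborel)"
    using nn_integral_lborel_translate[of "\<lambda>x. ?f x * ?u (x - t)" t] by simp
  also have "\<dots> \<le> (\<integral>\<^sup>+x. liminf (\<lambda>n. ?f x * ?u (x - s n)) \<partial>lborel)"
  proof (rule nn_integral_mono)
    fix x :: 'a
    show "?f x * ?u (x - t) \<le> liminf (\<lambda>n. ?f x * ?u (x - s n))"
    proof (cases "x - t \<in> U")
      case True
      have "(\<lambda>n. x - s n) \<longlonglongrightarrow> x - t"
        unfolding s_def by (intro tendsto_diff tendsto_const z(2))
      then have "\<forall>\<^sub>F n in sequentially. x - s n \<in> U"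
        using \<open>open U\<close> True by (rule topological_tendstoD)
      then have "\<forall>\<^sub>F n in sequentially. ?f x * ?u (x - t) \<le> ?f x * ?u (x - s n)"
        by eventually_elim (use True in simp)
      then show ?thesis by (rule Liminf_bounded)
    qed auto
  qed
  also have "\<dots> \<le> liminf (\<lambda>n. \<integral>\<^sup>+x. ?f x * ?u (x - s n) \<partial>lborel)"
    by (rule nn_integral_liminf) measurable
  also have "\<dots> = emeasure lborel (W \<inter> U)"
    by (simp add: eq Liminf_const)
  finally show ?thesis .
qed

text \<open>Averaging the preceding inequality over \<open>t\<close> yields
  \<open>|W| |U| \<le> |W \<inter> U|\<close> for every open \<open>U\<close>, which does the work
  of the Lebesgue density theorem. If \<open>U\<close> barely exceeds the complement of
  \<open>W\<close> in the cube, the right side is tiny; as \<open>|W|\<close> is positive, that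
  complement is null.\<close>

lemma torus_zero_one_rational:
  fixes W :: "'a::euclidean_space set"
  assumes [measurable]: "W \<in> sets borel"
    and inv: "\<And>n z x. z \<in> int_points \<Longrightarrow> x + z /\<^sub>R real (Suc n) \<in> W \<longleftrightarrow> x \<in> W"
    and pos: "emeasure torus W \<noteq> 0"
  shows "AE x in torus. x \<in> W"
proof -
  interpret a: sigma_finite_measure "torus :: 'a measure" by (rule sigma_finite_torus)
  interpret ab: pair_sigma_finite "lborel :: 'a measure" "torus :: 'a measure" ..
  let ?f = "indicator W :: 'a \<Rightarrow> ennreal"
  have one: "emeasure torus (UNIV :: 'a set) = 1"
    using prob_space.emeasure_space_1[OF prob_space_torus] by simp
  have per: "periodic ?f"
    using inv[of _ _ 0] by (auto simp: periodic_def indicator_def)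
  have bound: "emeasure torus W * emeasure lborel U \<le> emeasure lborel (W \<inter> U)" if "open U" for U
  proof -
    have [measurable]: "U \<in> sets borel" using \<open>open U\<close> by auto
    let ?u = "indicator U :: 'a \<Rightarrow> ennreal"
    have "emeasure torus W * emeasure lborel U
        = (\<integral>\<^sup>+x. ?u x * (\<integral>\<^sup>+t. ?f (t + x) \<partial>torus) \<partial>lborel)"
      by (simp add: nn_integral_torus_translate[OF _ per] nn_integral_multc mult.commute)
    also have "\<dots> = (\<integral>\<^sup>+x. \<integral>\<^sup>+t. ?f (x + t) * ?u x \<partial>torus \<partial>lborel)"
      by (subst nn_integral_cmult[symmetric]) (auto simp: add.commute mult.commute)
    also have "\<dots> = (\<integral>\<^sup>+t. \<integral>\<^sup>+x. ?f (x + t) * ?u x \<partial>lborel \<partial>torus)"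
      by (rule ab.Fubini'[symmetric]) measurable
    also have "\<dots> \<le> (\<integral>\<^sup>+t. emeasure lborel (W \<inter> U) \<partial>(torus :: 'a measure))"
      by (intro nn_integral_mono rational_invariant_open_inter_le assms that)
    also have "\<dots> = emeasure lborel (W \<inter> U)"
      by (simp add: one)
    finally show ?thesis .
  qed
  let ?X = "unit_cube - W"
  have "emeasure torus W * emeasure lborel ?X \<le> 0"
  proof (rule ennreal_le_epsilon)
    fix e :: real assume "0 < e"
    obtain U where U: "open U" "?X \<subseteq> U" "emeasure lborel (U - ?X) < e"
      using outer_regular_lborel[of ?X e] \<open>0 < e\<close> by auto
    have [measurable]: "U \<in> sets borel" using U(1) by auto
    have "emeasure torus W * emeasure lborel ?X \<le> emeasure torus W * emeasure lborel U"
      using U(2) by (intro mult_left_mono emeasure_mono) auto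
    also have "\<dots> \<le> emeasure lborel (W \<inter> U)" by (rule bound[OF U(1)])
    also have "\<dots> \<le> emeasure lborel (U - ?X)" by (intro emeasure_mono) auto
    also have "\<dots> \<le> e" using U(3) by simp
    finally show "emeasure torus W * emeasure lborel ?X \<le> 0 + ennreal e" by simp
  qed
  then have "emeasure torus (- W) = 0"
    using pos by (subst emeasure_torus) (auto simp: Diff_eq)
  then show ?thesis
    by (subst AE_iff_measurable[of "- W"]) auto
qed

section \<open>Product sets and independence of linear images\<close>

lemma unit_cube_real: "unit_cube = {0..<1::real}"
  by (auto simp: unit_cube_def)

lemma emeasure_torus_Basis:
  assumes [measurable]: "\<And>b. b \<in> Basis \<Longrightarrow> A b \<in> sets borel"
  shows "emeasure torus {x::'a::euclidean_space. \<forall>b\<in>Basis. x \<bullet> b \<in> A b}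
    = (\<Prod>b\<in>(Basis :: 'a set). emeasure (torus :: real measure) (A b))"
proof -
  have [measurable]: "{x::'a. \<forall>b\<in>Basis. x \<bullet> b \<in> A b} \<in> sets borel" by measurable
  have "emeasure torus {x::'a. \<forall>b\<in>Basis. x \<bullet> b \<in> A b}
      = (\<integral>\<^sup>+x. indicator (unit_cube \<inter> {x::'a. \<forall>b\<in>Basis. x \<bullet> b \<in> A b}) x \<partial>lborel)"
    by (simp add: emeasure_torus)
  also have "\<dots> = (\<integral>\<^sup>+x. (\<Prod>b\<in>Basis. indicator ({0..<1} \<inter> A b) (x \<bullet> b)) \<partial>(lborel :: 'a measure))"
    by (intro nn_integral_cong) (auto simp: unit_cube_def indicator_def)
  also have "\<dots> = (\<Prod>b\<in>(Basis :: 'a set). emeasure (torus :: real measure) (A b))"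
    by (subst nn_integral_lborel_prod) (auto simp: emeasure_torus unit_cube_real)
  finally show ?thesis .
qed

lemma measure_torus_vec:
  fixes A :: "'m::finite \<Rightarrow> real set"
  assumes A: "\<And>j. A j \<in> sets borel"
  shows "measure torus {x :: real ^ 'm. \<forall>j. x $ j \<in> A j} = (\<Prod>j\<in>UNIV. measure torus (A j))"
proof -
  interpret r: prob_space "torus :: real measure" by (rule prob_space_torus)
  interpret v: prob_space "torus :: (real ^ 'm) measure" by (rule prob_space_torus)
  \<comment> \<open>The product formula is indexed by basis vectors; \<open>THE\<close> recovers the
    coordinate \<open>j\<close> from \<open>axis j 1\<close>.\<close>
  define A' where "A' b = A (THE j. b = axis j 1)" for b :: "real ^ 'm"
  have A': "A' (axis j 1) = A j" for j
    by (simp add: A'_def axis_eq_axis)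
  have B: "(Basis :: (real ^ 'm) set) = range (\<lambda>j. axis j 1)"
    by (auto simp: Basis_vec_def)
  have inj: "inj (\<lambda>j::'m. axis j (1::real))"
    by (auto simp: inj_on_def axis_eq_axis)
  have "{x :: real ^ 'm. \<forall>j. x $ j \<in> A j} = {x. \<forall>b\<in>Basis. x \<bullet> b \<in> A' b}"
    by (simp add: B A' cart_eq_inner_axis)
  then have "emeasure torus {x :: real ^ 'm. \<forall>j. x $ j \<in> A j}
      = (\<Prod>b\<in>(Basis :: (real ^ 'm) set). emeasure torus (A' b))"
    using A by (simp add: emeasure_torus_Basis A'_def)
  also have "\<dots> = (\<Prod>j\<in>UNIV. emeasure torus (A j))"
    by (simp add: B prod.reindex[OF inj] A')
  finally have "ennreal (measure torus {x :: real ^ 'm. \<forall>j. x $ j \<in> A j})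
      = ennreal (\<Prod>j\<in>UNIV. measure torus (A j))"
    by (simp add: r.emeasure_eq_measure v.emeasure_eq_measure prod_ennreal)
  then show ?thesis by (simp add: prod_nonneg)
qed

lemma measure_torus_Times:
  fixes A :: "'a::euclidean_space set" and B :: "'b::euclidean_space set"
  assumes [measurable]: "A \<in> sets borel" "B \<in> sets borel"
  shows "measure torus (A \<times> B) = measure torus A * measure torus B"
proof -
  interpret a: prob_space "torus :: 'a measure" by (rule prob_space_torus)
  interpret b: prob_space "torus :: 'b measure" by (rule prob_space_torus)
  interpret ab: prob_space "torus :: ('a \<times> 'b) measure" by (rule prob_space_torus)
  have U: "(unit_cube :: ('a \<times> 'b) set) = unit_cube \<times> unit_cube"
    by (auto simp: unit_cube_def Basis_prod_def ball_Un)
  have [measurable]: "A \<times> B \<in> sets borel"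
    by (metis assms borel_prod pair_measureI)
  have "emeasure torus (A \<times> B) = emeasure (lborel \<Otimes>\<^sub>M lborel) ((unit_cube \<inter> A) \<times> (unit_cube \<inter> B))"
    by (simp add: emeasure_torus U Times_Int_Times lborel_prod)
  also have "\<dots> = emeasure torus A * emeasure torus B"
    by (subst lborel.emeasure_pair_measure_Times) (auto simp: emeasure_torus)
  finally have "ennreal (measure torus (A \<times> B)) = ennreal (measure torus A * measure torus B)"
    by (simp add: a.emeasure_eq_measure b.emeasure_eq_measure ab.emeasure_eq_measure ennreal_mult')
  then show ?thesis by simp
qed

lemma linear_borel_measurable:
  fixes L :: "'a::euclidean_space \<Rightarrow> 'b::euclidean_space"
  shows "linear L \<Longrightarrow> L \<in> borel_measurable borel"
  by (intro borel_measurable_continuous_onI linear_continuous_on)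
     (simp add: linear_conv_bounded_linear)

lemma measure_torus_linear:
  fixes L :: "'a::euclidean_space \<Rightarrow> 'b::euclidean_space"
  assumes L: "linear L" "surj L" "L ` int_points \<subseteq> int_points"
    and [measurable]: "A \<in> sets borel" and per: "periodic (\<lambda>x. x \<in> A)"
  shows "measure torus {x. L x \<in> A} = measure torus A"
proof -
  note [measurable] = linear_borel_measurable[OF L(1)]
  have "periodic (indicator A :: 'b \<Rightarrow> ennreal)"
    using per by (auto simp: periodic_def indicator_def)
  from nn_integral_torus_linear[OF L _ this]
  have "(\<integral>\<^sup>+x. indicator A (L x) \<partial>torus) = emeasure torus A" by simp
  also have "(\<integral>\<^sup>+x. indicator A (L x) \<partial>torus) = (\<integral>\<^sup>+x. indicator {x. L x \<in> A} x \<partial>torus)"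
    by (intro nn_integral_cong) (auto simp: indicator_def)
  also have "\<dots> = emeasure torus {x. L x \<in> A}"
    by (intro nn_integral_indicator) measurable
  finally show ?thesis by (simp add: measure_def)
qed

text \<open>The source of the independence statements for linear forms below: the joint map
  \<open>(L, L')\<close> is onto the product space, so it preserves the measure of periodic sets,
  and the torus measure of a rectangle is a product.\<close>

lemma measure_torus_linear_pair:
  fixes L L' :: "'a::euclidean_space \<Rightarrow> 'b::euclidean_space"
  assumes L: "linear L" "L ` int_points \<subseteq> int_points" and L': "linear L'" "L' ` int_points \<subseteq> int_points"
    and surj: "\<And>y y'. \<exists>x. L x = y \<and> L' x = y'"
    and [measurable]: "A \<in> sets borel" "B \<in> sets borel"
    and per: "periodic (\<lambda>x. x \<in> A)" "periodic (\<lambda>x. x \<in> B)"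
  shows "measure torus {x. L x \<in> A \<and> L' x \<in> B} = measure torus A * measure torus B"
proof -
  have [measurable]: "A \<times> B \<in> sets borel"
    by (metis assms(6,7) borel_prod pair_measureI)
  have *: "fst z \<in> int_points \<and> snd z \<in> int_points" if "z \<in> (int_points :: ('b \<times> 'b) set)" for z
    using that by (cases z) (auto simp: int_points_def Basis_prod_def ball_Un)
  have "measure torus {x. (L x, L' x) \<in> A \<times> B} = measure torus (A \<times> B)"
  proof (rule measure_torus_linear)
    show "linear (\<lambda>x. (L x, L' x))"
      using L(1) L'(1) by (auto simp: linear_iff)
    show "surj (\<lambda>x. (L x, L' x))"
      unfolding surj_def
    proof
      fix y :: "'b \<times> 'b"
      show "\<exists>x. y = (L x, L' x)" using surj[of "fst y" "snd y"] by (metis prod.collapse)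
    qed
    show "(\<lambda>x. (L x, L' x)) ` int_points \<subseteq> int_points"
      using L(2) L'(2) by (auto simp: int_points_def Basis_prod_def image_subset_iff)
    show "periodic (\<lambda>x. x \<in> A \<times> B)"
      using per * by (auto simp: periodic_def mem_Times_iff)
  qed measurable
  then show ?thesis by (simp add: measure_torus_Times)
qed

section \<open>Distance to the nearest integer and boxes around integer points\<close>

lemma nearest_int_dist_le: "nearest_int_dist x \<le> \<bar>x - of_int k\<bar>"
  unfolding nearest_int_dist_def by (simp add: round_diff_minimal)

lemma nearest_int_dist_add_of_int [simp]: "nearest_int_dist (x + of_int k) = nearest_int_dist x"
proof -
  have "x + of_int k + 1 / 2 = (x + 1 / 2) + of_int k" by simp
  then have "round (x + of_int k) = round x + k"
    unfolding round_def by (simp only: floor_add_int)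
  then show ?thesis by (simp add: nearest_int_dist_def)
qed

lemma nearest_int_dist_nonneg [simp]: "0 \<le> nearest_int_dist x"
  by (simp add: nearest_int_dist_def)

lemma nearest_int_dist_measurable [measurable]: "nearest_int_dist \<in> borel_measurable borel"
  unfolding nearest_int_dist_def[abs_def] round_def by measurable

text \<open>In the cube the set consists of \<open>[0, r]\<close> and \<open>[1 - r, 1)\<close>. The
  lower bound keeps only the first interval, since constant factors do not matter later.\<close>

lemma measure_nearest_int_dist_bounds:
  assumes "0 \<le> r" "r \<le> 1 / 2"
  shows "r \<le> measure torus {x. nearest_int_dist x \<le> r}" "measure torus {x. nearest_int_dist x \<le> r} \<le> 2 * r"
proof -
  interpret r: prob_space "torus :: real measure" by (rule prob_space_torus)
  have m: "measure torus {x. nearest_int_dist x \<le> r} = measure lborel ({0..<1} \<inter> {x. nearest_int_dist x \<le> r})"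
    by (simp add: measure_def emeasure_torus unit_cube_real)
  have f: "{0..<1} \<inter> {x. nearest_int_dist x \<le> r} \<in> fmeasurable lborel"
  proof (rule fmeasurableI2[of "{0..1}"])
    show "{0..<1} \<inter> {x. nearest_int_dist x \<le> r} \<in> sets lborel" by simp
  qed (auto simp: fmeasurable_def)
  have "measure lborel {0..r} \<le> measure lborel ({0..<1} \<inter> {x. nearest_int_dist x \<le> r})"
  proof (intro measure_mono_fmeasurable f)
    show "{0..r} \<subseteq> {0..<1} \<inter> {x. nearest_int_dist x \<le> r}"
    proof
      fix x assume "x \<in> {0..r}"
      then show "x \<in> {0..<1} \<inter> {x. nearest_int_dist x \<le> r}"
        using assms nearest_int_dist_le[of x 0] by auto
    qed
  qed auto
  then show "r \<le> measure torus {x. nearest_int_dist x \<le> r}" using assms m by simp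
  have "{0..<1} \<inter> {x. nearest_int_dist x \<le> r} \<subseteq> {0..r} \<union> {1-r..1}"
  proof
    fix x assume x: "x \<in> {0..<1} \<inter> {x. nearest_int_dist x \<le> r}"
    then have "\<bar>x - of_int (round x)\<bar> \<le> r" "0 \<le> x" "x < 1" by (auto simp: nearest_int_dist_def)
    moreover have "round x = 0 \<or> round x = 1"
      using x unfolding round_def by (auto, linarith)
    ultimately show "x \<in> {0..r} \<union> {1-r..1}" by auto
  qed
  then have "measure lborel ({0..<1} \<inter> {x. nearest_int_dist x \<le> r}) \<le> measure lborel ({0..r} \<union> {1-r..1})"
    using assms by (intro measure_mono_fmeasurable fmeasurable.Un) (auto simp: fmeasurable_def)
  also have "\<dots> \<le> measure lborel {0..r} + measure lborel {1-r..1}"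
    by (intro measure_Un_le) auto
  also have "\<dots> \<le> 2 * r" using assms by simp
  finally show "measure torus {x. nearest_int_dist x \<le> r} \<le> 2 * r" using m by simp
qed

definition near_int_box :: "('m::finite \<Rightarrow> real) \<Rightarrow> (real ^ 'm) set" where
  "near_int_box r = {x. \<forall>j. nearest_int_dist (x $ j) \<le> r j}"

lemma near_int_box_borel [measurable]:
  fixes r :: "'m::finite \<Rightarrow> real"
  shows "near_int_box r \<in> sets borel"
proof -
  have "(\<lambda>x :: real ^ 'm. x $ j) \<in> borel_measurable borel" for j :: 'm
    by (intro borel_measurable_continuous_onI continuous_intros)
  note [measurable] = this
  show ?thesis unfolding near_int_box_def by measurable
qed

lemma int_points_vec: "z \<in> (int_points :: (real ^ 'm::finite) set) \<longleftrightarrow> (\<forall>j. z $ j \<in> \<int>)"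
  by (auto simp: int_points_def Basis_vec_def cart_eq_inner_axis)

lemma periodic_near_int_box: "periodic (\<lambda>x. x \<in> near_int_box r)"
  by (auto simp: periodic_def near_int_box_def int_points_vec elim!: Ints_cases)
     (metis Ints_cases nearest_int_dist_add_of_int)+

lemma measure_near_int_box_bounds:
  assumes "\<And>j. 0 \<le> r j" "\<And>j. r j \<le> 1 / 2"
  shows "(\<Prod>j\<in>UNIV. r j) \<le> measure torus (near_int_box r)"
    "measure torus (near_int_box r) \<le> (\<Prod>j\<in>UNIV. 2 * r j)"
proof -
  have "measure torus (near_int_box r) = (\<Prod>j\<in>UNIV. measure torus {x. nearest_int_dist x \<le> r j})"
    using measure_torus_vec[of "\<lambda>j. {x. nearest_int_dist x \<le> r j}"] by (simp add: near_int_box_def)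
  then show "(\<Prod>j\<in>UNIV. r j) \<le> measure torus (near_int_box r)"
    "measure torus (near_int_box r) \<le> (\<Prod>j\<in>UNIV. 2 * r j)"
    using assms measure_nearest_int_dist_bounds by (auto intro!: prod_mono)
qed

section \<open>Second moments\<close>

text \<open>Cauchy-Schwarz for the counting function \<open>S\<close> and the indicator of the
  union, which equals 1 wherever \<open>S\<close> is nonzero. It is obtained from the nonnegative
  quadratic in \<open>l\<close> given by the mean square of
  \<open>l * S - indicator U\<close>.\<close>

lemma (in prob_space) second_moment_union:
  assumes fin: "finite I" and meas: "\<And>e. e \<in> I \<Longrightarrow> E e \<in> events"
  shows "(\<Sum>e\<in>I. prob (E e))\<^sup>2 \<le> (\<Sum>e\<in>I. \<Sum>e'\<in>I. prob (E e \<inter> E e')) * prob (\<Union>e\<in>I. E e)"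
proof -
  define U where "U = (\<Union>e\<in>I. E e)"
  define \<mu> where "\<mu> = (\<Sum>e\<in>I. prob (E e))"
  define s where "s = (\<Sum>e\<in>I. \<Sum>e'\<in>I. prob (E e \<inter> E e'))"
  define S :: "'a \<Rightarrow> real" where "S x = (\<Sum>e\<in>I. indicator (E e) x)" for x
  have U: "U \<in> events" unfolding U_def using fin meas by auto
  have int: "integrable M (indicator A :: 'a \<Rightarrow> real)" "(\<integral>x. indicator A x \<partial>M) = prob A" if "A \<in> events" for A
    using that by (auto simp: emeasure_eq_measure)
  have key: "0 \<le> l\<^sup>2 * s - 2 * l * \<mu> + prob U" for l :: real
  proof -
    have "0 \<le> (\<integral>x. (l * S x - indicator U x)\<^sup>2 \<partial>M)" by simp
    also have "(\<integral>x. (l * S x - indicator U x)\<^sup>2 \<partial>M) =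
      (\<integral>x. l\<^sup>2 * (\<Sum>e\<in>I. \<Sum>e'\<in>I. indicator (E e \<inter> E e') x) - 2 * l * (\<Sum>e\<in>I. indicator (E e) x) + indicator U x \<partial>M)"
    proof (rule Bochner_Integration.integral_cong)
      fix x
      have 1: "(S x)\<^sup>2 = (\<Sum>e\<in>I. \<Sum>e'\<in>I. indicator (E e \<inter> E e') x)"
        by (simp add: S_def power2_eq_square sum_product indicator_inter_arith)
      have 2: "S x * indicator U x = S x"
        unfolding S_def sum_distrib_right by (intro sum.cong) (auto simp: U_def indicator_def)
      have 3: "(indicator U x :: real)\<^sup>2 = indicator U x" by (simp add: indicator_def)
      have "(l * S x - indicator U x)\<^sup>2 = l\<^sup>2 * (S x)\<^sup>2 - 2 * l * (S x * indicator U x) + (indicator U x)\<^sup>2"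
        by (simp add: power2_eq_square algebra_simps)
      then show "(l * S x - indicator U x)\<^sup>2 = l\<^sup>2 * (\<Sum>e\<in>I. \<Sum>e'\<in>I. indicator (E e \<inter> E e') x)
          - 2 * l * (\<Sum>e\<in>I. indicator (E e) x) + indicator U x"
        unfolding 2 3 unfolding 1 by (simp add: S_def)
    qed simp
    also have "\<dots> = l\<^sup>2 * s - 2 * l * \<mu> + prob U"
      using meas U by (simp add: int s_def \<mu>_def sets.Int)
    finally show ?thesis .
  qed
  have s0: "0 \<le> s" by (simp add: s_def sum_nonneg)
  have "\<mu>\<^sup>2 \<le> s * prob U"
  proof (cases "s = 0")
    case True
    have "prob (E e) = 0" if "e \<in> I" for e
    proof -
      have "prob (E e \<inter> E e) \<le> (\<Sum>e'\<in>I. prob (E e \<inter> E e'))"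
        using that fin by (intro member_le_sum) auto
      also have "\<dots> \<le> s"
        unfolding s_def using that fin by (intro member_le_sum) (auto intro: sum_nonneg)
      finally show ?thesis using True measure_nonneg[of M "E e"] by simp
    qed
    then show ?thesis by (simp add: \<mu>_def True)
  next
    case False
    then have "s > 0" using s0 by simp
    \<comment> \<open>The quadratic is smallest at \<open>l = \<mu> / s\<close>.\<close>
    have "0 \<le> (\<mu> / s)\<^sup>2 * s - 2 * (\<mu> / s) * \<mu> + prob U" by (rule key)
    also have "\<dots> = prob U - \<mu>\<^sup>2 / s"
      using \<open>s > 0\<close> by (simp add: power2_eq_square field_simps)
    finally show ?thesis using \<open>s > 0\<close> by (simp add: field_simps)
  qed
  then show ?thesis by (simp add: \<mu>_def s_def U_def)
qed

lemma sum_halving_le: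
  fixes f :: "nat \<Rightarrow> real"
  assumes "\<And>k. f (Suc k) \<le> f k / 2" "\<And>k. 0 \<le> f k"
  shows "(\<Sum>i\<in>{k..<N}. f i) \<le> 2 * f k"
proof -
  \<comment> \<open>The extra \<open>2 * f (k + n)\<close> pays for the remaining geometric tail and
    lets the induction close.\<close>
  have "(\<Sum>i\<in>{k..<k + n}. f i) + 2 * f (k + n) \<le> 2 * f k" for n
  proof (induction n)
    case (Suc n)
    have "f (Suc (k + n)) \<le> f (k + n) / 2" by (rule assms)
    then show ?case using Suc by simp
  qed simp
  from this[of "N - k"] show ?thesis
    using assms(2)[of k] assms(2)[of "k + (N - k)"] by (cases "k \<le> N") auto
qed

lemma not_summable_tail_unbounded:
  fixes a :: "nat \<Rightarrow> real"
  assumes "\<not> summable a" "\<And>k. 0 \<le> a k"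
  shows "\<exists>N. B \<le> (\<Sum>k\<in>{K..<N}. a k)"
proof (rule ccontr)
  assume "\<not> ?thesis"
  then have *: "(\<Sum>k\<in>{K..<N}. a k) < B" for N by (meson not_le)
  have "(\<Sum>k<n. a k) \<le> (\<Sum>k<K. a k) + B" for n
  proof -
    have "(\<Sum>k<n. a k) \<le> (\<Sum>k\<in>{..<K} \<union> {K..<n}. a k)"
      using assms(2) by (intro sum_mono2) auto
    also have "\<dots> = (\<Sum>k<K. a k) + (\<Sum>k\<in>{K..<n}. a k)" by (intro sum.union_disjoint) auto
    finally show ?thesis using *[of n] by simp
  qed
  then have "(\<Sum>k\<le>n. a k) \<le> (\<Sum>k<K. a k) + B" for n
    by (metis lessThan_Suc_atMost)
  then have "summable a"
    using assms(2) by (intro bounded_imp_summable[where B = "(\<Sum>k<K. a k) + B"])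
  then show False using assms(1) by simp
qed

text \<open>A quasi-independent converse to Borel-Cantelli. Let \<open>X\<close> be the sum of
  \<open>card (I k) * f k\<close> over a long range of levels. Pairs with distinct \<open>p\<close>
  contribute at most \<open>C * X^2\<close> to the second moment, pairs sharing \<open>p\<close> at
  most \<open>4 * C * X\<close>, and \<open>X \<ge> 4\<close> absorbs the latter into the former.
  The result does not involve \<open>f\<close>, which later permits rescaling the targets.\<close>

lemma (in prob_space) prob_infinitely_often_ge:
  fixes I :: "nat \<Rightarrow> 'i set" and E :: "nat \<Rightarrow> 'i \<Rightarrow> 'a set" and f :: "nat \<Rightarrow> real"
  assumes fin: "\<And>k. finite (I k)" and meas: "\<And>k p. p \<in> I k \<Longrightarrow> E k p \<in> events"
    and f: "\<And>k. 0 < f k" "\<And>k. f (Suc k) \<le> f k / 2" and c: "0 < c" "0 < C"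
    and lower: "\<And>k p. p \<in> I k \<Longrightarrow> c * f k \<le> prob (E k p)"
    and upper: "\<And>k p. p \<in> I k \<Longrightarrow> prob (E k p) \<le> C * f k"
    and pair: "\<And>k k' p p'. p \<in> I k \<Longrightarrow> p' \<in> I k' \<Longrightarrow> p \<noteq> p' \<Longrightarrow>
      prob (E k p \<inter> E k' p') \<le> C * f k * f k'"
    and div: "\<not> summable (\<lambda>k. real (card (I k)) * f k)"
  shows "c\<^sup>2 / (2 * C) \<le> prob (\<Inter>K. \<Union>k\<in>{K..}. \<Union>p\<in>I k. E k p)"
proof -
  define A where "A K = (\<Union>k\<in>{K..}. \<Union>p\<in>I k. E k p)" for K
  have A: "A K \<in> events" for K
    unfolding A_def using meas fin by (intro sets.countable_UN' sets.finite_UN) auto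
  have bound: "c\<^sup>2 / (2 * C) \<le> prob (A K)" for K
  proof -
    obtain N where N: "4 \<le> (\<Sum>k\<in>{K..<N}. real (card (I k)) * f k)"
      using not_summable_tail_unbounded[OF div, of 4 K] less_imp_le[OF f(1)] by auto
    define X where "X = (\<Sum>k\<in>{K..<N}. real (card (I k)) * f k)"
    define J where "J = Sigma {K..<N} I"
    have finJ: "finite J" unfolding J_def using fin by auto
    define G where "G e = E (fst e) (snd e)" for e
    have sumJ: "(\<Sum>e\<in>J. h (fst e) (snd e)) = (\<Sum>k\<in>{K..<N}. \<Sum>p\<in>I k. h k p)" for h :: "nat \<Rightarrow> 'i \<Rightarrow> real"
      unfolding J_def using fin by (subst sum.Sigma) (auto simp: case_prod_beta)
    have "c * X = (\<Sum>e\<in>J. c * f (fst e))"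
      using sumJ[of "\<lambda>k p. c * f k"] by (simp add: X_def sum_distrib_left ac_simps)
    also have "\<dots> \<le> (\<Sum>e\<in>J. prob (G e))"
      unfolding G_def J_def by (intro sum_mono lower) auto
    finally have mu: "c * X \<le> (\<Sum>e\<in>J. prob (G e))" .
    \<comment> \<open>Events with the same \<open>p\<close> at two levels are not independent; their
      intersection is bounded through the rarer event, the one at the later level.\<close>
    define d where "d e e' = (if snd e = snd e' then f (max (fst e) (fst e')) else 0)"
      for e e' :: "nat \<times> 'i"
    have "(\<Sum>e\<in>J. \<Sum>e'\<in>J. prob (G e \<inter> G e')) \<le> (\<Sum>e\<in>J. \<Sum>e'\<in>J. C * f (fst e) * f (fst e') + C * d e e')"
    proof (intro sum_mono)
      fix e e' assume e: "e \<in> J" "e' \<in> J"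
      show "prob (G e \<inter> G e') \<le> C * f (fst e) * f (fst e') + C * d e e'"
      proof (cases "snd e = snd e'")
        case True
        have "prob (G e \<inter> G e') \<le> prob (G e)" "prob (G e \<inter> G e') \<le> prob (G e')"
          using e meas by (auto simp: G_def J_def intro!: finite_measure_mono)
        moreover have "prob (G e) \<le> C * f (fst e)" "prob (G e') \<le> C * f (fst e')"
          using e by (auto simp: G_def J_def intro!: upper)
        ultimately have "prob (G e \<inter> G e') \<le> C * d e e'"
          using True by (auto simp: d_def max_def)
        moreover have "0 \<le> C * f (fst e) * f (fst e')"
          using c f(1)[of "fst e"] f(1)[of "fst e'"] by simp
        ultimately show ?thesis by linarith
      next
        case False
        then show ?thesis
          using e pair[of "snd e" "fst e" "snd e'" "fst e'"] by (auto simp: G_def J_def d_def)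
      qed
    qed
    also have "\<dots> = C * X\<^sup>2 + C * (\<Sum>e\<in>J. \<Sum>e'\<in>J. d e e')"
    proof -
      have "(\<Sum>e\<in>J. f (fst e)) = X"
        using sumJ[of "\<lambda>k p. f k"] by (simp add: X_def)
      then have "(\<Sum>e\<in>J. \<Sum>e'\<in>J. C * f (fst e) * f (fst e')) = C * X\<^sup>2"
        by (simp add: power2_eq_square sum_distrib_left[symmetric] sum_distrib_right[symmetric] mult.assoc)
      then show ?thesis by (simp add: sum.distrib sum_distrib_left)
    qed
    also have "(\<Sum>e\<in>J. \<Sum>e'\<in>J. d e e') \<le> 4 * X"
    proof -
      \<comment> \<open>Shared \<open>p\<close> are charged to the earlier level: there are at most
        \<open>card (I k)\<close> of them, each weighted by the later \<open>f k'\<close>. The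
        geometric sum over \<open>k'\<close> costs a factor 2 and the two orders of the levels
        another 2, hence \<open>4 * X\<close>.\<close>
      define u where "u k k' = (if k \<le> k' then real (card (I k)) * f k' else 0)" for k k'
      have "(\<Sum>e\<in>J. \<Sum>e'\<in>J. d e e')
          = (\<Sum>k\<in>{K..<N}. \<Sum>p\<in>I k. \<Sum>k'\<in>{K..<N}. \<Sum>p'\<in>I k'. if p = p' then f (max k k') else 0)"
        unfolding d_def
        using sumJ[of "\<lambda>k p. \<Sum>e'\<in>J. if p = snd e' then f (max k (fst e')) else 0"]
          sumJ[of "\<lambda>k' p'. if _ = p' then f (max _ k') else 0"] by simp
      also have "\<dots> = (\<Sum>k\<in>{K..<N}. \<Sum>k'\<in>{K..<N}. \<Sum>p\<in>I k. \<Sum>p'\<in>I k'. if p = p' then f (max k k') else 0)"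
        by (intro sum.cong refl sum.swap)
      also have "\<dots> \<le> (\<Sum>k\<in>{K..<N}. \<Sum>k'\<in>{K..<N}. u k k' + u k' k)"
      proof (intro sum_mono)
        fix k k'
        have "(\<Sum>p\<in>I k. \<Sum>p'\<in>I k'. if p = p' then f (max k k') else 0)
            = (\<Sum>p\<in>I k. if p \<in> I k' then f (max k k') else 0)"
          using fin by (intro sum.cong) (auto simp: sum.delta')
        also have "\<dots> = real (card (I k \<inter> I k')) * f (max k k')"
          using fin by (subst sum.inter_restrict[symmetric]) auto
        also have "\<dots> \<le> u k k' + u k' k"
        proof -
          have "card (I k \<inter> I k') \<le> card (I k)" "card (I k \<inter> I k') \<le> card (I k')"
            using fin by (auto intro: card_mono)
          then have "real (card (I k \<inter> I k')) * f (max k k') \<le> real (card (I k)) * f (max k k')"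
            "real (card (I k \<inter> I k')) * f (max k k') \<le> real (card (I k')) * f (max k k')"
            using f(1)[of "max k k'"] by (auto intro!: mult_right_mono)
          moreover have "0 \<le> u k k'" "0 \<le> u k' k"
            using less_imp_le[OF f(1)] by (auto simp: u_def)
          ultimately show ?thesis by (cases "k \<le> k'") (auto simp: u_def max_def)
        qed
        finally show "(\<Sum>p\<in>I k. \<Sum>p'\<in>I k'. if p = p' then f (max k k') else 0) \<le> u k k' + u k' k" .
      qed
      also have "\<dots> = 2 * (\<Sum>k\<in>{K..<N}. \<Sum>k'\<in>{K..<N}. u k k')"
        by (simp add: sum.distrib) (rule sum.swap)
      also have "\<dots> \<le> 2 * (\<Sum>k\<in>{K..<N}. real (card (I k)) * (2 * f k))"
      proof (intro mult_left_mono sum_mono)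
        fix k assume k: "k \<in> {K..<N}"
        have "(\<Sum>k'\<in>{K..<N}. u k k') = (\<Sum>k'\<in>{k..<N}. u k k')"
          using k by (intro sum.mono_neutral_right) (auto simp: u_def)
        also have "\<dots> = real (card (I k)) * (\<Sum>k'\<in>{k..<N}. f k')"
          by (simp add: u_def sum_distrib_left)
        also have "\<dots> \<le> real (card (I k)) * (2 * f k)"
          using f(2) less_imp_le[OF f(1)] by (intro mult_left_mono sum_halving_le) auto
        finally show "(\<Sum>k'\<in>{K..<N}. u k k') \<le> real (card (I k)) * (2 * f k)" .
      qed auto
      also have "\<dots> = 4 * X" by (simp add: X_def sum_distrib_left)
      finally show ?thesis .
    qed
    finally have s: "(\<Sum>e\<in>J. \<Sum>e'\<in>J. prob (G e \<inter> G e')) \<le> C * X\<^sup>2 + C * (4 * X)"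
      using c by simp
    have X4: "4 \<le> X" using N by (simp add: X_def)
    have GA: "(\<Union>e\<in>J. G e) \<subseteq> A K" unfolding J_def G_def A_def by fastforce
    have "c\<^sup>2 * X\<^sup>2 = (c * X)\<^sup>2" by (simp add: power_mult_distrib)
    also have "\<dots> \<le> (\<Sum>e\<in>J. prob (G e))\<^sup>2"
      using mu c X4 by (intro power_mono) auto
    also have "\<dots> \<le> (\<Sum>e\<in>J. \<Sum>e'\<in>J. prob (G e \<inter> G e')) * prob (\<Union>e\<in>J. G e)"
      using finJ meas by (intro second_moment_union) (auto simp: J_def G_def)
    also have "\<dots> \<le> (C * X\<^sup>2 + C * (4 * X)) * prob (A K)"
      using s c X4 by (intro mult_mono finite_measure_mono GA A) auto
    also have "\<dots> \<le> (2 * C * X\<^sup>2) * prob (A K)"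
    proof (rule mult_right_mono)
      have "4 * X \<le> X\<^sup>2" using X4 by (simp add: power2_eq_square)
      then have "C * (4 * X) \<le> C * X\<^sup>2" using c by (intro mult_left_mono) auto
      then show "C * X\<^sup>2 + C * (4 * X) \<le> 2 * C * X\<^sup>2" by simp
    qed simp
    finally have "c\<^sup>2 * X\<^sup>2 \<le> (2 * C * prob (A K)) * X\<^sup>2" by (simp add: ac_simps)
    then have "c\<^sup>2 \<le> 2 * C * prob (A K)" using X4 by simp
    then show ?thesis using c by (simp add: field_simps)
  qed
  have "decseq A"
    unfolding decseq_def A_def by (intro allI impI UN_mono) auto
  then have "(\<lambda>K. prob (A K)) \<longlonglongrightarrow> prob (\<Inter>K. A K)"
    using A by (intro finite_Lim_measure_decseq) auto
  then have "c\<^sup>2 / (2 * C) \<le> prob (\<Inter>K. A K)"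
    by (rule LIMSEQ_le_const) (use bound in auto)
  then show ?thesis by (simp add: A_def)
qed

section \<open>Primitive vectors and reduced fractions\<close>

text \<open>Telescoping with \<open>1 / (d - 1) - 1 / d\<close> from \<open>d = 3\<close> on, after
  the exact term 1/4 for \<open>d = 2\<close>. Because 3/4 is below 1, union bounds over divisors
  leave a positive proportion.\<close>

lemma sum_inverse_squares_le: "(\<Sum>d=2..D. 1 / (real d)\<^sup>2) \<le> 3 / 4"
proof -
  have "(\<Sum>d=2..D + 2. 1 / (real d)\<^sup>2) \<le> 3 / 4 - 1 / real (D + 2)" for D
  proof (induction D)
    case (Suc D)
    have "1 / (real (Suc D + 2))\<^sup>2 \<le> 1 / (real (D + 2) * real (D + 3))"
      unfolding power2_eq_square by (intro divide_left_mono mult_mono) auto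
    also have "\<dots> = 1 / real (D + 2) - 1 / real (Suc D + 2)"
      by (simp add: field_simps)
    finally have "1 / (real (Suc D + 2))\<^sup>2 \<le> 1 / real (D + 2) - 1 / real (Suc D + 2)" .
    then show ?case using Suc by simp
  qed simp
  from this[of "D - 2"] show ?thesis
  proof (cases "2 \<le> D")
    case True
    then have "D - 2 + 2 = D" by simp
    then show ?thesis using \<open>_ \<le> 3 / 4 - 1 / real (D - 2 + 2)\<close> by (smt (verit) divide_nonneg_nonneg of_nat_0_le_iff)
  qed auto
qed

lemma card_multiples_le:
  assumes "0 < (d::nat)"
  shows "real (card {x\<in>{1..r}. d dvd x}) \<le> real r / real d"
proof -
  have "{x\<in>{1..r}. d dvd x} \<subseteq> (\<lambda>k. d * k) ` {1..r div d}"
  proof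
    fix x assume "x \<in> {x\<in>{1..r}. d dvd x}"
    then obtain k where k: "x = d * k" "1 \<le> x" "x \<le> r" by auto
    then have "k \<le> r div d" using assms by (simp add: less_eq_div_iff_mult_less_eq mult.commute)
    moreover have "1 \<le> k" using k by (cases k) auto
    ultimately show "x \<in> (\<lambda>k. d * k) ` {1..r div d}" using k by auto
  qed
  then have "card {x\<in>{1..r}. d dvd x} \<le> card {1..r div d}"
    by (meson card_image_le card_mono finite_atLeastAtMost finite_imageI le_trans)
  then have "real (card {x\<in>{1..r}. d dvd x}) \<le> real (r div d)" by simp
  also have "\<dots> \<le> real r / real d" by (rule of_nat_div_le_of_nat)
  finally show ?thesis .
qed

text \<open>A vector that is not primitive has all entries divisible by some
  \<open>d \<ge> 2\<close>. At most a fraction \<open>1 / d^n\<close>, hence at most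
  \<open>1 / d^2\<close>, of the box is divisible by \<open>d\<close>, so the union bound removes at
  most 3/4 of it.\<close>

lemma card_primitive_ge:
  fixes r :: "'n::finite \<Rightarrow> nat"
  assumes n: "2 \<le> CARD('n)"
  shows "(\<Prod>i\<in>UNIV. real (r i)) / 4 \<le> real (card {p. (\<forall>i. p i \<in> {1..r i}) \<and> Gcd (range p) = 1})"
proof -
  define P where "P = {p :: 'n \<Rightarrow> nat. \<forall>i. p i \<in> {1..r i}}"
  define Q where "Q d = {p :: 'n \<Rightarrow> nat. \<forall>i. p i \<in> {x\<in>{1..r i}. d dvd x}}" for d
  \<comment> \<open>An arbitrary coordinate: the entries are positive, so the gcd is at most
    \<open>r i0\<close>, which makes the union over \<open>d\<close> finite.\<close>
  define i0 :: 'n where "i0 = undefined"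
  have PiE: "{p :: 'n \<Rightarrow> nat. \<forall>i. p i \<in> S i} = PiE UNIV S" for S by (auto simp: PiE_def Pi_def)
  have finP: "finite P" unfolding P_def PiE by (intro finite_PiE) auto
  have cardP: "real (card P) = (\<Prod>i\<in>UNIV. real (r i))"
    unfolding P_def PiE by (subst card_PiE) auto
  have cardQ: "real (card (Q d)) \<le> (\<Prod>i\<in>UNIV. real (r i)) * (1 / (real d)\<^sup>2)" if d: "d \<in> {2..r i0}" for d
  proof -
    have "real (card (Q d)) = (\<Prod>i\<in>UNIV. real (card {x\<in>{1..r i}. d dvd x}))"
      unfolding Q_def PiE by (subst card_PiE) auto
    also have "\<dots> \<le> (\<Prod>i\<in>UNIV. real (r i) / real d)"
      using d by (intro prod_mono conjI card_multiples_le) auto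
    also have "\<dots> = (\<Prod>i\<in>UNIV. real (r i)) * (1 / (real d) ^ CARD('n))"
      by (simp add: prod_dividef)
    also have "\<dots> \<le> (\<Prod>i\<in>UNIV. real (r i)) * (1 / (real d)\<^sup>2)"
      using d n by (intro mult_left_mono divide_left_mono power_increasing prod_nonneg mult_pos_pos zero_less_power) auto
    finally show ?thesis .
  qed
  let ?G = "{p. (\<forall>i. p i \<in> {1..r i}) \<and> Gcd (range p) = 1}"
  have sub: "P - ?G \<subseteq> (\<Union>d\<in>{2..r i0}. Q d)"
  proof
    fix p assume p: "p \<in> P - ?G"
    let ?d = "Gcd (range p)"
    have dvd: "?d dvd p i" for i by (rule Gcd_dvd) auto
    have pos: "1 \<le> p i" "p i \<le> r i" for i using p by (auto simp: P_def)
    have "?d \<le> r i0" using dvd[of i0] pos[of i0] by (meson dvd_imp_le le_trans less_le_trans zero_less_one)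
    moreover have "?d \<noteq> 0" using dvd[of i0] pos[of i0] by (metis dvd_0_left_iff not_one_le_zero)
    moreover have "?d \<noteq> 1" using p by (auto simp: P_def)
    ultimately have "2 \<le> ?d" "?d \<le> r i0" by linarith+
    then have "?d \<in> {2..r i0}" by simp
    moreover have "p \<in> Q ?d" using dvd pos by (auto simp: Q_def)
    ultimately show "p \<in> (\<Union>d\<in>{2..r i0}. Q d)" by blast
  qed
  have finQ: "finite (Q d)" for d unfolding Q_def PiE by (intro finite_PiE) auto
  have "card (P - ?G) \<le> (\<Sum>d\<in>{2..r i0}. card (Q d))"
    using card_mono[OF _ sub] card_UN_le[of "{2..r i0}" Q] finQ by (meson finite_UN finite_atLeastAtMost le_trans)
  then have "real (card (P - ?G)) \<le> (\<Sum>d\<in>{2..r i0}. real (card (Q d)))"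
    unfolding of_nat_sum[symmetric] of_nat_le_iff .
  also have "\<dots> \<le> (\<Sum>d\<in>{2..r i0}. (\<Prod>i\<in>UNIV. real (r i)) * (1 / (real d)\<^sup>2))"
    by (intro sum_mono cardQ)
  also have "\<dots> \<le> (\<Prod>i\<in>UNIV. real (r i)) * (3 / 4)"
    unfolding sum_distrib_left[symmetric] by (intro mult_left_mono sum_inverse_squares_le prod_nonneg) auto
  finally have 1: "real (card (P - ?G)) \<le> (\<Prod>i\<in>UNIV. real (r i)) * (3 / 4)" .
  have GP: "?G \<subseteq> P" by (auto simp: P_def)
  have "card P = card (P - ?G) + card ?G"
    using card_Diff_subset[OF finite_subset[OF GP finP] GP] card_mono[OF finP GP] by linarith
  then show ?thesis using 1 cardP by simp
qed

text \<open>Let \<open>N p\<close> count the residues not coprime to \<open>p\<close>. A union bound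
  over divisors gives that \<open>N p / p\<close> is at most the sum of \<open>1 / d\<close> over
  divisors \<open>d \<ge> 2\<close>; summed over \<open>p \<le> r\<close> this is at most
  \<open>3 * r / 4\<close>. A bad \<open>p\<close> has \<open>N p / p \<ge> 7 / 8\<close>, so at
  most \<open>6 * r / 7\<close> of them exist.\<close>

lemma card_large_coprime_ge:
  assumes r: "56 \<le> r"
  shows "real r / 8 \<le> real (card {p\<in>{2..r}. p \<le> 8 * card {s\<in>{1..<p}. coprime s p}})"
proof -
  define N where "N p = card {s\<in>{1..p}. \<not> coprime s p}" for p :: nat
  define G where "G = {p\<in>{2..r}. p \<le> 8 * card {s\<in>{1..<p}. coprime s p}}"
  have N: "real (N p) / real p \<le> (\<Sum>d\<in>{2..r}. if d dvd p then 1 / real d else 0)" if p: "p \<in> {1..r}" for p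
  proof -
    let ?D = "{d\<in>{2..r}. d dvd p}"
    have "{s\<in>{1..p}. \<not> coprime s p} \<subseteq> (\<Union>d\<in>?D. {s\<in>{1..p}. d dvd s})"
    proof
      fix s assume s: "s \<in> {s\<in>{1..p}. \<not> coprime s p}"
      have "gcd s p \<noteq> 1" using s by (auto simp: coprime_iff_gcd_eq_1)
      moreover have "gcd s p \<noteq> 0" using s by auto
      moreover have "gcd s p \<le> p" using p by (intro dvd_imp_le) auto
      ultimately have "2 \<le> gcd s p" "gcd s p \<le> p" by linarith+
      then have "gcd s p \<in> ?D" using p by (simp add: le_trans[of "gcd s p" p r])
      then show "s \<in> (\<Union>d\<in>?D. {s\<in>{1..p}. d dvd s})" using s by blast
    qed
    then have "N p \<le> card (\<Union>d\<in>?D. {s\<in>{1..p}. d dvd s})"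
      unfolding N_def by (intro card_mono) auto
    also have "\<dots> \<le> (\<Sum>d\<in>?D. card {s\<in>{1..p}. d dvd s})" by (intro card_UN_le) auto
    finally have "real (N p) \<le> (\<Sum>d\<in>?D. real (card {s\<in>{1..p}. d dvd s}))"
      unfolding of_nat_sum[symmetric] of_nat_le_iff .
    also have "\<dots> \<le> (\<Sum>d\<in>?D. real p / real d)" by (intro sum_mono card_multiples_le) auto
    also have "\<dots> = real p * (\<Sum>d\<in>?D. 1 / real d)" by (simp add: sum_distrib_left)
    also have "(\<Sum>d\<in>?D. 1 / real d) = (\<Sum>d\<in>{2..r}. if d dvd p then 1 / real d else 0)"
      by (rule sum.inter_filter) simp
    finally show ?thesis using p by (simp add: field_simps)
  qed
  have "(\<Sum>p\<in>{1..r}. real (N p) / real p) \<le> (\<Sum>p\<in>{1..r}. \<Sum>d\<in>{2..r}. if d dvd p then 1 / real d else 0)"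
    by (intro sum_mono N)
  also have "\<dots> = (\<Sum>d\<in>{2..r}. \<Sum>p\<in>{1..r}. if d dvd p then 1 / real d else 0)" by (rule sum.swap)
  also have "\<dots> \<le> (\<Sum>d\<in>{2..r}. real r * (1 / (real d)\<^sup>2))"
  proof (rule sum_mono)
    fix d assume d: "d \<in> {2..r}"
    have "(\<Sum>p\<in>{1..r}. if d dvd p then 1 / real d else 0) = real (card {p\<in>{1..r}. d dvd p}) * (1 / real d)"
      by (subst sum.inter_filter[symmetric]) auto
    also have "\<dots> \<le> (real r / real d) * (1 / real d)"
      using d by (intro mult_right_mono card_multiples_le) auto
    finally show "(\<Sum>p\<in>{1..r}. if d dvd p then 1 / real d else 0) \<le> real r * (1 / (real d)\<^sup>2)"
      by (simp add: power2_eq_square)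
  qed
  also have "\<dots> \<le> real r * (3 / 4)"
    unfolding sum_distrib_left[symmetric] by (intro mult_left_mono sum_inverse_squares_le) auto
  finally have total: "(\<Sum>p\<in>{1..r}. real (N p) / real p) \<le> real r * (3 / 4)" .
  have "real (card ({2..r} - G)) * (7 / 8) = (\<Sum>p\<in>{2..r} - G. 7 / 8)" by simp
  also have "\<dots> \<le> (\<Sum>p\<in>{2..r} - G. real (N p) / real p)"
  proof (rule sum_mono)
    fix p assume p: "p \<in> {2..r} - G"
    let ?A = "{s\<in>{1..<p}. coprime s p}"
    \<comment> \<open>Since \<open>p \<ge> 2\<close>, the end point \<open>s = p\<close> is not
      coprime to \<open>p\<close>.\<close>
    have "?A = {s\<in>{1..p}. coprime s p}" using p by (auto simp: le_less)
    moreover have "card {1..p} = card {s\<in>{1..p}. coprime s p} + N p"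
    proof -
      have "{1..p} = {s\<in>{1..p}. coprime s p} \<union> {s\<in>{1..p}. \<not> coprime s p}" by auto
      then have "card {1..p} = card ({s\<in>{1..p}. coprime s p} \<union> {s\<in>{1..p}. \<not> coprime s p})" by (rule arg_cong)
      also have "\<dots> = card {s\<in>{1..p}. coprime s p} + N p"
        unfolding N_def by (intro card_Un_disjoint) auto
      finally show ?thesis .
    qed
    ultimately have "p = card ?A + N p" by simp
    moreover have "8 * card ?A < p" using p by (auto simp: G_def)
    ultimately have "7 * p \<le> 8 * N p" by linarith
    then have "7 * real p \<le> 8 * real (N p)" by linarith
    then show "7 / 8 \<le> real (N p) / real p" using p by (simp add: field_simps)
  qed
  also have "\<dots> \<le> (\<Sum>p\<in>{1..r}. real (N p) / real p)" by (intro sum_mono2) auto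
  also note total
  finally have bad: "real (card ({2..r} - G)) \<le> real r * (6 / 7)" by simp
  have G: "G \<subseteq> {2..r}" by (auto simp: G_def)
  have "card {2..r} = card ({2..r} - G) + card G"
    using card_Diff_subset[OF finite_subset[OF G] G] card_mono[OF _ G] by simp
  then have "real (card G) = real r - 1 - real (card ({2..r} - G))" using r by simp
  also have "\<dots> \<ge> real r - 1 - real r * (6 / 7)" using bad by simp
  \<comment> \<open>\<open>r / 7 - 1 \<ge> r / 8\<close> says precisely that
    \<open>r \<ge> 56\<close>.\<close>
  also have "real r - 1 - real r * (6 / 7) \<ge> real r / 8" using r by simp
  finally show ?thesis by (simp add: G_def)
qed

text \<open>Needed only for \<open>n = 1\<close>, where distinct \<open>p\<close> do not give independent events; for \<open>n \<ge> 2\<close> distinct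
  primitive vectors do.\<close>

definition reduced_approx :: "nat \<Rightarrow> real \<Rightarrow> real set" where
  "reduced_approx p \<psi> = {x. \<exists>s::int. coprime s (int p) \<and> \<bar>real p * x - of_int s\<bar> \<le> \<psi>}"

lemma reduced_approx_borel [measurable]: "reduced_approx p \<psi> \<in> sets borel"
  unfolding reduced_approx_def by measurable

lemma reduced_approx_subset: "reduced_approx p \<psi> \<subseteq> {x. nearest_int_dist (real p * x) \<le> \<psi>}"
  unfolding reduced_approx_def using nearest_int_dist_le by (auto intro: order_trans)

text \<open>The intervals of radius \<open>\<psi> / p\<close> around the reduced fractions
  \<open>s / p\<close> are disjoint and stay inside the unit interval, both because
  \<open>\<psi> < 1 / 2\<close>.\<close>

lemma measure_reduced_approx_ge:
  assumes p: "2 \<le> p" and \<psi>: "0 < \<psi>" "\<psi> < 1 / 2"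
  shows "real (card {s\<in>{1..<p}. coprime s p}) * (2 * \<psi> / real p) \<le> measure torus (reduced_approx p \<psi>)"
proof -
  interpret r: prob_space "torus :: real measure" by (rule prob_space_torus)
  let ?S = "{s\<in>{1..<p}. coprime s p}"
  define J where "J s = {(real s - \<psi>) / real p..(real s + \<psi>) / real p}" for s
  have disj: "disjoint_family_on J ?S"
    unfolding disjoint_family_on_def
  proof (intro ballI impI)
    fix s t assume "s \<in> ?S" "t \<in> ?S" "s \<noteq> t"
    then have "real s + 1 \<le> real t \<or> real t + 1 \<le> real s" by auto
    then show "J s \<inter> J t = {}"
      using p \<psi> by (auto simp: J_def divide_le_eq le_divide_eq mult.commute)
  qed
  have sub: "J s \<subseteq> {0..<1} \<inter> reduced_approx p \<psi>" if s: "s \<in> ?S" for s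
  proof
    fix x assume "x \<in> J s"
    then have x: "real s - \<psi> \<le> real p * x" "real p * x \<le> real s + \<psi>"
      using p by (auto simp: J_def field_simps)
    have s1: "1 \<le> real s" "real s + 1 \<le> real p" using s by auto
    have "0 < real p * x" using x s1 \<psi> by linarith
    then have "0 < x" using p by (simp add: zero_less_mult_iff)
    moreover have "real p * x < real p * 1" using x s1 \<psi> by linarith
    then have "x < 1" using p by (simp add: mult_less_cancel_left)
    moreover have "coprime (int s) (int p)" using s by simp
    moreover have "\<bar>real p * x - of_int (int s)\<bar> \<le> \<psi>" using x by (simp add: abs_le_iff)
    ultimately have "0 \<le> x" "x < 1" "\<exists>s. coprime s (int p) \<and> \<bar>real p * x - of_int s\<bar> \<le> \<psi>"
      by (simp, simp, blast)
    then show "x \<in> {0..<1} \<inter> reduced_approx p \<psi>"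
      by (simp add: reduced_approx_def)
  qed
  have "real (card ?S) * (2 * \<psi> / real p) = (\<Sum>s\<in>?S. measure lborel (J s))"
    using p \<psi> by (simp add: J_def divide_right_mono diff_divide_distrib[symmetric])
  also have "\<dots> = measure lborel (\<Union>s\<in>?S. J s)"
    by (intro measure_finite_Union[symmetric] disj) (auto simp: J_def emeasure_lborel_Icc_eq)
  also have "\<dots> \<le> measure lborel ({0..<1} \<inter> reduced_approx p \<psi>)"
  proof (rule measure_mono_fmeasurable)
    show "(\<Union>s\<in>?S. J s) \<in> sets lborel" by (auto simp: J_def)
    show "{0..<1} \<inter> reduced_approx p \<psi> \<in> fmeasurable lborel"
      by (rule fmeasurableI2[of "{0..1}"]) (auto simp: fmeasurable_def)
  qed (use sub in blast)
  also have "\<dots> = measure torus (reduced_approx p \<psi>)"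
    by (simp add: measure_def emeasure_torus unit_cube_real)
  finally show ?thesis .
qed

text \<open>With \<open>d = gcd p p'\<close> the difference \<open>s * p' - s' * p\<close> is
  \<open>d * v\<close>, where \<open>v\<close> is nonzero and \<open>|v| \<le> D / d\<close>. Each
  \<open>v\<close> comes from at most \<open>d\<close> pairs, so the factor \<open>d\<close>
  cancels. Excluding \<open>v = 0\<close> is essential: coinciding fractions cannot be bounded in
  terms of \<open>D\<close>.\<close>

lemma card_close_fraction_pairs_le:
  fixes p p' :: int and D :: real
  assumes p: "0 < p" "0 < p'" and D: "0 \<le> D"
  defines "Q \<equiv> {(s, s'). s \<in> {1..<p} \<and> s' \<in> {1..<p'} \<and> s * p' \<noteq> s' * p \<and>
      \<bar>of_int (s * p' - s' * p)\<bar> \<le> D}"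
  shows "finite Q" "real (card Q) \<le> 2 * D"
proof -
  have "Q \<subseteq> {1..<p} \<times> {1..<p'}" by (auto simp: Q_def)
  then show "finite Q" by (rule finite_subset) auto
  define d where "d = gcd p p'"
  have d: "0 < d" using p by (simp add: d_def)
  have "gcd p p' \<noteq> 0" using d by (simp add: d_def)
  from gcd_coprime_exists[OF this, folded d_def]
  obtain e e' where e: "p = e * d" "p' = e' * d" "coprime e e'" by blast
  have e0: "0 < e" "0 < e'" using e p d by (auto simp: zero_less_mult_iff)
  define m where "m = \<lfloor>D / of_int d\<rfloor>"
  have m: "0 \<le> m" using D d by (simp add: m_def)
  \<comment> \<open>The first component determines \<open>s\<close> modulo \<open>e\<close>, since
    \<open>e\<close> and \<open>e'\<close> are coprime; the block index \<open>s div e\<close> has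
    only \<open>d\<close> possible values because \<open>s < e * d\<close>.\<close>
  define \<phi> where "\<phi> = (\<lambda>(s, s'). (s * e' - s' * e, s div e))"
  have "inj_on \<phi> Q"
  proof (rule inj_onI, clarify)
    fix s t s' t' assume "\<phi> (s, t) = \<phi> (s', t')"
    then have eq: "s * e' - t * e = s' * e' - t' * e" "s div e = s' div e" by (auto simp: \<phi>_def)
    then have eq': "(s - s') * e' = (t - t') * e" by (simp add: algebra_simps)
    then have "e dvd (s - s') * e'" by simp
    then have "e dvd s - s'" using e(3) by (simp add: coprime_dvd_mult_left_iff)
    then have "s mod e = s' mod e" by (simp add: mod_eq_dvd_iff)
    then have "s = s'" using eq(2) by (metis mult_div_mod_eq)
    moreover from this have "t = t'" using eq' e0 by simp
    ultimately show "s = s' \<and> t = t'" by simp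
  qed
  moreover have "\<phi> ` Q \<subseteq> (({-m..m} - {0}) \<times> {0..<d})"
  proof
    fix y assume "y \<in> \<phi> ` Q"
    then obtain s t where y: "y = \<phi> (s, t)"
      and st: "s \<in> {1..<p}" "t \<in> {1..<p'}" "s * p' \<noteq> t * p" "\<bar>of_int (s * p' - t * p)\<bar> \<le> D"
      by (auto simp: Q_def)
    have v: "s * p' - t * p = d * (s * e' - t * e)" by (simp add: e algebra_simps)
    have "of_int d * \<bar>of_int (s * e' - t * e)\<bar> \<le> D"
      using st(4) d unfolding v by (simp add: abs_mult)
    then have "of_int \<bar>s * e' - t * e\<bar> \<le> D / of_int d" using d by (simp add: field_simps)
    then have "\<bar>s * e' - t * e\<bar> \<le> m" unfolding m_def by (simp add: le_floor_iff)
    moreover have "s * e' - t * e \<noteq> 0" using st(3) v by auto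
    moreover have "0 \<le> s div e" using st e0 by (simp add: pos_imp_zdiv_nonneg_iff)
    moreover have "s div e < d"
    proof -
      have "e * (s div e) = s - s mod e" by (simp add: minus_mod_eq_mult_div)
      also have "\<dots> < e * d" using st(1) e(1) pos_mod_sign[OF e0(1), of s] by auto
      finally show ?thesis using e0 by simp
    qed
    ultimately show "y \<in> ({-m..m} - {0}) \<times> {0..<d}" by (auto simp: y \<phi>_def)
  qed
  ultimately have "card Q \<le> card (({-m..m} - {0}) \<times> {0..<d})"
    by (intro card_inj_on_le[of \<phi>]) auto
  also have "\<dots> = nat (2 * m) * nat d"
  proof -
    have "nat (2 * m + 1) - Suc 0 = nat (2 * m)" using m by linarith
    then show ?thesis using m by (simp add: card_cartesian_product card_Diff_singleton)
  qed
  finally have "real (card Q) \<le> real (nat (2 * m) * nat d)" by (simp only: of_nat_le_iff)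
  also have "\<dots> = 2 * (of_int m * of_int d)" using m d by simp
  also have "\<dots> \<le> 2 * D"
  proof -
    have "of_int m \<le> D / of_int d" unfolding m_def by linarith
    then show ?thesis using d by (simp add: field_simps)
  qed
  finally show "real (card Q) \<le> 2 * D" .
qed

text \<open>Quasi-independence for one row. If the intervals around \<open>s / p\<close> and
  \<open>s' / p'\<close> meet, then \<open>|s * p' - s' * p| \<le> D\<close>. Reducedness excludes
  equal fractions, so at most \<open>2 * D\<close> pairs remain, each contributing at most the
  shorter interval length \<open>w\<close>.\<close>

lemma measure_reduced_approx_Int_le:
  assumes p: "2 \<le> p" "2 \<le> p'" "p \<noteq> p'" and \<psi>: "0 < \<psi>" "\<psi> < 1 / 2" "0 < \<psi>'" "\<psi>' < 1 / 2"
  shows "measure torus (reduced_approx p \<psi> \<inter> reduced_approx p' \<psi>') \<le> 8 * \<psi> * \<psi>'"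
proof -
  define D where "D = \<psi> * real p' + \<psi>' * real p"
  define Q where "Q = {(s, s'). s \<in> {1..<int p} \<and> s' \<in> {1..<int p'} \<and> s * int p' \<noteq> s' * int p \<and>
      \<bar>real_of_int (s * int p' - s' * int p)\<bar> \<le> D}"
  have D: "0 \<le> D" using \<psi> by (simp add: D_def)
  have Q: "finite Q" "real (card Q) \<le> 2 * D"
    using card_close_fraction_pairs_le[of "int p" "int p'" D] p D by (auto simp: Q_def)
  define J where "J q \<phi> s = {(of_int s - \<phi>) / real q..(of_int s + \<phi>) / real q}" for q \<phi> and s :: int
  \<comment> \<open>The numerators 0 and \<open>q\<close> are possible by size, but not coprime to
    \<open>q \<ge> 2\<close>; no interval crosses the boundary of the cube.\<close>
  have range: "s \<in> {1..<int q}" if "coprime s (int q)" "\<bar>real q * x - of_int s\<bar> \<le> \<phi>" "0 \<le> x" "x < 1" "2 \<le> q" "\<phi> < 1 / 2"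
    for s q x \<phi>
  proof -
    have "0 \<le> real q * x" "real q * x < real q" using that by auto
    then have "- 1 < real_of_int s" "real_of_int s < real q + 1" using that by linarith+
    then have "0 \<le> s" "s \<le> int q" by linarith+
    moreover have "s \<noteq> 0" "s \<noteq> int q" using that by auto
    ultimately show ?thesis by auto
  qed
  have "{0..<1} \<inter> (reduced_approx p \<psi> \<inter> reduced_approx p' \<psi>') \<subseteq> (\<Union>(s, s')\<in>Q. J p \<psi> s \<inter> J p' \<psi>' s')"
  proof
    fix x assume x: "x \<in> {0..<1} \<inter> (reduced_approx p \<psi> \<inter> reduced_approx p' \<psi>')"
    then obtain s s' where s: "coprime s (int p)" "\<bar>real p * x - of_int s\<bar> \<le> \<psi>"
      and s': "coprime s' (int p')" "\<bar>real p' * x - of_int s'\<bar> \<le> \<psi>'"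
      by (auto simp: reduced_approx_def)
    \<comment> \<open>Equal fractions in lowest terms would have equal denominators.\<close>
    have "s * int p' \<noteq> s' * int p"
    proof
      assume eq: "s * int p' = s' * int p"
      have "int p dvd s * int p'" unfolding eq by simp
      moreover have "int p' dvd s' * int p" unfolding eq[symmetric] by simp
      moreover have "coprime (int p) s" "coprime (int p') s'"
        using s(1) s'(1) by (blast intro: coprime_imp_coprime)+
      ultimately have "int p dvd int p'" "int p' dvd int p"
        by (simp_all only: coprime_dvd_mult_right_iff)
      then show False using p by (simp add: dvd_antisym)
    qed
    moreover have "\<bar>real_of_int (s * int p' - s' * int p)\<bar> \<le> D"
    proof -
      have "real_of_int (s * int p' - s' * int p)
          = real p * (real p' * x - of_int s') - real p' * (real p * x - of_int s)"
        by (simp add: algebra_simps)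
      also have "\<bar>\<dots>\<bar> \<le> \<bar>real p * (real p' * x - of_int s')\<bar> + \<bar>real p' * (real p * x - of_int s)\<bar>"
        by (rule abs_triangle_ineq4)
      also have "\<dots> = real p * \<bar>real p' * x - of_int s'\<bar> + real p' * \<bar>real p * x - of_int s\<bar>"
        by (simp add: abs_mult)
      also have "\<dots> \<le> real p * \<psi>' + real p' * \<psi>"
        using s s' by (intro add_mono mult_left_mono) auto
      finally show ?thesis by (simp add: D_def mult.commute)
    qed
    moreover have "s \<in> {1..<int p}" "s' \<in> {1..<int p'}"
      using range[OF s] range[OF s'] x p \<psi> by auto
    ultimately have "(s, s') \<in> Q" by (simp add: Q_def)
    moreover have "x \<in> J p \<psi> s" "x \<in> J p' \<psi>' s'"
      using s(2) s'(2) p by (auto simp: J_def abs_le_iff field_simps)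
    ultimately show "x \<in> (\<Union>(s, s')\<in>Q. J p \<psi> s \<inter> J p' \<psi>' s')" by blast
  qed
  define w where "w = min (2 * \<psi> / real p) (2 * \<psi>' / real p')"
  have w: "measure lborel (J p \<psi> s \<inter> J p' \<psi>' s') \<le> w" for s s'
  proof -
    have "measure lborel (J q \<phi> t) = 2 * \<phi> / real q" if "0 < \<phi>" for q \<phi> t
      using that by (simp add: J_def divide_right_mono diff_divide_distrib[symmetric])
    moreover have "measure lborel (J p \<psi> s \<inter> J p' \<psi>' s') \<le> measure lborel (J p \<psi> s)"
      "measure lborel (J p \<psi> s \<inter> J p' \<psi>' s') \<le> measure lborel (J p' \<psi>' s')"
      by (auto intro!: measure_mono_fmeasurable simp: J_def fmeasurable_def emeasure_lborel_Icc_eq)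
    ultimately show ?thesis using \<psi> by (simp add: w_def)
  qed
  have "measure torus (reduced_approx p \<psi> \<inter> reduced_approx p' \<psi>')
      = measure lborel ({0..<1} \<inter> (reduced_approx p \<psi> \<inter> reduced_approx p' \<psi>'))"
    by (simp add: measure_def emeasure_torus unit_cube_real)
  also have "\<dots> \<le> measure lborel (\<Union>q\<in>Q. J p \<psi> (fst q) \<inter> J p' \<psi>' (snd q))"
  proof (rule measure_mono_fmeasurable)
    show "(\<Union>q\<in>Q. J p \<psi> (fst q) \<inter> J p' \<psi>' (snd q)) \<in> fmeasurable lborel"
      by (intro fmeasurable.finite_UN Q)
         (auto simp: J_def fmeasurable_def emeasure_lborel_Icc_eq Int_atLeastAtMost)
  qed (use \<open>_ \<subseteq> (\<Union>(s, s')\<in>Q. J p \<psi> s \<inter> J p' \<psi>' s')\<close> in \<open>auto simp: case_prod_beta\<close>)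
  also have "\<dots> \<le> (\<Sum>q\<in>Q. measure lborel (J p \<psi> (fst q) \<inter> J p' \<psi>' (snd q)))"
    by (intro measure_UNION_le Q) (auto simp: J_def)
  also have "\<dots> \<le> (\<Sum>q\<in>Q. w)" by (intro sum_mono w)
  also have "\<dots> \<le> 2 * D * w"
    using Q(2) \<psi> by (simp add: w_def mult_right_mono)
  also have "\<dots> = 2 * (\<psi> * real p' * w) + 2 * (\<psi>' * real p * w)"
    by (simp add: D_def algebra_simps)
  \<comment> \<open>Each of the two terms of \<open>D\<close> is multiplied by the bound for
    \<open>w\<close> in which its own denominator cancels.\<close>
  also have "\<dots> \<le> 2 * (\<psi> * real p' * (2 * \<psi>' / real p')) + 2 * (\<psi>' * real p * (2 * \<psi> / real p))"
    using \<psi> by (intro add_mono mult_left_mono) (auto simp: w_def)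
  also have "\<dots> = 8 * \<psi> * \<psi>'" using p by simp
  finally show ?thesis .
qed

lemma measure_reduced_approx_le:
  assumes p: "1 \<le> p" and \<psi>: "0 \<le> \<psi>" "\<psi> \<le> 1 / 2"
  shows "measure torus (reduced_approx p \<psi>) \<le> 2 * \<psi>"
proof -
  interpret r: prob_space "torus :: real measure" by (rule prob_space_torus)
  let ?A = "{x. nearest_int_dist x \<le> \<psi>}"
  have "measure torus (reduced_approx p \<psi>) \<le> measure torus {x. real p * x \<in> ?A}"
    using reduced_approx_subset[of p \<psi>] by (intro r.finite_measure_mono) auto
  also have "\<dots> = measure torus ?A"
  proof (rule measure_torus_linear)
    show "surj (\<lambda>x. real p * x)"
      using p by (intro surjI[of _ "\<lambda>y. y / real p"]) simp
    show "periodic (\<lambda>x. x \<in> ?A)"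
      by (auto simp: periodic_def int_points_def elim!: Ints_cases)
  qed (auto simp: int_points_def)
  also have "\<dots> \<le> 2 * \<psi>" using measure_nearest_int_dist_bounds[OF \<psi>] by simp
  finally show ?thesis .
qed

lemma periodic_reduced_approx: "periodic (\<lambda>x. x \<in> reduced_approx p \<psi>)"
proof -
  have *: "x + of_int k \<in> reduced_approx p \<psi>" if x: "x \<in> reduced_approx p \<psi>" for x k
  proof -
    obtain s :: int where s: "coprime s (int p)" "\<bar>real p * x - of_int s\<bar> \<le> \<psi>"
      using x by (auto simp: reduced_approx_def)
    have "coprime (s + k * int p) (int p)" using s(1)
      by (metis add.commute coprime_iff_gcd_eq_1 gcd.commute gcd_add_mult)
    moreover have "\<bar>real p * (x + of_int k) - of_int (s + k * int p)\<bar> \<le> \<psi>"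
      using s(2) by (simp add: algebra_simps)
    ultimately show ?thesis unfolding reduced_approx_def by blast
  qed
  show ?thesis
    unfolding periodic_def
  proof (intro ballI allI)
    fix z x :: real assume "z \<in> int_points"
    then obtain k where k: "z = of_int k" by (auto simp: int_points_def elim: Ints_cases)
    show "(x + z \<in> reduced_approx p \<psi>) = (x \<in> reduced_approx p \<psi>)"
      using *[of x k] *[of "x + z" "- k"] k by auto
  qed
qed

section \<open>Quasimultiplicative functions and condensation\<close>

lemma powi_bracket:
  assumes "1 < (M::real)" "0 < T"
  obtains k :: int where "M powi k \<le> T" "T \<le> M powi (k + 1)"
proof
  let ?k = "\<lfloor>log M T\<rfloor>"
  have "M powi ?k = M powr of_int ?k" using assms by (simp add: powr_real_of_int')
  also have "\<dots> \<le> M powr (log M T)" using assms by (intro powr_mono) auto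
  also have "\<dots> = T" using assms by simp
  finally show "M powi ?k \<le> T" .
  have "T = M powr (log M T)" using assms by simp
  also have "\<dots> \<le> M powr of_int (?k + 1)" using assms by (intro powr_mono) linarith+
  also have "\<dots> = M powi (?k + 1)" using assms by (subst powr_real_of_int') auto
  finally show "T \<le> M powi (?k + 1)" .
qed

text \<open>The growth condition holds only outside a finite window of exponents. Among
  \<open>2 * r + 2 * L\<close> consecutive exponents, either the first \<open>r\<close> lie below
  the window or the last \<open>r\<close> lie above it, and \<open>r\<close> good steps gain more
  than a factor 2. Monotonicity handles the remaining steps.\<close>

lemma quasimultiplicative_doubles:
  assumes "quasimultiplicative h"
  shows "\<exists>S>1. \<forall>T>0. 2 * h T \<le> h (S * T)"
proof -
  obtain M c\<^sub>1 c\<^sub>2 K where M: "1 < M" and c: "1 < c\<^sub>1"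
    and K: "\<And>k::int. K \<le> \<bar>k\<bar> \<Longrightarrow> c\<^sub>1 * h (M powi k) \<le> h (M powi (k + 1))"
    and pos: "\<And>T. 0 < T \<Longrightarrow> 0 < h T" and mono: "mono_on {0<..} h"
    using assms unfolding quasimultiplicative_def by blast
  have Mp: "0 < M powi k" for k using M by (simp add: zero_less_power_int)
  define H where "H k = h (M powi k)" for k
  have Hpos: "0 < H k" for k using pos Mp by (simp add: H_def)
  have Hmono: "H k \<le> H l" if "k \<le> l" for k l
    unfolding H_def using that M Mp by (intro mono_onD[OF mono] power_int_increasing) auto
  define L where "L = max K 0"
  obtain r :: nat where r: "2 < c\<^sub>1 ^ r" using real_arch_pow[OF c] by blast
  have gain: "c\<^sub>1 ^ n * H k \<le> H (k + int n)" if "\<And>i. k \<le> i \<Longrightarrow> i < k + int n \<Longrightarrow> K \<le> \<bar>i\<bar>" for n k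
    using that
  proof (induction n)
    case (Suc n)
    have "c\<^sub>1 ^ Suc n * H k \<le> c\<^sub>1 * H (k + int n)"
      using Suc c by (simp add: mult.assoc)
    also have "\<dots> \<le> H (k + int n + 1)"
      unfolding H_def by (intro K Suc.prems) auto
    finally show ?case by (simp add: ac_simps)
  qed simp
  have two: "2 * H k \<le> H (k + 2 * int r + 2 * L)" for k
  proof (cases "k + int r \<le> - L")
    case True
    have "2 * H k \<le> c\<^sub>1 ^ r * H k" using r Hpos[of k] by simp
    also have "\<dots> \<le> H (k + int r)" using True by (intro gain) (auto simp: L_def)
    also have "\<dots> \<le> H (k + 2 * int r + 2 * L)" by (intro Hmono) (auto simp: L_def)
    finally show ?thesis .
  next
    case False
    have "2 * H k \<le> 2 * H (k + int r + 2 * L)"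
      by (intro mult_left_mono Hmono) (auto simp: L_def)
    also have "\<dots> \<le> c\<^sub>1 ^ r * H (k + int r + 2 * L)" using r Hpos[of "k + int r + 2 * L"] by simp
    also have "\<dots> \<le> H (k + int r + 2 * L + int r)" using False by (intro gain) (auto simp: L_def)
    also have "\<dots> = H (k + 2 * int r + 2 * L)" by (simp add: algebra_simps)
    finally show ?thesis .
  qed
  \<comment> \<open>One step more than in \<open>two\<close>, because \<open>T\<close> is only
    located between two consecutive powers of \<open>M\<close>.\<close>
  define e where "e = 2 * int r + 2 * L + 1"
  have "1 \<le> e" by (simp add: e_def L_def)
  then have "1 < M powi e" using M power_int_strict_increasing[of 0 e M] by simp
  moreover have "2 * h T \<le> h (M powi e * T)" if T: "0 < T" for T
  proof -
    obtain k where k: "M powi k \<le> T" "T \<le> M powi (k + 1)" using powi_bracket[OF M T] .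
    have "2 * h T \<le> 2 * H (k + 1)"
      using k T Mp unfolding H_def by (intro mult_left_mono mono_onD[OF mono]) auto
    also have "\<dots> \<le> H (k + 1 + 2 * int r + 2 * L)" by (rule two)
    also have "\<dots> = H (e + k)" by (simp add: e_def algebra_simps)
    also have "\<dots> \<le> h (M powi e * T)"
      unfolding H_def using M k T Mp
      by (intro mono_onD[OF mono]) (auto simp: power_int_add intro!: mult_left_mono less_imp_le)
    finally show ?thesis .
  qed
  ultimately show ?thesis by blast
qed

text \<open>One multiplicative step of size \<open>M\<close> costs a bounded factor:
  \<open>c\<^sub>2\<close> outside the finite window, and one of finitely many ratios inside.
  Finitely many steps cover the scaling by \<open>S\<close>.\<close>

lemma quasimultiplicative_scale_le:
  assumes "quasimultiplicative h" and S: "0 < S"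
  shows "\<exists>C. \<forall>T>0. h (S * T) \<le> C * h T"
proof -
  obtain M c\<^sub>2 K where M: "1 < M"
    and K: "\<And>k::int. K \<le> \<bar>k\<bar> \<Longrightarrow> h (M powi (k + 1)) \<le> c\<^sub>2 * h (M powi k)"
    and pos: "\<And>T. 0 < T \<Longrightarrow> 0 < h T" and mono: "mono_on {0<..} h"
    using assms(1) unfolding quasimultiplicative_def by blast
  have Mp: "0 < M powi k" for k using M by (simp add: zero_less_power_int)
  define H where "H k = h (M powi k)" for k
  have Hpos: "0 < H k" for k using pos Mp by (simp add: H_def)
  \<comment> \<open>The sum dominates every ratio of consecutive values in the exceptional
    window.\<close>
  define C where "C = \<bar>c\<^sub>2\<bar> + (\<Sum>k\<in>{-K..K}. H (k + 1) / H k)"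
  have S0: "0 \<le> (\<Sum>k\<in>{-K..K}. H (k + 1) / H k)"
    using Hpos by (intro sum_nonneg) (auto intro!: divide_nonneg_nonneg less_imp_le)
  have C0: "0 \<le> C" using S0 by (simp add: C_def)
  have step: "H (k + 1) \<le> C * H k" for k
  proof (cases "K \<le> \<bar>k\<bar>")
    case True
    have "H (k + 1) \<le> c\<^sub>2 * H k" unfolding H_def by (rule K[OF True])
    also have "\<dots> \<le> C * H k" using S0 Hpos[of k] by (intro mult_right_mono) (auto simp: C_def)
    finally show ?thesis .
  next
    case False
    then have "k \<in> {-K..K}" by auto
    then have "H (k + 1) / H k \<le> (\<Sum>k\<in>{-K..K}. H (k + 1) / H k)"
      using Hpos by (intro member_le_sum) (auto intro!: divide_nonneg_nonneg less_imp_le)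
    also have "\<dots> \<le> C" by (simp add: C_def)
    finally show ?thesis using Hpos[of k] by (simp add: field_simps)
  qed
  have steps: "H (k + int n) \<le> C ^ n * H k" for n k
  proof (induction n)
    case (Suc n)
    have "H (k + int (Suc n)) \<le> C * H (k + int n)" using step[of "k + int n"] by (simp add: ac_simps)
    also have "\<dots> \<le> C * (C ^ n * H k)" using Suc C0 by (intro mult_left_mono)
    finally show ?case by (simp add: mult.assoc)
  qed simp
  obtain r :: nat where r: "max S 1 < M ^ r" using real_arch_pow[OF M] by blast
  have "h (S * T) \<le> C ^ Suc r * h T" if T: "0 < T" for T
  proof -
    obtain k where k: "M powi k \<le> T" "T \<le> M powi (k + 1)" using powi_bracket[OF M T] .
    have "S * T \<le> M ^ r * M powi (k + 1)" using k T S r by (intro mult_mono) auto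
    also have "\<dots> = M powi (k + int (Suc r))"
      using M by (simp add: power_int_add power_int_add_1' ac_simps)
    finally have "h (S * T) \<le> H (k + int (Suc r))"
      unfolding H_def using T S Mp by (intro mono_onD[OF mono]) auto
    also have "\<dots> \<le> C ^ Suc r * H k" by (rule steps)
    also have "\<dots> \<le> C ^ Suc r * h T"
      using k T Mp C0 unfolding H_def by (intro mult_left_mono mono_onD[OF mono]) auto
    finally show ?thesis .
  qed
  then show ?thesis by blast
qed

text \<open>Sums over the index dominate all individual constants. \<open>B\<close> is a natural
  number so that its powers cut the series into blocks of integers.\<close>

lemma quasimultiplicative_common_base:
  fixes h :: "'i::finite \<Rightarrow> real \<Rightarrow> real"
  assumes "\<And>i. quasimultiplicative (h i)"
  obtains B :: nat and C :: real where "2 \<le> B" "1 \<le> C"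
    "\<And>i T. 0 < T \<Longrightarrow> 2 * h i T \<le> h i (real B * T)"
    "\<And>i T. 0 < T \<Longrightarrow> h i (real B * T) \<le> C * h i T"
proof -
  have "\<forall>i. \<exists>S>1. \<forall>T>0. 2 * h i T \<le> h i (S * T)"
    using quasimultiplicative_doubles[OF assms] by blast
  then obtain S where S: "\<And>i. 1 < S i" "\<And>i T. 0 < T \<Longrightarrow> 2 * h i T \<le> h i (S i * T)"
    by metis
  have pos: "0 < h i T" if "0 < T" for i T
    using assms[of i] that by (simp add: quasimultiplicative_def)
  have mono: "mono_on {0<..} (h i)" for i
    using assms[of i] by (simp add: quasimultiplicative_def)
  define B where "B = nat \<lceil>\<Sum>i\<in>UNIV. S i\<rceil> + 2"
  have S0: "0 \<le> S i" for i using S(1)[of i] by simp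
  have B: "S i \<le> real B" for i
  proof -
    have "S i \<le> (\<Sum>i\<in>UNIV. S i)" using S0 by (intro member_le_sum) auto
    also have "\<dots> \<le> real B" by (simp add: B_def) linarith
    finally show ?thesis .
  qed
  have B0: "0 < real B" by (simp add: B_def)
  have "\<forall>i. \<exists>C. \<forall>T>0. h i (real B * T) \<le> C * h i T"
    using quasimultiplicative_scale_le[OF assms B0] by blast
  then obtain C where C: "\<And>i T. 0 < T \<Longrightarrow> h i (real B * T) \<le> C i * h i T" by metis
  define C' where "C' = 1 + (\<Sum>i\<in>UNIV. \<bar>C i\<bar>)"
  have C': "C i \<le> C'" for i
  proof -
    have "\<bar>C i\<bar> \<le> (\<Sum>i\<in>UNIV. \<bar>C i\<bar>)" by (intro member_le_sum) auto
    then show ?thesis by (simp add: C'_def)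
  qed
  show ?thesis
  proof (rule that[of B C'])
    show "2 \<le> B" by (simp add: B_def)
    show "1 \<le> C'" by (simp add: C'_def sum_nonneg)
    fix i and T :: real assume T: "0 < T"
    have "2 * h i T \<le> h i (S i * T)" by (rule S(2)[OF T])
    also have "\<dots> \<le> h i (real B * T)"
      using T B[of i] S(1)[of i] B0 by (intro mono_onD[OF mono]) (auto intro!: mult_right_mono)
    finally show "2 * h i T \<le> h i (real B * T)" .
    have "h i (real B * T) \<le> C i * h i T" by (rule C[OF T])
    also have "\<dots> \<le> C' * h i T" using C'[of i] pos[OF T, of i] by (intro mult_right_mono) auto
    finally show "h i (real B * T) \<le> C' * h i T" .
  qed
qed

lemma sum_blocks:
  fixes a :: "nat \<Rightarrow> real"
  assumes "1 \<le> B"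
  shows "(\<Sum>k<n. \<Sum>l\<in>{B ^ k..<B ^ Suc k}. a l) = (\<Sum>l\<in>{1..<B ^ n}. a l)"
proof (induction n)
  case (Suc n)
  have "1 \<le> B ^ n" "B ^ n \<le> B ^ Suc n" using assms by auto
  then show ?case using Suc sum.atLeastLessThan_concat[of 1 "B ^ n" "B ^ Suc n" a] by simp
qed simp

text \<open>Cauchy condensation in base \<open>B\<close>: a block has at most
  \<open>B ^ Suc k\<close> terms, each at most \<open>C * b (Suc k) / B ^ k\<close>. The bound
  refers to the right end of the block, where the values of \<alpha> are smallest.\<close>

lemma summable_of_condensed:
  fixes a b :: "nat \<Rightarrow> real"
  assumes B: "2 \<le> B" and a: "\<And>l. 1 \<le> l \<Longrightarrow> 0 \<le> a l" and b: "summable b" "\<And>k. 0 \<le> b k" and C: "0 \<le> C"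
    and le: "\<And>k l. B ^ k \<le> l \<Longrightarrow> l < B ^ Suc k \<Longrightarrow> a l \<le> C * b (Suc k) / real (B ^ k)"
  shows "summable (\<lambda>l. a (Suc l))"
proof (rule bounded_imp_summable)
  fix n
  have "(\<Sum>k\<le>n. a (Suc k)) = (\<Sum>l\<in>{1..Suc n}. a l)"
    by (simp add: atMost_atLeast0 sum.shift_bounds_cl_Suc_ivl[symmetric])
  also have "\<dots> \<le> (\<Sum>l\<in>{1..<B ^ (n + 2)}. a l)"
  proof (rule sum_mono2)
    have "n + 2 < 2 ^ (n + 2)" by (rule less_exp)
    also have "\<dots> \<le> B ^ (n + 2)" using B by (rule power_mono) simp
    finally show "{1..Suc n} \<subseteq> {1..<B ^ (n + 2)}" by auto
  qed (auto intro: a)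
  also have "\<dots> = (\<Sum>k<n + 2. \<Sum>l\<in>{B ^ k..<B ^ Suc k}. a l)" using B by (intro sum_blocks[symmetric]) simp
  also have "\<dots> \<le> (\<Sum>k<n + 2. real B * C * b (Suc k))"
  proof (rule sum_mono)
    fix k
    have "(\<Sum>l\<in>{B ^ k..<B ^ Suc k}. a l) \<le> (\<Sum>l\<in>{B ^ k..<B ^ Suc k}. C * b (Suc k) / real (B ^ k))"
      by (intro sum_mono le) auto
    also have "\<dots> = real (B ^ Suc k - B ^ k) * (C * b (Suc k) / real (B ^ k))" by simp
    also have "\<dots> \<le> real (B ^ Suc k) * (C * b (Suc k) / real (B ^ k))"
      using b C by (intro mult_right_mono divide_nonneg_nonneg mult_nonneg_nonneg)
        (auto simp del: power_Suc of_nat_power)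
    also have "\<dots> = real B * C * b (Suc k)" using B by simp
    finally show "(\<Sum>l\<in>{B ^ k..<B ^ Suc k}. a l) \<le> real B * C * b (Suc k)" .
  qed
  also have "\<dots> \<le> (\<Sum>k. real B * C * b (Suc k))"
    using b C by (intro sum_le_suminf summable_mult) (auto simp: summable_Suc_iff)
  finally show "(\<Sum>k\<le>n. a (Suc k)) \<le> (\<Sum>k. real B * C * b (Suc k))" .
qed (simp add: a)

text \<open>The converse condensation, now with the left end of each block. As
  \<open>B \<ge> 2\<close>, a block contains at least \<open>B ^ Suc k / 2\<close> integers.\<close>

lemma condensed_summable:
  fixes a b :: "nat \<Rightarrow> real"
  assumes B: "2 \<le> B" and a: "\<And>l. 1 \<le> l \<Longrightarrow> 0 \<le> a l" "summable (\<lambda>l. a (Suc l))"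
    and b: "\<And>k. 0 \<le> b k" and C: "0 < C"
    and le: "\<And>k l. B ^ k \<le> l \<Longrightarrow> l < B ^ Suc k \<Longrightarrow> b k / real (B ^ Suc k) \<le> C * a l"
  shows "summable b"
proof (rule bounded_imp_summable)
  fix n
  have "b k \<le> 2 * C * (\<Sum>l\<in>{B ^ k..<B ^ Suc k}. a l)" for k
  proof -
    have "b k / 2 \<le> real (B ^ Suc k - B ^ k) * (b k / real (B ^ Suc k))"
    proof -
      have "B * B ^ k \<le> 2 * (B * B ^ k - B ^ k)"
      proof -
        have "2 * B ^ k \<le> B * B ^ k" using B by (rule mult_right_mono) simp
        then show ?thesis by linarith
      qed
      then have "real (B ^ Suc k) \<le> 2 * real (B ^ Suc k - B ^ k)"
        unfolding power_Suc by (metis of_nat_le_iff of_nat_mult of_nat_numeral)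
      then have "real (B ^ Suc k) * b k \<le> 2 * real (B ^ Suc k - B ^ k) * b k"
        using b by (intro mult_right_mono) auto
      moreover have "0 < real (B ^ Suc k)" using B by simp
      ultimately show ?thesis by (simp add: field_simps del: power_Suc of_nat_power)
    qed
    also have "\<dots> = (\<Sum>l\<in>{B ^ k..<B ^ Suc k}. b k / real (B ^ Suc k))" by simp
    also have "\<dots> \<le> (\<Sum>l\<in>{B ^ k..<B ^ Suc k}. C * a l)" by (intro sum_mono le) auto
    finally show ?thesis by (simp add: sum_distrib_left[symmetric])
  qed
  then have "(\<Sum>k<Suc n. b k) \<le> (\<Sum>k<Suc n. 2 * C * (\<Sum>l\<in>{B ^ k..<B ^ Suc k}. a l))"
    by (intro sum_mono)
  also have "\<dots> = 2 * C * (\<Sum>l\<in>{1..<B ^ Suc n}. a l)"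
    using B sum_blocks[of B a "Suc n"] by (simp add: sum_distrib_left[symmetric])
  also have "(\<Sum>l\<in>{1..<B ^ Suc n}. a l) \<le> (\<Sum>l. a (Suc l))"
  proof -
    have "(\<Sum>l\<in>{1..<B ^ Suc n}. a l) \<le> (\<Sum>l\<in>{1..<Suc (B ^ Suc n)}. a l)"
      using a by (intro sum_mono2) auto
    also have "\<dots> = (\<Sum>l<B ^ Suc n. a (Suc l))"
      unfolding One_nat_def sum.shift_bounds_Suc_ivl by (simp add: atLeast0LessThan)
    also have "\<dots> \<le> (\<Sum>l. a (Suc l))" using a by (intro sum_le_suminf) auto
    finally show ?thesis .
  qed
  finally show "(\<Sum>k\<le>n. b k) \<le> 2 * C * (\<Sum>l. a (Suc l))"
    using C by (simp add: lessThan_Suc_atMost)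
qed (rule b)

section \<open>Approximation for the transposed system\<close>

lemma int_points_matrix: "z \<in> (int_points :: (real ^ 'm::finite ^ 'n::finite) set) \<longleftrightarrow> (\<forall>i j. z $ i $ j \<in> \<int>)"
  by (auto simp: int_points_def Basis_vec_def inner_axis)

lemma int_points_prod: "z \<in> int_points \<longleftrightarrow> fst z \<in> int_points \<and> snd z \<in> int_points"
  by (cases z) (auto simp: int_points_def Basis_prod_def ball_Un)

lemma vec_nth_borel [measurable]:
  "(\<lambda>x :: 'a::euclidean_space ^ 'n::finite. x $ i) \<in> borel_measurable borel"
  by (intro borel_measurable_continuous_onI continuous_intros)

text \<open>The transpose of \<Theta> applied to \<open>p\<close>, viewed as a linear function of
  \<Theta>, since the matrix is what is random.\<close>

definition col_form :: "('n \<Rightarrow> real) \<Rightarrow> real ^ 'm ^ 'n \<Rightarrow> real ^ 'm::finite" where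
  "col_form p \<Theta> = (\<chi> j. \<Sum>i\<in>UNIV. \<Theta> $ i $ j * p i)"

lemma linear_col_form: "linear (col_form (p :: 'n::finite \<Rightarrow> real) :: real ^ 'm::finite ^ 'n \<Rightarrow> _)"
  by (auto simp: linear_iff col_form_def vec_eq_iff sum.distrib sum_distrib_left algebra_simps)

lemma col_form_int_points:
  fixes p :: "'n::finite \<Rightarrow> real"
  assumes "\<And>i. p i \<in> \<int>"
  shows "col_form p ` (int_points :: (real ^ 'm::finite ^ 'n) set) \<subseteq> int_points"
  using assms by (auto simp: int_points_matrix int_points_vec col_form_def intro!: Ints_sum Ints_mult)

lemma col_form_axis:
  fixes p :: "'n::finite \<Rightarrow> real" and y :: "real ^ 'm::finite"
  shows "col_form p (axis i y) = p i *\<^sub>R y"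
  by (simp add: col_form_def vec_eq_iff axis_def if_distrib[of "\<lambda>v. v $ _ * _"] sum.delta cong: if_cong)

lemma col_form_surj:
  fixes p :: "'n::finite \<Rightarrow> real"
  assumes "p i \<noteq> 0"
  shows "surj (col_form p :: real ^ 'm::finite ^ 'n \<Rightarrow> _)"
proof (rule surjI)
  fix y :: "real ^ 'm"
  show "col_form p (axis i (y /\<^sub>R p i)) = y"
    using assms by (simp add: col_form_axis)
qed

text \<open>Cramer's rule: with a nonzero 2 by 2 minor of \<open>p\<close> and \<open>p'\<close>,
  rows \<open>i\<close> and \<open>i'\<close> of the matrix alone attain every pair of
  values.\<close>

lemma col_form_pair_surj:
  fixes p p' :: "'n::finite \<Rightarrow> real" and y y' :: "real ^ 'm::finite"
  assumes ne: "p i * p' i' \<noteq> p i' * p' i"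
  shows "\<exists>\<Theta>. col_form p \<Theta> = y \<and> col_form p' \<Theta> = y'"
proof -
  define d where "d = p i * p' i' - p i' * p' i"
  have d: "d \<noteq> 0" using ne by (simp add: d_def)
  have ii: "i \<noteq> i'" using ne by (auto simp: mult.commute)
  define e where "e = inverse d"
  define u where "u = e *\<^sub>R (p' i' *\<^sub>R y - p i' *\<^sub>R y')"
  define v where "v = e *\<^sub>R (p i *\<^sub>R y' - p' i *\<^sub>R y)"
  have form: "col_form r (axis i u + axis i' v) = r i *\<^sub>R u + r i' *\<^sub>R v" for r :: "'n \<Rightarrow> real"
    by (simp add: linear_add[OF linear_col_form] col_form_axis)
  have "p i *\<^sub>R u + p i' *\<^sub>R v = (e * d) *\<^sub>R y" "p' i *\<^sub>R u + p' i' *\<^sub>R v = (e * d) *\<^sub>R y'"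
    by (simp_all add: vec_eq_iff u_def v_def d_def algebra_simps)
  then show ?thesis using d form by (intro exI[of _ "axis i u + axis i' v"]) (simp add: e_def)
qed

definition dual_approx ::
  "('n::finite \<Rightarrow> real) \<Rightarrow> ('m::finite \<Rightarrow> real) \<Rightarrow> (real ^ 'm ^ 'n) set" where
  "dual_approx r \<psi> = {\<Theta>. \<exists>p :: 'n \<Rightarrow> int. (\<exists>i. p i \<noteq> 0) \<and> (\<forall>i. \<bar>of_int (p i)\<bar> \<le> r i) \<and>
     (\<forall>j. nearest_int_dist (\<Sum>i\<in>UNIV. \<Theta> $ i $ j * of_int (p i)) \<le> \<psi> j)}"

lemma dual_approx_borel [measurable]: "dual_approx r \<psi> \<in> sets borel"
  unfolding dual_approx_def by measurable

lemma dual_approx_mono: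
  assumes "\<And>i. r i \<le> r' i" "\<And>j. \<psi> j \<le> \<psi>' j"
  shows "dual_approx r \<psi> \<subseteq> dual_approx r' \<psi>'"
  unfolding dual_approx_def using order_trans[OF _ assms(1)] order_trans[OF _ assms(2)] by blast

text \<open>Passing from \<open>p\<close> to \<open>(N + 1) * p\<close> clears the denominator of
  the translation, at the price of a factor \<open>N + 1\<close> in both bounds. With
  \<open>N = 0\<close> this is invariance under integer translations.\<close>

lemma dual_approx_rational_translate:
  fixes \<Theta> z :: "real ^ 'm::finite ^ 'n::finite"
  assumes \<Theta>: "\<Theta> \<in> dual_approx r \<psi>" and z: "z \<in> int_points"
  shows "\<Theta> + z /\<^sub>R real (Suc N) \<in> dual_approx (\<lambda>i. real (Suc N) * r i) (\<lambda>j. real (Suc N) * \<psi> j)"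
proof -
  obtain p :: "'n \<Rightarrow> int" where p: "\<exists>i. p i \<noteq> 0" "\<And>i. \<bar>of_int (p i)\<bar> \<le> r i"
    "\<And>j. nearest_int_dist (\<Sum>i\<in>UNIV. \<Theta> $ i $ j * of_int (p i)) \<le> \<psi> j"
    using \<Theta> by (auto simp: dual_approx_def)
  define p' where "p' i = int (Suc N) * p i" for i
  have "nearest_int_dist (\<Sum>i\<in>UNIV. (\<Theta> + z /\<^sub>R real (Suc N)) $ i $ j * of_int (p' i)) \<le> real (Suc N) * \<psi> j" for j
  proof -
    let ?s = "\<Sum>i\<in>UNIV. \<Theta> $ i $ j * of_int (p i)"
    have "(\<Sum>i\<in>UNIV. z $ i $ j * of_int (p i)) \<in> \<int>"
      using z by (intro Ints_sum Ints_mult) (auto simp: int_points_matrix)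
    then obtain k where k: "(\<Sum>i\<in>UNIV. z $ i $ j * of_int (p i)) = of_int k" by (auto elim: Ints_cases)
    have "(\<Sum>i\<in>UNIV. (\<Theta> + z /\<^sub>R real (Suc N)) $ i $ j * of_int (p' i))
        = (\<Sum>i\<in>UNIV. real (Suc N) * (\<Theta> $ i $ j * of_int (p i)) + z $ i $ j * of_int (p i))"
      by (intro sum.cong) (auto simp: p'_def field_simps simp del: of_nat_Suc)
    also have "\<dots> = real (Suc N) * ?s + of_int k"
      by (simp add: sum.distrib sum_distrib_left k del: of_nat_Suc)
    finally have "nearest_int_dist (\<Sum>i\<in>UNIV. (\<Theta> + z /\<^sub>R real (Suc N)) $ i $ j * of_int (p' i))
        = nearest_int_dist (real (Suc N) * ?s)" by simp
    also have "\<dots> \<le> \<bar>real (Suc N) * ?s - of_int (int (Suc N) * round ?s)\<bar>"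
      by (rule nearest_int_dist_le)
    also have "\<dots> = real (Suc N) * nearest_int_dist ?s"
      by (simp add: nearest_int_dist_def abs_mult right_diff_distrib[symmetric] del: of_nat_Suc)
    also have "\<dots> \<le> real (Suc N) * \<psi> j" using p(3) by (intro mult_left_mono) auto
    finally show ?thesis .
  qed
  moreover have "\<bar>of_int (p' i)\<bar> \<le> real (Suc N) * r i" for i
    using mult_left_mono[OF p(2)[of i], of "real (Suc N)"] by (simp add: p'_def abs_mult del: of_nat_Suc)
  moreover have "\<exists>i. p' i \<noteq> 0" using p(1) by (auto simp: p'_def)
  ultimately show ?thesis unfolding dual_approx_def by blast
qed

lemma prod_halving_le:
  fixes \<psi> :: "nat \<Rightarrow> 'm::finite \<Rightarrow> real"
  assumes "\<And>k j. 0 < \<psi> k j" "\<And>k j. \<psi> (Suc k) j \<le> \<psi> k j / 2"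
  shows "(\<Prod>j\<in>UNIV. \<psi> (Suc k) j) \<le> (\<Prod>j\<in>UNIV. \<psi> k j) / 2"
proof -
  have "(\<Prod>j\<in>UNIV. \<psi> (Suc k) j) \<le> (\<Prod>j\<in>UNIV. \<psi> k j / 2)"
    using assms by (intro prod_mono) (auto intro: less_imp_le)
  also have "\<dots> = (\<Prod>j\<in>UNIV. \<psi> k j) / 2 ^ CARD('m)" by (simp add: prod_dividef)
  also have "\<dots> \<le> (\<Prod>j\<in>UNIV. \<psi> k j) / 2 ^ 1"
    using assms(1) by (intro divide_left_mono power_increasing prod_nonneg) (auto intro: less_imp_le)
  finally show ?thesis by simp
qed

lemma not_summable_eventually_ge:
  fixes a b :: "nat \<Rightarrow> real"
  assumes "\<not> summable b" "0 < c" "\<And>k. 0 \<le> b k" "\<forall>\<^sub>F k in sequentially. c * b k \<le> a k"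
  shows "\<not> summable a"
proof
  assume "summable a"
  then have "summable (\<lambda>k. c * b k)"
    by (rule summable_comparison_test_ev[rotated]) (use assms(2-4) in \<open>auto elim: eventually_mono\<close>)
  then show False using assms(1,2) by simp
qed

lemma floor_ge_half: "2 \<le> (x::real) \<Longrightarrow> x / 2 \<le> real (nat \<lfloor>x\<rfloor>)"
  by linarith

text \<open>Here \<open>r k i\<close> stands for \<open>c / \<alpha> i (g (B ^ k))\<close> and
  \<open>\<psi> k j\<close> for \<open>c / \<beta> j (B ^ k)\<close>; the bound 1/4 reflects
  \<open>c \<le> 1 / 4\<close>.\<close>

context
  fixes r :: "nat \<Rightarrow> 'n::finite \<Rightarrow> real" and \<psi> :: "nat \<Rightarrow> 'm::finite \<Rightarrow> real"
  assumes r: "\<And>i. filterlim (\<lambda>k. r k i) at_top sequentially" "\<And>k i. 0 < r k i"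
    and \<psi>: "\<And>k j. 0 < \<psi> k j" "\<And>k j. \<psi> k j \<le> 1 / 4" "\<And>k j. \<psi> (Suc k) j \<le> \<psi> k j / 2"
    and div: "\<not> summable (\<lambda>k. (\<Prod>i\<in>UNIV. r k i) * (\<Prod>j\<in>UNIV. \<psi> k j))"
begin

lemma eventually_all_ge: "\<forall>\<^sub>F k in sequentially. \<forall>i. c \<le> r k i"
  using r(1) by (intro eventually_all_finite) (auto simp: filterlim_at_top)

lemma prod_psi_pos: "0 < (\<Prod>j\<in>UNIV. \<psi> k j)"
  using \<psi>(1) by (intro prod_pos) auto

lemma psi_bounds: "\<psi> k j < 1 / 2" "0 \<le> \<psi> k j" "\<psi> k j \<le> 1 / 2"
  using \<psi>(1,2)[of k j] by linarith+

text \<open>Distinct primitive vectors with positive entries are not parallel, so their column forms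
  are jointly onto and the events independent. The constant \<open>4 ^ m\<close> is the square of
  the factor \<open>2 ^ m\<close> between the two bounds for a box.\<close>

lemma dual_approx_limsup_ge_several_rows:
  assumes n: "2 \<le> CARD('n)"
  shows "1 / (2 * 4 ^ CARD('m)) \<le> measure torus (\<Inter>K. \<Union>k\<in>{K..}. dual_approx (r k) (\<psi> k))"
proof -
  interpret prob_space "torus :: (real ^ 'm ^ 'n) measure" by (rule prob_space_torus)
  define I where "I k = {p :: 'n \<Rightarrow> nat. (\<forall>i. p i \<in> {1..nat \<lfloor>r k i\<rfloor>}) \<and> Gcd (range p) = 1}" for k
  define F where "F p = (col_form (\<lambda>i. real (p i)) :: real ^ 'm ^ 'n \<Rightarrow> _)" for p :: "'n \<Rightarrow> nat"
  define E where "E k p = {\<Theta>. F p \<Theta> \<in> near_int_box (\<psi> k)}" for k p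
  define f where "f k = (\<Prod>j\<in>UNIV. \<psi> k j)" for k
  have F: "linear (F p)" "F p ` int_points \<subseteq> int_points" for p
    by (auto simp: F_def linear_col_form col_form_int_points)
  have [measurable]: "F p \<in> borel_measurable borel" for p
    by (rule linear_borel_measurable[OF F(1)])
  have meas: "E k p \<in> sets borel" for k p unfolding E_def by measurable
  have single: "prob (E k p) = measure torus (near_int_box (\<psi> k))" if "p \<in> I k'" for k k' p
    unfolding E_def
  proof (rule measure_torus_linear)
    obtain i :: 'n where "True" by simp
    have "p i \<noteq> 0" using that by (auto simp: I_def Suc_le_eq)
    then show "surj (F p)" unfolding F_def by (intro col_form_surj[of _ i]) simp
  qed (use F in \<open>auto simp: periodic_near_int_box\<close>)
  have box: "f k \<le> measure torus (near_int_box (\<psi> k))" "measure torus (near_int_box (\<psi> k)) \<le> 2 ^ CARD('m) * f k" for k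
    using measure_near_int_box_bounds[of "\<psi> k", OF psi_bounds(2,3)] by (auto simp: f_def prod.distrib)
  have pair: "prob (E k p \<inter> E k' p') = measure torus (near_int_box (\<psi> k)) * measure torus (near_int_box (\<psi> k'))"
    if p: "p \<in> I k" "p' \<in> I k'" "p \<noteq> p'" for k k' p p'
  proof -
    \<comment> \<open>If all minors vanish, then the vectors \<open>p i * p'\<close> and
      \<open>p' i * p\<close> agree; comparing gcds gives \<open>p i = p' i\<close>.\<close>
    have "\<exists>i i'. p i * p' i' \<noteq> p i' * p' i"
    proof (rule ccontr)
      assume "\<not> ?thesis"
      then have eq: "p i * p' i' = p' i * p i'" for i i' by (metis mult.commute)
      have "p i = p' i" for i
      proof -
        have "p i * Gcd (range p') = Gcd ((*) (p i) ` range p')" by (simp add: Gcd_mult)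
        also have "(*) (p i) ` range p' = (*) (p' i) ` range p" using eq[of i] by (auto simp: image_image)
        also have "Gcd \<dots> = p' i * Gcd (range p)" by (simp add: Gcd_mult)
        finally show ?thesis using p by (simp add: I_def)
      qed
      then show False using p(3) by auto
    qed
    then obtain i i' where i: "p i * p' i' \<noteq> p i' * p' i" by blast
    have "real (p i) * real (p' i') \<noteq> real (p i') * real (p' i)"
      using i by (metis of_nat_eq_iff of_nat_mult)
    then have "\<exists>\<Theta>. F p \<Theta> = y \<and> F p' \<Theta> = y'" for y y'
      unfolding F_def by (rule col_form_pair_surj)
    then have "measure torus {\<Theta>. F p \<Theta> \<in> near_int_box (\<psi> k) \<and> F p' \<Theta> \<in> near_int_box (\<psi> k')}
        = measure torus (near_int_box (\<psi> k)) * measure torus (near_int_box (\<psi> k'))"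
      by (intro measure_torus_linear_pair F periodic_near_int_box near_int_box_borel)
    then show ?thesis by (simp add: E_def Collect_conj_eq)
  qed
  have "1\<^sup>2 / (2 * 4 ^ CARD('m)) \<le> prob (\<Inter>K. \<Union>k\<in>{K..}. \<Union>p\<in>I k. E k p)"
  proof (rule prob_infinitely_often_ge[where f = f])
    have "I k \<subseteq> PiE UNIV (\<lambda>i. {1..nat \<lfloor>r k i\<rfloor>})" for k by (auto simp: I_def)
    then show "finite (I k)" for k by (rule finite_subset) (intro finite_PiE, auto)
    show f0: "0 < f k" for k unfolding f_def by (rule prod_psi_pos)
    show "f (Suc k) \<le> f k / 2" for k unfolding f_def by (intro prod_halving_le \<psi>)
    show "1 * f k \<le> prob (E k p)" if "p \<in> I k" for k p using single[OF that] box by simp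
    show "prob (E k p) \<le> 4 ^ CARD('m) * f k" if "p \<in> I k" for k p
    proof -
      have "prob (E k p) \<le> 2 ^ CARD('m) * f k" using single[OF that] box by simp
      also have "\<dots> \<le> 4 ^ CARD('m) * f k" using f0[of k] by (intro mult_right_mono power_mono) auto
      finally show ?thesis .
    qed
    show "prob (E k p \<inter> E k' p') \<le> 4 ^ CARD('m) * f k * f k'" if "p \<in> I k" "p' \<in> I k'" "p \<noteq> p'" for k k' p p'
    proof -
      have "prob (E k p \<inter> E k' p') \<le> (2 ^ CARD('m) * f k) * (2 ^ CARD('m) * f k')"
        unfolding pair[OF that] using box f0[of k] by (intro mult_mono) auto
      also have "\<dots> = 4 ^ CARD('m) * f k * f k'" by (simp add: power_mult_distrib[symmetric])
      finally show ?thesis .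
    qed
    \<comment> \<open>Taking floors costs at most a factor 2 per coordinate, and primitivity a
      factor 4.\<close>
    have ev: "\<forall>\<^sub>F k in sequentially. (1 / 4 * (1 / 2) ^ CARD('n)) * ((\<Prod>i\<in>UNIV. r k i) * f k) \<le> real (card (I k)) * f k"
      using eventually_all_ge[of 2]
    proof eventually_elim
      case (elim k)
      have "(1 / 4 * (1 / 2) ^ CARD('n)) * (\<Prod>i\<in>UNIV. r k i) = (\<Prod>i\<in>UNIV. r k i / 2) / 4"
        by (simp add: prod_dividef power_one_over)
      also have "\<dots> \<le> (\<Prod>i\<in>UNIV. real (nat \<lfloor>r k i\<rfloor>)) / 4"
        using elim r(2)[of k] by (intro divide_right_mono prod_mono conjI floor_ge_half) (auto intro: less_imp_le)
      also have "\<dots> \<le> real (card (I k))" unfolding I_def by (rule card_primitive_ge[OF n])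
      finally have "(1 / 4 * (1 / 2) ^ CARD('n)) * (\<Prod>i\<in>UNIV. r k i) \<le> real (card (I k))" .
      from mult_right_mono[OF this less_imp_le[OF f0[of k]]] show ?case by (simp add: mult.assoc)
    qed
    show "\<not> summable (\<lambda>k. real (card (I k)) * f k)"
    proof (rule not_summable_eventually_ge[OF div])
      show "0 < (1 / 4 * (1 / 2) ^ CARD('n) :: real)" by simp
      show "0 \<le> (\<Prod>i\<in>UNIV. r k i) * (\<Prod>j\<in>UNIV. \<psi> k j)" for k
        by (intro mult_nonneg_nonneg prod_nonneg) (simp_all add: less_imp_le r(2) \<psi>(1))
    qed (use ev in \<open>simp add: f_def\<close>)
  qed (auto simp: meas)
  also have "\<dots> \<le> prob (\<Inter>K. \<Union>k\<in>{K..}. dual_approx (r k) (\<psi> k))"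
  proof (rule finite_measure_mono)
    have sub: "E k p \<subseteq> dual_approx (r k) (\<psi> k)" if p: "p \<in> I k" for k p
    proof
      fix \<Theta> assume "\<Theta> \<in> E k p"
      then have "nearest_int_dist (\<Sum>i\<in>UNIV. \<Theta> $ i $ j * of_int (int (p i))) \<le> \<psi> k j" for j
        by (simp add: E_def F_def near_int_box_def col_form_def)
      moreover have "\<bar>of_int (int (p i))\<bar> \<le> r k i" for i
      proof -
        have "p i \<le> nat \<lfloor>r k i\<rfloor>" using p by (auto simp: I_def)
        then show ?thesis using r(2)[of k i] by (simp add: le_nat_iff le_floor_iff)
      qed
      moreover have "int (p i) \<noteq> 0" for i using p by (auto simp: I_def Suc_le_eq)
      ultimately show "\<Theta> \<in> dual_approx (r k) (\<psi> k)"
        unfolding dual_approx_def by (intro CollectI exI[of _ "\<lambda>i. int (p i)"]) blast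
    qed
    show "(\<Inter>K. \<Union>k\<in>{K..}. \<Union>p\<in>I k. E k p) \<subseteq> (\<Inter>K. \<Union>k\<in>{K..}. dual_approx (r k) (\<psi> k))"
      by (intro INF_superset_mono UN_mono UN_least subset_refl) (rule sub)
  qed measurable
  finally show ?thesis by simp
qed

lemma dual_approx_limsup_ge_one_row:
  assumes n: "CARD('n) = 1"
  shows "((1 / 4) ^ CARD('m))\<^sup>2 / (2 * 8 ^ CARD('m)) \<le> measure torus (\<Inter>K. \<Union>k\<in>{K..}. dual_approx (r k) (\<psi> k))"
proof -
  interpret prob_space "torus :: (real ^ 'm ^ 'n) measure" by (rule prob_space_torus)
  obtain i0 :: 'n where i0: "UNIV = {i0}" using n by (auto simp: card_1_singleton_iff)
  define I where "I k = {p\<in>{2..nat \<lfloor>r k i0\<rfloor>}. p \<le> 8 * card {s\<in>{1..<p}. coprime s p}}" for k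
  define A where "A k p = {x :: real ^ 'm. \<forall>j. x $ j \<in> reduced_approx p (\<psi> k j)}" for k p
  define E where "E k p = {\<Theta> :: real ^ 'm ^ 'n. \<Theta> $ i0 \<in> A k p}" for k p
  define f where "f k = (\<Prod>j\<in>UNIV. \<psi> k j)" for k
  have f0: "0 < f k" for k unfolding f_def by (rule prod_psi_pos)
  have [measurable]: "A k p \<in> sets borel" for k p unfolding A_def by measurable
  have meas: "E k p \<in> sets borel" for k p unfolding E_def by measurable
  have perA: "periodic (\<lambda>x. x \<in> A k p)" for k p
    unfolding periodic_def A_def
  proof (intro ballI allI)
    fix z x :: "real ^ 'm" assume "z \<in> int_points"
    then have "z $ j \<in> int_points" for j by (auto simp: int_points_vec) (auto simp: int_points_def)
    then have "(x + z) $ j \<in> reduced_approx p (\<psi> k j) \<longleftrightarrow> x $ j \<in> reduced_approx p (\<psi> k j)" for j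
      using periodic_reduced_approx[of p "\<psi> k j"] by (simp add: periodic_def)
    then show "(x + z \<in> {x. \<forall>j. x $ j \<in> reduced_approx p (\<psi> k j)}) = (x \<in> {x. \<forall>j. x $ j \<in> reduced_approx p (\<psi> k j)})"
      by blast
  qed
  have row: "prob {\<Theta>. \<Theta> $ i0 \<in> X} = measure torus X" if "X \<in> sets borel" "periodic (\<lambda>x. x \<in> X)" for X
  proof (rule measure_torus_linear)
    show "linear (\<lambda>\<Theta> :: real ^ 'm ^ 'n. \<Theta> $ i0)" by (auto simp: linear_iff)
    show "surj (\<lambda>\<Theta> :: real ^ 'm ^ 'n. \<Theta> $ i0)" by (rule surjI[of _ "\<lambda>y. axis i0 y"]) simp
    show "(\<lambda>\<Theta> :: real ^ 'm ^ 'n. \<Theta> $ i0) ` int_points \<subseteq> int_points"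
      by (auto simp: int_points_matrix int_points_vec)
  qed (use that in auto)
  have single: "prob (E k p) = (\<Prod>j\<in>UNIV. measure torus (reduced_approx p (\<psi> k j)))" for k p
    unfolding E_def by (subst row) (auto simp: perA, auto simp: A_def measure_torus_vec)
  have pair: "prob (E k p \<inter> E k' p') = (\<Prod>j\<in>UNIV. measure torus (reduced_approx p (\<psi> k j) \<inter> reduced_approx p' (\<psi> k' j)))" for k p k' p'
  proof -
    have "prob (E k p \<inter> E k' p') = prob {\<Theta>. \<Theta> $ i0 \<in> A k p \<inter> A k' p'}"
      by (simp add: E_def Collect_conj_eq)
    also have "\<dots> = measure torus (A k p \<inter> A k' p')"
      using perA[of k p] perA[of k' p'] by (intro row) (auto simp: periodic_def)
    also have "A k p \<inter> A k' p' = {x. \<forall>j. x $ j \<in> reduced_approx p (\<psi> k j) \<inter> reduced_approx p' (\<psi> k' j)}"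
      by (auto simp: A_def)
    also have "measure torus \<dots> = (\<Prod>j\<in>UNIV. measure torus (reduced_approx p (\<psi> k j) \<inter> reduced_approx p' (\<psi> k' j)))"
      by (rule measure_torus_vec) simp
    finally show ?thesis .
  qed
  note \<psi>' = psi_bounds
  have "((1 / 4) ^ CARD('m))\<^sup>2 / (2 * 8 ^ CARD('m)) \<le> prob (\<Inter>K. \<Union>k\<in>{K..}. \<Union>p\<in>I k. E k p)"
  proof (rule prob_infinitely_often_ge[where f = f])
    show "finite (I k)" for k unfolding I_def by auto
    show "0 < f k" for k by (rule f0)
    show "f (Suc k) \<le> f k / 2" for k unfolding f_def by (intro prod_halving_le \<psi>)
    show "(1 / 4) ^ CARD('m) * f k \<le> prob (E k p)" if p: "p \<in> I k" for k p
    proof -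
      \<comment> \<open>With at least \<open>p / 8\<close> coprime numerators the intervals have
        total length at least \<open>(p / 8) * (2 * \<psi> / p)\<close>.\<close>
      have "\<psi> k j / 4 \<le> measure torus (reduced_approx p (\<psi> k j))" for j
      proof -
        let ?\<phi> = "card {s\<in>{1..<p}. coprime s p}"
        have p2: "2 \<le> p" "p \<le> 8 * ?\<phi>" using p by (auto simp: I_def)
        have "real p \<le> 8 * real ?\<phi>" using p2(2) by linarith
        then have "\<psi> k j / 4 * real p \<le> real ?\<phi> * (2 * \<psi> k j)"
          using mult_left_mono[of "real p" "8 * real ?\<phi>" "\<psi> k j / 4"] \<psi>' by (simp add: mult.commute)
        then have "\<psi> k j / 4 \<le> real ?\<phi> * (2 * \<psi> k j / real p)" using p2 by (simp add: field_simps)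
        also have "\<dots> \<le> measure torus (reduced_approx p (\<psi> k j))"
          by (rule measure_reduced_approx_ge[OF p2(1) \<psi>(1) \<psi>'(1)])
        finally show ?thesis .
      qed
      then have "(\<Prod>j\<in>UNIV. \<psi> k j / 4) \<le> prob (E k p)"
        unfolding single using \<psi>' by (intro prod_mono) auto
      then show ?thesis by (simp add: f_def prod_dividef power_one_over)
    qed
    show "prob (E k p) \<le> 8 ^ CARD('m) * f k" if "p \<in> I k" for k p
    proof -
      have "prob (E k p) \<le> (\<Prod>j\<in>UNIV. 2 * \<psi> k j)"
        unfolding single using \<psi>' that by (intro prod_mono conjI measure_reduced_approx_le) (auto simp: I_def)
      also have "\<dots> = 2 ^ CARD('m) * f k" by (simp add: prod.distrib f_def)
      also have "\<dots> \<le> 8 ^ CARD('m) * f k" using f0[of k] by (intro mult_right_mono power_mono) auto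
      finally show ?thesis .
    qed
    show "prob (E k p \<inter> E k' p') \<le> 8 ^ CARD('m) * f k * f k'" if "p \<in> I k" "p' \<in> I k'" "p \<noteq> p'" for k k' p p'
    proof -
      have "prob (E k p \<inter> E k' p') \<le> (\<Prod>j\<in>UNIV. 8 * \<psi> k j * \<psi> k' j)"
        unfolding pair using \<psi>' \<psi>(1) that
        by (intro prod_mono conjI measure_reduced_approx_Int_le) (auto simp: I_def)
      then show ?thesis by (simp add: prod.distrib f_def)
    qed
    \<comment> \<open>The factor is 1/8 from counting suitable denominators times 1/2 from the
      floor.\<close>
    have ev: "\<forall>\<^sub>F k in sequentially. 1 / 16 * ((\<Prod>i\<in>UNIV. r k i) * f k) \<le> real (card (I k)) * f k"
      using eventually_all_ge[of 56]
    proof eventually_elim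
      case (elim k)
      have "56 \<le> nat \<lfloor>r k i0\<rfloor>" using elim[rule_format, of i0] by linarith
      from card_large_coprime_ge[OF this]
      have "real (nat \<lfloor>r k i0\<rfloor>) / 8 \<le> real (card (I k))" by (simp add: I_def)
      moreover have "r k i0 / 2 \<le> real (nat \<lfloor>r k i0\<rfloor>)" using elim[rule_format, of i0] by (intro floor_ge_half) simp
      ultimately have "1 / 16 * (\<Prod>i\<in>UNIV. r k i) \<le> real (card (I k))" by (simp add: i0)
      from mult_right_mono[OF this less_imp_le[OF f0[of k]]] show ?case by (simp add: mult.assoc)
    qed
    show "\<not> summable (\<lambda>k. real (card (I k)) * f k)"
    proof (rule not_summable_eventually_ge[OF div])
      show "0 < (1 / 16 :: real)" by simp
      show "0 \<le> (\<Prod>i\<in>UNIV. r k i) * (\<Prod>j\<in>UNIV. \<psi> k j)" for k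
        by (intro mult_nonneg_nonneg prod_nonneg) (simp_all add: less_imp_le r(2) \<psi>(1))
    qed (use ev in \<open>simp add: f_def\<close>)
  qed (auto simp: meas)
  also have "\<dots> \<le> prob (\<Inter>K. \<Union>k\<in>{K..}. dual_approx (r k) (\<psi> k))"
  proof (rule finite_measure_mono)
    have sub: "E k p \<subseteq> dual_approx (r k) (\<psi> k)" if p: "p \<in> I k" for k p
    proof
      fix \<Theta> assume \<Theta>: "\<Theta> \<in> E k p"
      have "nearest_int_dist (\<Sum>i\<in>UNIV. \<Theta> $ i $ j * of_int (int p)) \<le> \<psi> k j" for j
        using \<Theta> reduced_approx_subset[of p "\<psi> k j"] by (auto simp: E_def A_def i0 mult.commute)
      moreover have "\<bar>of_int (int p)\<bar> \<le> r k i" for i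
      proof -
        have "i = i0" using i0 by blast
        moreover have "p \<le> nat \<lfloor>r k i0\<rfloor>" using p by (auto simp: I_def)
        ultimately show ?thesis using r(2)[of k i] by (simp add: le_nat_iff le_floor_iff)
      qed
      moreover have "int p \<noteq> 0" using p by (auto simp: I_def)
      ultimately show "\<Theta> \<in> dual_approx (r k) (\<psi> k)"
        unfolding dual_approx_def by (intro CollectI exI[of _ "\<lambda>i. int p"]) blast
    qed
    show "(\<Inter>K. \<Union>k\<in>{K..}. \<Union>p\<in>I k. E k p) \<subseteq> (\<Inter>K. \<Union>k\<in>{K..}. dual_approx (r k) (\<psi> k))"
      by (intro INF_superset_mono UN_mono UN_least subset_refl) (rule sub)
  qed measurable
  finally show ?thesis .
qed

end

text \<open>The universally quantified \<open>c\<close> is what makes the zero-one law applicable: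
  it absorbs the factor by which a rational translation worsens an approximation.\<close>

lemma AE_dual_approx_infinitely_often:
  fixes r :: "nat \<Rightarrow> 'n::finite \<Rightarrow> real" and \<psi> :: "nat \<Rightarrow> 'm::finite \<Rightarrow> real"
  assumes r: "\<And>i. filterlim (\<lambda>k. r k i) at_top sequentially" "\<And>k i. 0 < r k i"
    and \<psi>: "\<And>k j. 0 < \<psi> k j" "\<And>k j. \<psi> k j \<le> 1" "\<And>k j. \<psi> (Suc k) j \<le> \<psi> k j / 2"
    and div: "\<not> summable (\<lambda>k. (\<Prod>i\<in>UNIV. r k i) * (\<Prod>j\<in>UNIV. \<psi> k j))"
  shows "AE \<Theta> in torus. \<forall>c>0. \<forall>K. \<exists>k\<ge>K. \<Theta> \<in> dual_approx (\<lambda>i. c * r k i) (\<lambda>j. c * \<psi> k j)"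
proof -
  interpret prob_space "torus :: (real ^ 'm ^ 'n) measure" by (rule prob_space_torus)
  define V where "V c = (\<Inter>K. \<Union>k\<in>{K..}. dual_approx (\<lambda>i. c * r k i) (\<lambda>j. c * \<psi> k j))" for c
  have [measurable]: "V c \<in> sets borel" for c unfolding V_def by measurable
  \<comment> \<open>Scaling by \<open>c\<close> multiplies the series by \<open>c ^ (n + m)\<close>,
    so divergence persists, and \<delta> depends on \<open>n\<close> and \<open>m\<close>
    only.\<close>
  obtain \<delta> where \<delta>: "0 < \<delta>" "\<And>c. 0 < c \<Longrightarrow> c \<le> 1 / 4 \<Longrightarrow> \<delta> \<le> prob (V c)"
  proof -
    have scaled: "filterlim (\<lambda>k. c * r k i) at_top sequentially" "0 < c * r k i" "0 < c * \<psi> k j"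
      "c * \<psi> k j \<le> 1 / 4" "c * \<psi> (Suc k) j \<le> c * \<psi> k j / 2"
      "\<not> summable (\<lambda>k. (\<Prod>i\<in>UNIV. c * r k i) * (\<Prod>j\<in>UNIV. c * \<psi> k j))"
      if c: "0 < c" "c \<le> 1 / 4" for c k i j
    proof -
      show "filterlim (\<lambda>k. c * r k i) at_top sequentially"
        by (rule filterlim_tendsto_pos_mult_at_top[OF tendsto_const c(1) r(1)])
      show "0 < c * r k i" "0 < c * \<psi> k j" using c r(2) \<psi>(1) by auto
      show "c * \<psi> k j \<le> 1 / 4" using c mult_mono[OF c(2) \<psi>(2)[of k j]] \<psi>(1)[of k j] by simp
      show "c * \<psi> (Suc k) j \<le> c * \<psi> k j / 2"
        using mult_left_mono[OF \<psi>(3)[of k j], of c] c by simp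
      have eq: "(\<Prod>i\<in>UNIV. c * r k i) * (\<Prod>j\<in>UNIV. c * \<psi> k j)
          = c ^ (CARD('n) + CARD('m)) * ((\<Prod>i\<in>UNIV. r k i) * (\<Prod>j\<in>UNIV. \<psi> k j))" for k
        by (simp add: prod.distrib power_add)
      show "\<not> summable (\<lambda>k. (\<Prod>i\<in>UNIV. c * r k i) * (\<Prod>j\<in>UNIV. c * \<psi> k j))"
        unfolding eq using div c(1) by (simp add: summable_cmult_iff)
    qed
    show ?thesis
    proof (cases "2 \<le> CARD('n)")
      case True
      show ?thesis
        by (rule that[of "1 / (2 * 4 ^ CARD('m))"])
           (simp, unfold V_def, rule dual_approx_limsup_ge_several_rows[OF scaled True])
    next
      case False
      then have 1: "CARD('n) = 1" using zero_less_card_finite[where 'a='n] by linarith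
      show ?thesis
        by (rule that[of "((1 / 4) ^ CARD('m))\<^sup>2 / (2 * 8 ^ CARD('m))"])
           (simp, unfold V_def, rule dual_approx_limsup_ge_one_row[OF scaled 1])
    qed
  qed
  have V_mono: "V c \<subseteq> V d" if "c \<le> d" for c d
    unfolding V_def
    by (intro INF_superset_mono UN_mono subset_refl dual_approx_mono mult_right_mono that)
       (auto intro: less_imp_le r(2) \<psi>(1))
  \<comment> \<open>A countable version of the intersection over all \<open>c\<close>; starting at
    1/4 keeps every member within the range where \<delta> applies.\<close>
  define W where "W = (\<Inter>N. V (1 / real (N + 4)))"
  have [measurable]: "W \<in> sets borel" unfolding W_def by measurable
  have W: "\<Theta> \<in> W \<longleftrightarrow> (\<forall>c>0. \<Theta> \<in> V c)" for \<Theta>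
  proof
    assume \<Theta>: "\<Theta> \<in> W"
    show "\<forall>c>0. \<Theta> \<in> V c"
    proof (intro allI impI)
      fix c :: real assume "0 < c"
      then obtain N where N: "inverse (real (Suc N)) < c" using reals_Archimedean by blast
      have "1 / real (N + 4) \<le> inverse (real (Suc N))" by (simp add: field_simps)
      then have "V (1 / real (N + 4)) \<subseteq> V c" using N by (intro V_mono) simp
      then show "\<Theta> \<in> V c" using \<Theta> unfolding W_def by blast
    qed
  qed (auto simp: W_def)
  have "\<delta> \<le> prob W"
  proof -
    have "decseq (\<lambda>N. V (1 / real (N + 4)))"
      unfolding decseq_def by (intro allI impI V_mono divide_left_mono) auto
    then have "(\<lambda>N. prob (V (1 / real (N + 4)))) \<longlonglongrightarrow> prob W"
      unfolding W_def by (intro finite_Lim_measure_decseq) auto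
    then show ?thesis by (rule LIMSEQ_le_const) (auto intro!: exI[of _ 0] \<delta>(2) simp: field_simps)
  qed
  then have pos: "emeasure torus W \<noteq> 0" using \<delta>(1) by (simp add: emeasure_eq_measure)
  have step: "\<Theta> + z /\<^sub>R real (Suc n) \<in> W" if \<Theta>: "\<Theta> \<in> W" and z: "z \<in> int_points" for \<Theta> z n
    unfolding W
  proof (intro allI impI)
    fix c :: real assume c: "0 < c"
    \<comment> \<open>The smaller parameter compensates in advance for the factor
      \<open>Suc n\<close> lost by the translation.\<close>
    have "\<Theta> \<in> V (c / real (Suc n))" using \<Theta> c unfolding W by (simp del: of_nat_Suc)
    show "\<Theta> + z /\<^sub>R real (Suc n) \<in> V c"
      unfolding V_def
    proof (intro INT_I)
      fix K
      obtain k where k: "K \<le> k" "\<Theta> \<in> dual_approx (\<lambda>i. c / real (Suc n) * r k i) (\<lambda>j. c / real (Suc n) * \<psi> k j)"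
        using \<open>\<Theta> \<in> V (c / real (Suc n))\<close> unfolding V_def by blast
      from dual_approx_rational_translate[OF k(2) z, of n] k(1)
      show "\<Theta> + z /\<^sub>R real (Suc n) \<in> (\<Union>k\<in>{K..}. dual_approx (\<lambda>i. c * r k i) (\<lambda>j. c * \<psi> k j))"
        by (auto simp del: of_nat_Suc)
    qed
  qed
  have "AE \<Theta> in torus. \<Theta> \<in> W"
  proof (rule torus_zero_one_rational[OF _ _ pos])
    fix n and z \<Theta> :: "real ^ 'm ^ 'n" assume z: "z \<in> int_points"
    show "\<Theta> + z /\<^sub>R real (Suc n) \<in> W \<longleftrightarrow> \<Theta> \<in> W"
      using step[of \<Theta> z n] step[of "\<Theta> + z /\<^sub>R real (Suc n)" "- z" n] z by auto
  qed measurable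
  then show ?thesis
  proof (rule AE_mp, intro AE_I2 impI allI)
    fix \<Theta> c K assume "\<Theta> \<in> W" "0 < (c::real)"
    then have "\<Theta> \<in> V c" unfolding W by simp
    then have "\<Theta> \<in> (\<Union>k\<in>{K..}. dual_approx (\<lambda>i. c * r k i) (\<lambda>j. c * \<psi> k j))"
      unfolding V_def by (rule INT_D) simp
    then show "\<exists>k\<ge>K. \<Theta> \<in> dual_approx (\<lambda>i. c * r k i) (\<lambda>j. c * \<psi> k j)" by auto
  qed
qed

section \<open>Dirichlet pairs\<close>

definition row_form :: "('m::finite \<Rightarrow> real) \<Rightarrow> (real ^ 'm ^ 'n) \<times> (real ^ 'n) \<Rightarrow> real ^ 'n::finite" where
  "row_form q x = (\<chi> i. (\<Sum>j\<in>UNIV. fst x $ i $ j * q j) - snd x $ i)"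

lemma linear_row_form: "linear (row_form (q :: 'm::finite \<Rightarrow> real) :: (real ^ 'm ^ 'n::finite) \<times> (real ^ 'n) \<Rightarrow> _)"
  by (auto simp: linear_iff row_form_def vec_eq_iff sum.distrib sum_distrib_left algebra_simps)

lemma row_form_int_points:
  fixes q :: "'m::finite \<Rightarrow> real"
  assumes "\<And>j. q j \<in> \<int>"
  shows "row_form q ` (int_points :: ((real ^ 'm ^ 'n::finite) \<times> (real ^ 'n)) set) \<subseteq> int_points"
  using assms
  by (auto simp: int_points_prod int_points_matrix int_points_vec row_form_def intro!: Ints_diff Ints_sum Ints_mult)

lemma row_form_surj: "surj (row_form (q :: 'm::finite \<Rightarrow> real) :: (real ^ 'm ^ 'n::finite) \<times> (real ^ 'n) \<Rightarrow> _)"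
  by (rule surjI[of _ "\<lambda>y. (0, - y)"]) (simp add: row_form_def vec_eq_iff)

text \<open>The two forms differ by \<Theta> applied to \<open>q - q'\<close>, which takes any value
  by means of column \<open>j\<close> alone; the inhomogeneous part then adjusts the first form.
  Hence any two distinct \<open>q\<close>, parallel or not, give independent points.\<close>

lemma row_form_pair_surj:
  fixes q q' :: "'m::finite \<Rightarrow> real" and y y' :: "real ^ 'n::finite"
  assumes ne: "q j \<noteq> q' j"
  shows "\<exists>x. row_form q x = y \<and> row_form q' x = y'"
proof -
  define t where "t = (y - y') /\<^sub>R (q j - q' j)"
  define x :: "(real ^ 'm ^ 'n) \<times> (real ^ 'n)" where "x = ((\<chi> i. axis j (t $ i)), q j *\<^sub>R t - y)"
  have form: "row_form s x = s j *\<^sub>R t - (q j *\<^sub>R t - y)" for s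
    by (simp add: row_form_def x_def vec_eq_iff axis_def if_distrib[of "\<lambda>v. v * _"] sum.delta cong: if_cong)
  have "(q j - q' j) *\<^sub>R t = y - y'" using ne by (simp add: t_def)
  then have "row_form q' x = y'" unfolding form by (simp add: algebra_simps)
  then show ?thesis using form[of q] by (intro exI[of _ x]) simp
qed

text \<open>The condition at one \<open>T\<close>, with the bounds as free parameters, so that
  conditions at different \<open>T\<close> are compared by monotonicity.\<close>

definition solvable_set :: "('n::finite \<Rightarrow> real) \<Rightarrow> ('m::finite \<Rightarrow> real) \<Rightarrow> ((real ^ 'm ^ 'n) \<times> (real ^ 'n)) set" where
  "solvable_set a b = {x. \<exists>q :: int ^ 'm. q \<noteq> 0 \<and> row_form (\<lambda>j. of_int (q $ j)) x \<in> near_int_box a \<and>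
     (\<forall>j. \<bar>of_int (q $ j)\<bar> \<le> b j)}"

lemma dirichlet_pair_iff:
  "dirichlet_pair g \<alpha> \<beta> \<Theta> \<eta> \<longleftrightarrow> (\<forall>\<^sub>F T in at_top. (\<Theta>, \<eta>) \<in> solvable_set (\<lambda>i. \<alpha> i (g T)) (\<lambda>j. \<beta> j T))"
  by (simp add: dirichlet_pair_def solvable_set_def near_int_box_def row_form_def)

lemma solvable_set_borel [measurable]:
  fixes a :: "'n::finite \<Rightarrow> real" and b :: "'m::finite \<Rightarrow> real"
  shows "solvable_set a b \<in> sets borel"
proof -
  have [measurable]: "row_form q \<in> borel_measurable borel"
    for q :: "'m \<Rightarrow> real" by (rule linear_borel_measurable[OF linear_row_form])
  show ?thesis unfolding solvable_set_def by measurable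
qed

lemma periodic_solvable_set:
  fixes a :: "'n::finite \<Rightarrow> real" and b :: "'m::finite \<Rightarrow> real"
  shows "periodic (\<lambda>x. x \<in> solvable_set a b)"
proof -
  have "row_form (\<lambda>j. of_int (q $ j)) (x + z) \<in> near_int_box a \<longleftrightarrow> row_form (\<lambda>j. of_int (q $ j)) x \<in> near_int_box a"
    if "z \<in> int_points" for q :: "int ^ 'm" and x z
  proof -
    have "row_form (\<lambda>j. of_int (q $ j)) z \<in> int_points"
      using row_form_int_points[of "\<lambda>j. of_int (q $ j)"] that by auto
    then show ?thesis
      using periodic_near_int_box[of a] by (simp add: linear_add[OF linear_row_form] periodic_def)
  qed
  then show ?thesis by (simp add: periodic_def solvable_set_def del: split_paired_All)
qed

lemma solvable_set_mono:
  assumes "\<And>i. a i \<le> a' i" "\<And>j. b j \<le> b' j"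
  shows "solvable_set a b \<subseteq> solvable_set a' b'"
  unfolding solvable_set_def near_int_box_def
  using order_trans[OF _ assms(1)] order_trans[OF _ assms(2)] by blast

text \<open>A solution \<open>q\<close> forces \<open>\<eta> \<cdot> p\<close> to be close to an integer for every good approximation \<open>p\<close> of the
  transposed system, since \<open>\<eta> \<cdot> p = (\<Theta>\<^sup>T p) \<cdot> q - (\<Theta> q - \<eta>) \<cdot> p\<close>.\<close>

lemma solvable_set_dual:
  fixes p :: "'n::finite \<Rightarrow> int" and \<Theta> :: "real ^ 'm::finite ^ 'n"
  assumes solv: "(\<Theta>, \<eta>) \<in> solvable_set a b"
    and p: "\<And>i. \<bar>of_int (p i)\<bar> \<le> c / a i" "\<And>j. nearest_int_dist (\<Sum>i\<in>UNIV. \<Theta> $ i $ j * of_int (p i)) \<le> c / b j"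
    and ab: "\<And>i. 0 < a i" "\<And>j. 0 < b j" and c: "0 \<le> c"
  shows "nearest_int_dist (\<Sum>i\<in>UNIV. \<eta> $ i * of_int (p i)) \<le> real (CARD('n) + CARD('m)) * c"
proof -
  obtain q :: "int ^ 'm" where q: "\<And>j. \<bar>of_int (q $ j)\<bar> \<le> b j"
    "\<And>i. nearest_int_dist ((\<Sum>j\<in>UNIV. \<Theta> $ i $ j * of_int (q $ j)) - \<eta> $ i) \<le> a i"
    using solv by (auto simp: solvable_set_def near_int_box_def row_form_def)
  define x where "x j = (\<Sum>i\<in>UNIV. \<Theta> $ i $ j * of_int (p i))" for j
  define y where "y i = (\<Sum>j\<in>UNIV. \<Theta> $ i $ j * of_int (q $ j)) - \<eta> $ i" for i
  \<comment> \<open>The integer obtained from the identity for \<open>\<eta> \<cdot> p\<close> by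
    rounding every \<open>x j\<close> and \<open>y i\<close>.\<close>
  define k where "k = (\<Sum>j\<in>UNIV. q $ j * round (x j)) - (\<Sum>i\<in>UNIV. p i * round (y i))"
  have "(\<Sum>i\<in>UNIV. \<eta> $ i * of_int (p i))
      = (\<Sum>i\<in>UNIV. \<Sum>j\<in>UNIV. \<Theta> $ i $ j * of_int (q $ j) * of_int (p i)) - (\<Sum>i\<in>UNIV. y i * of_int (p i))"
    unfolding sum_subtractf[symmetric]
    by (intro sum.cong refl) (simp add: y_def sum_distrib_right sum_distrib_left algebra_simps)
  also have "(\<Sum>i\<in>UNIV. \<Sum>j\<in>UNIV. \<Theta> $ i $ j * of_int (q $ j) * of_int (p i)) = (\<Sum>j\<in>UNIV. of_int (q $ j) * x j)"
    by (subst sum.swap) (simp add: x_def sum_distrib_left ac_simps)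
  finally have eq: "(\<Sum>i\<in>UNIV. \<eta> $ i * of_int (p i)) - of_int k
      = (\<Sum>j\<in>UNIV. of_int (q $ j) * (x j - of_int (round (x j)))) - (\<Sum>i\<in>UNIV. of_int (p i) * (y i - of_int (round (y i))))"
    by (simp add: k_def right_diff_distrib sum_subtractf mult.commute)
  have "nearest_int_dist (\<Sum>i\<in>UNIV. \<eta> $ i * of_int (p i)) \<le> \<bar>(\<Sum>i\<in>UNIV. \<eta> $ i * of_int (p i)) - of_int k\<bar>"
    by (rule nearest_int_dist_le)
  also have "\<dots> \<le> \<bar>\<Sum>j\<in>UNIV. of_int (q $ j) * (x j - of_int (round (x j)))\<bar> + \<bar>\<Sum>i\<in>UNIV. of_int (p i) * (y i - of_int (round (y i)))\<bar>"
    unfolding eq by (rule abs_triangle_ineq4)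
  also have "\<bar>\<Sum>j\<in>UNIV. of_int (q $ j) * (x j - of_int (round (x j)))\<bar> \<le> (\<Sum>j\<in>(UNIV :: 'm set). c)"
  proof (rule sum_abs[THEN order_trans], rule sum_mono)
    fix j
    have "\<bar>of_int (q $ j) * (x j - of_int (round (x j)))\<bar> = \<bar>of_int (q $ j)\<bar> * nearest_int_dist (x j)"
      by (simp add: abs_mult nearest_int_dist_def)
    also have "\<dots> \<le> b j * (c / b j)"
      using q(1) p(2) ab(2)[of j] by (intro mult_mono) (auto simp: x_def)
    also have "\<dots> = c" using ab(2)[of j] by simp
    finally show "\<bar>of_int (q $ j) * (x j - of_int (round (x j)))\<bar> \<le> c" .
  qed
  also have "\<bar>\<Sum>i\<in>UNIV. of_int (p i) * (y i - of_int (round (y i)))\<bar> \<le> (\<Sum>i\<in>(UNIV :: 'n set). c)"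
  proof (rule sum_abs[THEN order_trans], rule sum_mono)
    fix i
    have "\<bar>of_int (p i) * (y i - of_int (round (y i)))\<bar> = \<bar>of_int (p i)\<bar> * nearest_int_dist (y i)"
      by (simp add: abs_mult nearest_int_dist_def)
    also have "\<dots> \<le> (c / a i) * a i"
      using q(2) p(1) ab(1)[of i] c by (intro mult_mono) (auto simp: y_def)
    also have "\<dots> = c" using ab(1)[of i] by simp
    finally show "\<bar>of_int (p i) * (y i - of_int (round (y i)))\<bar> \<le> c" .
  qed
  finally show ?thesis by (simp add: algebra_simps)
qed

lemma measure_nearest_int_dist_form_le:
  fixes p :: "'n::finite \<Rightarrow> int"
  assumes p: "p i \<noteq> 0" and d: "0 \<le> d" "d \<le> 1 / 2"
  shows "measure torus {\<eta> :: real ^ 'n. nearest_int_dist (\<Sum>i\<in>UNIV. \<eta> $ i * of_int (p i)) \<le> d} \<le> 2 * d"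
proof -
  let ?L = "\<lambda>\<eta> :: real ^ 'n. \<Sum>i\<in>UNIV. \<eta> $ i * of_int (p i)"
  have "measure torus {\<eta>. ?L \<eta> \<in> {x. nearest_int_dist x \<le> d}} = measure torus {x. nearest_int_dist x \<le> d}"
  proof (rule measure_torus_linear)
    show "linear ?L" by (auto simp: linear_iff sum.distrib sum_distrib_left algebra_simps)
    show "surj ?L"
      using p by (intro surjI[of _ "\<lambda>y. axis i (y / of_int (p i))"])
        (simp add: axis_def if_distrib[of "\<lambda>v. v * _"] sum.delta cong: if_cong)
    show "?L ` int_points \<subseteq> int_points"
      by (auto simp: int_points_vec) (auto simp: int_points_def intro!: Ints_sum Ints_mult)
    show "periodic (\<lambda>x. x \<in> {x. nearest_int_dist x \<le> d})"
      by (auto simp: periodic_def int_points_def elim!: Ints_cases)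
  qed simp
  then show ?thesis using measure_nearest_int_dist_bounds(2)[OF d] by simp
qed

text \<open>\<Theta> is fixed. Solvability at all levels from \<open>K\<close> on includes the level
  of a single good \<open>p\<close> for any prescribed \<open>c\<close>, and that one
  \<open>p\<close> already confines \<eta> to a set of measure proportional to
  \<open>c\<close>.\<close>

lemma AE_not_eventually_solvable:
  fixes a :: "nat \<Rightarrow> 'n::finite \<Rightarrow> real" and b :: "nat \<Rightarrow> 'm::finite \<Rightarrow> real"
  assumes ab: "\<And>k i. 0 < a k i" "\<And>k j. 0 < b k j"
    and dual: "\<And>c K. 0 < c \<Longrightarrow> \<exists>k\<ge>K. \<Theta> \<in> dual_approx (\<lambda>i. c / a k i) (\<lambda>j. c / b k j)"
  shows "AE \<eta> in lborel. \<not> (\<forall>\<^sub>F k in sequentially. (\<Theta>, \<eta>) \<in> solvable_set (a k) (b k))"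
proof -
  interpret prob_space "torus :: (real ^ 'n) measure" by (rule prob_space_torus)
  define N where "N K = {\<eta>. \<forall>k\<ge>K. (\<Theta>, \<eta>) \<in> solvable_set (a k) (b k)}" for K
  have [measurable]: "(\<lambda>\<eta> :: real ^ 'n. (\<Theta>, \<eta>)) \<in> borel_measurable borel"
    by (intro borel_measurable_continuous_onI continuous_intros)
  have [measurable]: "N K \<in> sets borel" for K unfolding N_def by measurable
  define s where "s = real (CARD('n) + CARD('m))"
  have s: "1 \<le> s" unfolding s_def using zero_less_card_finite[where 'a='n] by linarith
  have "prob (N K) = 0" for K
  proof -
    have "prob (N K) \<le> e" if e: "0 < e" "e < 1" for e
    proof -
      \<comment> \<open>Then \<open>(n + m) * c = e / 2\<close>, and being that close to an integer
        has probability at most \<open>e\<close>.\<close>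
      define c where "c = e / (2 * s)"
      have c: "0 < c" "s * c = e / 2" using e s by (auto simp: c_def)
      obtain k where k: "K \<le> k" "\<Theta> \<in> dual_approx (\<lambda>i. c / a k i) (\<lambda>j. c / b k j)"
        using dual[OF c(1)] by blast
      then obtain p i where p: "p i \<noteq> 0" "\<And>i. \<bar>of_int (p i)\<bar> \<le> c / a k i"
        "\<And>j. nearest_int_dist (\<Sum>i\<in>UNIV. \<Theta> $ i $ j * of_int (p i)) \<le> c / b k j"
        by (auto simp: dual_approx_def)
      have "N K \<subseteq> {\<eta>. nearest_int_dist (\<Sum>i\<in>UNIV. \<eta> $ i * of_int (p i)) \<le> e / 2}"
      proof
        fix \<eta> assume "\<eta> \<in> N K"
        then have "(\<Theta>, \<eta>) \<in> solvable_set (a k) (b k)" using k(1) by (simp add: N_def)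
        from solvable_set_dual[OF this p(2,3) ab less_imp_le[OF c(1)]]
        show "\<eta> \<in> {\<eta>. nearest_int_dist (\<Sum>i\<in>UNIV. \<eta> $ i * of_int (p i)) \<le> e / 2}"
          using c(2) by (simp add: s_def)
      qed
      then have "prob (N K) \<le> prob {\<eta>. nearest_int_dist (\<Sum>i\<in>UNIV. \<eta> $ i * of_int (p i)) \<le> e / 2}"
        by (intro finite_measure_mono) auto
      also have "\<dots> \<le> 2 * (e / 2)"
        using e by (intro measure_nearest_int_dist_form_le[of p i, OF p(1)]) auto
      finally show ?thesis by simp
    qed
    then have "prob (N K) \<le> 0 + e" if "0 < e" for e
      using that by (cases "e < 1") (auto intro: order_trans[OF prob_le_1])
    then have "prob (N K) \<le> 0" by (rule field_le_epsilon)
    then show ?thesis using measure_nonneg[of torus "N K"] by linarith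
  qed
  then have "AE \<eta> in torus. \<eta> \<notin> N K" for K
    by (intro AE_not_in) (auto simp: null_sets_def emeasure_eq_measure)
  then have "AE \<eta> in torus. \<forall>K. \<eta> \<notin> N K" by (simp add: AE_all_countable)
  then have "AE \<eta> in torus. \<not> (\<forall>\<^sub>F k in sequentially. (\<Theta>, \<eta>) \<in> solvable_set (a k) (b k))"
    by (rule AE_mp) (auto simp: N_def eventually_sequentially)
  moreover have "periodic (\<lambda>\<eta>. \<not> (\<forall>\<^sub>F k in sequentially. (\<Theta>, \<eta>) \<in> solvable_set (a k) (b k)))"
    unfolding periodic_def
  proof (intro ballI allI)
    fix z \<eta> :: "real ^ 'n" assume "z \<in> int_points"
    then have "(0, z) \<in> (int_points :: ((real ^ 'm ^ 'n) \<times> (real ^ 'n)) set)"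
      by (simp add: int_points_prod int_points_matrix)
    then have "(\<Theta>, \<eta>) + (0, z) \<in> solvable_set (a k) (b k) \<longleftrightarrow> (\<Theta>, \<eta>) \<in> solvable_set (a k) (b k)" for k
      using periodic_solvable_set[of "a k" "b k"] unfolding periodic_def by blast
    then show "(\<not> (\<forall>\<^sub>F k in sequentially. (\<Theta>, \<eta> + z) \<in> solvable_set (a k) (b k)))
        = (\<not> (\<forall>\<^sub>F k in sequentially. (\<Theta>, \<eta>) \<in> solvable_set (a k) (b k)))" by simp
  qed
  ultimately show ?thesis by (rule AE_lborel_of_torus)
qed

lemma dual_approx_int_translate:
  fixes \<Theta> z :: "real ^ 'm::finite ^ 'n::finite"
  assumes "z \<in> int_points"
  shows "\<Theta> + z \<in> dual_approx r \<psi> \<longleftrightarrow> \<Theta> \<in> dual_approx r \<psi>"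
  using dual_approx_rational_translate[of \<Theta> r \<psi> z 0]
    dual_approx_rational_translate[of "\<Theta> + z" r \<psi> "- z" 0] assms by auto

text \<open>Approximation of the transposed system is applied with \<open>1 / a\<close> and
  \<open>1 / b\<close>; Fubini combines almost every \<Theta> with almost every \<eta>.\<close>

lemma AE_pair_not_eventually_solvable:
  fixes a :: "nat \<Rightarrow> 'n::finite \<Rightarrow> real" and b :: "nat \<Rightarrow> 'm::finite \<Rightarrow> real"
  assumes a: "\<And>k i. 0 < a k i" "\<And>i. filterlim (\<lambda>k. 1 / a k i) at_top sequentially"
    and b: "\<And>k j. 1 \<le> b k j" "\<And>k j. 2 * b k j \<le> b (Suc k) j"
    and div: "\<not> summable (\<lambda>k. 1 / ((\<Prod>j\<in>UNIV. b k j) * (\<Prod>i\<in>UNIV. a k i)))"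
  shows "AE x in lborel. \<not> (\<forall>\<^sub>F k in sequentially. x \<in> solvable_set (a k) (b k))"
proof -
  have b0: "0 < b k j" for k j using b(1)[of k j] by linarith
  let ?good = "\<lambda>\<Theta>. \<forall>c>0. \<forall>K. \<exists>k\<ge>K. \<Theta> \<in> dual_approx (\<lambda>i. c * (1 / a k i)) (\<lambda>j. c * (1 / b k j))"
  have "AE \<Theta> in torus. ?good \<Theta>"
  proof (rule AE_dual_approx_infinitely_often)
    show "1 / b (Suc k) j \<le> 1 / b k j / 2" for k j
      using b(2)[of k j] b0[of k j] b0[of "Suc k" j] by (simp add: field_simps)
    have "(\<Prod>i\<in>UNIV. 1 / a k i) * (\<Prod>j\<in>UNIV. 1 / b k j) = 1 / ((\<Prod>j\<in>UNIV. b k j) * (\<Prod>i\<in>UNIV. a k i))" for k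
      by (simp add: prod_dividef)
    then show "\<not> summable (\<lambda>k. (\<Prod>i\<in>UNIV. 1 / a k i) * (\<Prod>j\<in>UNIV. 1 / b k j))"
      using div by simp
  qed (use a b b0 in auto)
  then have "AE \<Theta> in lborel. ?good \<Theta>"
    by (rule AE_lborel_of_torus) (simp add: periodic_def dual_approx_int_translate)
  then have "AE \<Theta> in lborel. AE \<eta> in lborel. \<not> (\<forall>\<^sub>F k in sequentially. (\<Theta>, \<eta>) \<in> solvable_set (a k) (b k))"
  proof (rule eventually_mono)
    fix \<Theta> assume "?good \<Theta>"
    then show "AE \<eta> in lborel. \<not> (\<forall>\<^sub>F k in sequentially. (\<Theta>, \<eta>) \<in> solvable_set (a k) (b k))"
      by (intro AE_not_eventually_solvable a b0) simp
  qed
  moreover have "{x \<in> space (lborel \<Otimes>\<^sub>M lborel).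
      \<not> (\<forall>\<^sub>F k in sequentially. x \<in> solvable_set (a k) (b k))} \<in> sets (lborel \<Otimes>\<^sub>M lborel)"
    unfolding lborel_prod eventually_sequentially by measurable
  ultimately have "AE x in lborel \<Otimes>\<^sub>M lborel. \<not> (\<forall>\<^sub>F k in sequentially. x \<in> solvable_set (a k) (b k))"
    by (intro lborel_pair.AE_pair_measure)
  then show ?thesis unfolding lborel_prod .
qed

text \<open>Restricting to positive \<open>q\<close> leaves pairwise independent events of common
  probability \<open>w\<close>. With expected count \<mu>, the second moment is at most
  \<open>\<mu>^2 + \<mu>\<close>, so some event occurs with probability at least
  \<open>\<mu> / (\<mu> + 1)\<close> and failure has probability at most
  \<open>1 / \<mu>\<close>.\<close>

lemma AE_eventually_solvable:
  fixes a :: "nat \<Rightarrow> 'n::finite \<Rightarrow> real" and b :: "nat \<Rightarrow> 'm::finite \<Rightarrow> real"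
  assumes a: "\<And>k i. 0 < a k i" "\<And>k i. a k i \<le> A" and b: "\<And>k j. 1 \<le> b k j" and A: "1 \<le> A"
    and sum: "summable (\<lambda>k. 1 / ((\<Prod>j\<in>UNIV. b k j) * (\<Prod>i\<in>UNIV. a k i)))"
  shows "AE x in torus. \<forall>\<^sub>F k in sequentially. x \<in> solvable_set (a k) (b k)"
proof -
  interpret prob_space "torus :: ((real ^ 'm ^ 'n) \<times> (real ^ 'n)) measure" by (rule prob_space_torus)
  define F where "F q = (row_form (\<lambda>j. real (q j)) :: (real ^ 'm ^ 'n) \<times> (real ^ 'n) \<Rightarrow> _)" for q :: "'m \<Rightarrow> nat"
  have F: "linear (F q)" "F q ` int_points \<subseteq> int_points" "surj (F q)" for q
    by (auto simp: F_def linear_row_form row_form_int_points row_form_surj)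
  have [measurable]: "F q \<in> borel_measurable borel" for q
    by (rule linear_borel_measurable[OF F(1)])
  define C where "C = 2 ^ CARD('m) * (2 * A) ^ CARD('n)"
  have prob_bad: "prob (- solvable_set (a k) (b k)) \<le> C * (1 / ((\<Prod>j\<in>UNIV. b k j) * (\<Prod>i\<in>UNIV. a k i)))" for k
  proof -
    \<comment> \<open>The box is shrunk so that its half-widths do not exceed 1/2, as the measure
      bounds require; this costs the factor \<open>(2 * A) ^ n\<close> in \<open>C\<close>.\<close>
    define \<rho> where "\<rho> i = a k i / (2 * A)" for i
    define X where "X = near_int_box \<rho>"
    define Q where "Q = {q :: 'm \<Rightarrow> nat. \<forall>j. q j \<in> {1..nat \<lfloor>b k j\<rfloor>}}"
    define E where "E q = {x. F q x \<in> X}" for q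
    have [measurable]: "X \<in> sets borel" unfolding X_def by simp
    have meas: "E q \<in> sets borel" for q unfolding E_def by measurable
    have Q: "Q = PiE UNIV (\<lambda>j. {1..nat \<lfloor>b k j\<rfloor>})" by (auto simp: Q_def PiE_def Pi_def)
    have finQ: "finite Q" unfolding Q by (intro finite_PiE) auto
    have cardQ: "real (card Q) = (\<Prod>j\<in>UNIV. real (nat \<lfloor>b k j\<rfloor>))" unfolding Q by (subst card_PiE) auto
    define w where "w = measure torus X"
    have \<rho>: "0 \<le> \<rho> i" "\<rho> i \<le> 1 / 2" "\<rho> i \<le> a k i" "0 < \<rho> i" for i
    proof -
      have "a k i * 1 \<le> a k i * (2 * A)" using a(1)[of k i] A by (intro mult_left_mono) auto
      then show "\<rho> i \<le> a k i" using A by (simp add: \<rho>_def divide_le_eq)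
    qed (use a(1,2)[of k i] A in \<open>auto simp: \<rho>_def field_simps\<close>)
    have w: "(\<Prod>i\<in>UNIV. \<rho> i) \<le> w" unfolding w_def X_def by (rule measure_near_int_box_bounds[OF \<rho>(1,2)])
    have w0: "0 < w" using w \<rho>(4) by (meson less_le_trans prod_pos)
    define \<mu> where "\<mu> = real (card Q) * w"
    have single: "prob (E q) = w" for q
      unfolding E_def w_def by (rule measure_torus_linear[OF F(1,3,2)]) (auto simp: X_def periodic_near_int_box)
    have pair: "prob (E q \<inter> E q') = w\<^sup>2" if "q \<noteq> q'" for q q'
    proof -
      obtain j where "q j \<noteq> q' j" using \<open>q \<noteq> q'\<close> by auto
      then have "\<exists>x. F q x = y \<and> F q' x = y'" for y y'
        unfolding F_def by (intro row_form_pair_surj[of _ j]) simp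
      then have "measure torus {x. F q x \<in> X \<and> F q' x \<in> X} = measure torus X * measure torus X"
        by (intro measure_torus_linear_pair F) (auto simp: X_def periodic_near_int_box)
      then show ?thesis by (simp add: E_def Collect_conj_eq w_def power2_eq_square)
    qed
    have half: "x / 2 \<le> real (nat \<lfloor>x\<rfloor>)" if "1 \<le> x" for x :: real
    proof -
      have "1 \<le> \<lfloor>x\<rfloor>" using that by simp
      then show ?thesis by linarith
    qed
    have mu_ge: "(\<Prod>j\<in>UNIV. b k j) * (\<Prod>i\<in>UNIV. a k i) / C \<le> \<mu>"
    proof -
      have "(\<Prod>j\<in>UNIV. b k j) * (\<Prod>i\<in>UNIV. a k i) / C = (\<Prod>j\<in>UNIV. b k j / 2) * (\<Prod>i\<in>UNIV. \<rho> i)"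
        by (simp add: C_def \<rho>_def prod_dividef)
      also have "\<dots> \<le> real (card Q) * w"
        unfolding cardQ using w \<rho>(1) b
        by (intro mult_mono prod_mono conjI half) (auto intro!: prod_nonneg order_trans[OF _ b])
      finally show ?thesis by (simp add: \<mu>_def)
    qed
    have ab0: "0 < (\<Prod>j\<in>UNIV. b k j) * (\<Prod>i\<in>UNIV. a k i)"
      using a(1) b by (intro mult_pos_pos prod_pos) (auto intro: less_le_trans[OF _ b])
    have C0: "0 < C" using A by (simp add: C_def)
    have mu0: "0 < \<mu>" using less_le_trans[OF divide_pos_pos[OF ab0 C0] mu_ge] .
    have "\<mu>\<^sup>2 = (\<Sum>q\<in>Q. prob (E q))\<^sup>2" by (simp add: single \<mu>_def)
    also have "\<dots> \<le> (\<Sum>q\<in>Q. \<Sum>q'\<in>Q. prob (E q \<inter> E q')) * prob (\<Union>q\<in>Q. E q)"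
      by (intro second_moment_union finQ) (simp add: meas)
    also have "(\<Sum>q\<in>Q. \<Sum>q'\<in>Q. prob (E q \<inter> E q')) \<le> (\<Sum>q\<in>Q. \<Sum>q'\<in>Q. w\<^sup>2 + (if q = q' then w else 0))"
    proof (intro sum_mono)
      fix q q'
      show "prob (E q \<inter> E q') \<le> w\<^sup>2 + (if q = q' then w else 0)"
        using pair[of q q'] single[of q] by (cases "q = q'") auto
    qed
    also have "\<dots> = \<mu>\<^sup>2 + \<mu>"
      using finQ by (simp add: sum.distrib sum.delta \<mu>_def power2_eq_square algebra_simps)
    finally have "\<mu>\<^sup>2 \<le> (\<mu>\<^sup>2 + \<mu>) * prob (\<Union>q\<in>Q. E q)" by (simp add: mult_right_mono)
    then have "\<mu> * \<mu> \<le> \<mu> * ((\<mu> + 1) * prob (\<Union>q\<in>Q. E q))" by (simp add: power2_eq_square algebra_simps)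
    then have ge: "\<mu> \<le> (\<mu> + 1) * prob (\<Union>q\<in>Q. E q)" using mu0 by simp
    have "(\<Union>q\<in>Q. E q) \<subseteq> solvable_set (a k) (b k)"
    proof
      fix x assume "x \<in> (\<Union>q\<in>Q. E q)"
      then obtain q where q: "q \<in> Q" "F q x \<in> X" by (auto simp: E_def)
      define q' :: "int ^ 'm" where "q' = (\<chi> j. int (q j))"
      have "q' \<noteq> 0" using q(1) by (auto simp: q'_def Q_def vec_eq_iff Suc_le_eq)
      moreover have "row_form (\<lambda>j. of_int (q' $ j)) x \<in> near_int_box (a k)"
        using q(2) \<rho>(3) by (auto simp: q'_def F_def X_def near_int_box_def intro: order_trans)
      moreover have "\<bar>of_int (q' $ j)\<bar> \<le> b k j" for j
      proof -
        have "q j \<le> nat \<lfloor>b k j\<rfloor>" using q(1) by (auto simp: Q_def)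
        then show ?thesis using b[of k j] by (simp add: q'_def le_nat_iff le_floor_iff)
      qed
      ultimately show "x \<in> solvable_set (a k) (b k)" unfolding solvable_set_def by blast
    qed
    then have "prob (\<Union>q\<in>Q. E q) \<le> prob (solvable_set (a k) (b k))"
      by (intro finite_measure_mono) auto
    with ge have ge': "\<mu> \<le> (\<mu> + 1) * prob (solvable_set (a k) (b k))"
      using mu0 by (meson add_nonneg_nonneg less_imp_le mult_left_mono order_trans zero_le_one)
    have "prob (- solvable_set (a k) (b k)) = 1 - prob (solvable_set (a k) (b k))"
      using prob_compl[of "solvable_set (a k) (b k)"] by (simp add: Compl_eq_Diff_UNIV)
    also have "\<dots> \<le> 1 / \<mu>"
    proof -
      let ?P = "prob (solvable_set (a k) (b k))"
      have "\<mu> * (1 - ?P) \<le> ?P" using ge' by (simp add: algebra_simps)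
      also have "?P \<le> 1" by (rule prob_le_1)
      finally show ?thesis using mu0 by (simp add: field_simps)
    qed
    also have "\<dots> \<le> 1 / ((\<Prod>j\<in>UNIV. b k j) * (\<Prod>i\<in>UNIV. a k i) / C)"
      using mu_ge ab0 C0 mu0 by (intro divide_left_mono) auto
    finally show ?thesis by simp
  qed
  have "AE x in torus. \<forall>\<^sub>F k in sequentially. x \<in> space torus - (- solvable_set (a k) (b k))"
  proof (rule borel_cantelli_AE1)
    show "summable (\<lambda>k. prob (- solvable_set (a k) (b k)))"
      by (rule summable_comparison_test'[OF summable_mult[OF sum, of C]]) (use prob_bad in auto)
  qed (auto simp: emeasure_eq_measure)
  then show ?thesis by simp
qed

section \<open>Weight functions and the reduction of the theorem to powers of
  \<open>B\<close>\<close>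

lemma weight_function_ge_one: "weight_function h \<Longrightarrow> 1 \<le> T \<Longrightarrow> 1 \<le> h T"
  unfolding weight_function_def by (metis atLeast_iff mono_onD order_refl)

text \<open>Small values near 0 come from large values at infinity through
  \<open>h (1 / T) = 1 / h T\<close>.\<close>

lemma weight_function_small:
  assumes "weight_function h" "0 < Z"
  obtains \<epsilon> where "0 < \<epsilon>" "0 < h \<epsilon>" "Z \<le> 1 / h \<epsilon>"
proof -
  have h: "\<And>T. 1 \<le> T \<Longrightarrow> 0 < h T" "filterlim h at_top at_top"
    "\<And>T. 0 < T \<Longrightarrow> T \<le> 1 \<Longrightarrow> h T = 1 / h (1 / T)"
    using assms(1) by (auto simp: weight_function_def)
  have "\<forall>\<^sub>F T in at_top. Z \<le> h T \<and> 1 \<le> T"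
    using h(2) by (intro eventually_conj eventually_ge_at_top) (auto simp: filterlim_at_top)
  then obtain T where T: "Z \<le> h T" "1 \<le> T" by (auto simp: eventually_at_top_linorder)
  have "h (1 / T) = 1 / h T" using h(3)[of "1 / T"] T by simp
  then show ?thesis using T h(1)[of T] by (intro that[of "1 / T"]) auto
qed

lemma nat_power_bracket:
  assumes "2 \<le> (B::nat)" "1 \<le> (T::real)"
  obtains k where "real B ^ k \<le> T" "T < real B ^ Suc k"
proof -
  define n where "n = (LEAST n. T < real B ^ n)"
  have "\<exists>n. T < real B ^ n" using assms by (intro real_arch_pow) simp
  then have n: "T < real B ^ n" unfolding n_def by (rule LeastI_ex)
  have "n \<noteq> 0" using n assms by (cases n) auto
  then obtain k where k: "n = Suc k" by (cases n) auto
  have "\<not> T < real B ^ k" using not_less_Least[of k "\<lambda>n. T < real B ^ n"] k by (simp add: n_def)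
  then show ?thesis using that[of k] n k by (simp add: not_less)
qed

text \<open>The set \<open>S\<close> need not be Borel; it lies in a Borel null set, and the
  completed measure makes it null itself.\<close>

lemma AE_lborel_null_sets_lebesgue:
  fixes S :: "'a::euclidean_space set"
  assumes "AE x in lborel. x \<notin> S"
  shows "S \<in> null_sets lebesgue"
proof -
  obtain N where N: "{x. \<not> x \<notin> S} \<subseteq> N" "N \<in> null_sets lborel"
    using assms by (auto simp: eventually_ae_filter)
  then have "N \<in> null_sets lebesgue" by (simp add: null_sets_completionI)
  then show ?thesis using N(1) null_sets_completion_subset[of S N lborel] by auto
qed

theorem theorem1p1:
  fixes \<alpha> :: "'n::finite \<Rightarrow> real \<Rightarrow> real"
    and \<beta> :: "'m::finite \<Rightarrow> real \<Rightarrow> real"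
    and g :: "real \<Rightarrow> real"
  defines "D \<equiv> {(\<Theta> :: real ^ 'm ^ 'n, \<eta> :: real ^ 'n). dirichlet_pair g \<alpha> \<beta> \<Theta> \<eta>}"
    and "a \<equiv> (\<lambda>l::nat. 1 / (real l * (\<Prod>j\<in>UNIV. \<beta> j (real l)) * (\<Prod>i\<in>UNIV. \<alpha> i (g (real l)))))"
  assumes "\<And>i. weight_function (\<alpha> i)" and "\<And>i. quasimultiplicative (\<alpha> i)"
    and "\<And>j. weight_function (\<beta> j)" and "\<And>j. quasimultiplicative (\<beta> j)"
    and "\<And>T. T \<ge> 1 \<Longrightarrow> g T > 0"
    and "antimono_on {1..} g"
  shows "(\<not> summable (\<lambda>l. a (Suc l)) \<longrightarrow> D \<in> null_sets lebesgue) \<and>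
         (summable (\<lambda>l. a (Suc l)) \<longrightarrow> - D \<in> null_sets lebesgue)"
proof -
  have \<alpha>_pos: "0 < \<alpha> i T" if "0 < T" for i T
    using assms(4)[of i] that by (simp add: quasimultiplicative_def)
  have \<alpha>_mono: "\<alpha> i S \<le> \<alpha> i T" if "0 < S" "S \<le> T" for i S T
    using assms(4)[of i] that by (auto simp: quasimultiplicative_def elim!: mono_onD)
  have \<beta>_mono: "\<beta> j S \<le> \<beta> j T" if "0 < S" "S \<le> T" for j S T
    using assms(6)[of j] that by (auto simp: quasimultiplicative_def elim!: mono_onD)
  have \<beta>_ge: "1 \<le> \<beta> j T" if "1 \<le> T" for j T
    using weight_function_ge_one[OF assms(5) that] .
  have g_pos: "0 < g T" if "1 \<le> T" for T using assms(7) that .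
  have g_mono: "g T \<le> g S" if "1 \<le> S" "S \<le> T" for S T
    using assms(8) that by (auto simp: monotone_on_def)
  have \<alpha>g_pos: "0 < \<alpha> i (g T)" if "1 \<le> T" for i T using \<alpha>_pos g_pos that by blast
  have \<alpha>g_mono: "\<alpha> i (g T) \<le> \<alpha> i (g S)" if "1 \<le> S" "S \<le> T" for i S T
    using g_mono[OF that] g_pos[of T] that by (intro \<alpha>_mono) auto
  obtain B :: nat and C :: real where B: "2 \<le> B" and C: "1 \<le> C"
    and dbl: "\<And>j T. 0 < T \<Longrightarrow> 2 * \<beta> j T \<le> \<beta> j (real B * T)"
    and scl: "\<And>j T. 0 < T \<Longrightarrow> \<beta> j (real B * T) \<le> C * \<beta> j T"
    using quasimultiplicative_common_base[of \<beta>] assms(6) by blast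
  define A where "A k i = \<alpha> i (g (real B ^ k))" for k i
  define b where "b k j = \<beta> j (real B ^ k)" for k j
  \<comment> \<open>The condensed series. The block estimates compare \<open>a\<close> with it up to
    the factor \<open>C ^ m\<close>.\<close>
  define s where "s k = 1 / ((\<Prod>j\<in>UNIV. b k j) * (\<Prod>i\<in>UNIV. A k i))" for k
  have Bk: "1 \<le> real B ^ k" for k using B by simp
  have Bk0: "0 < real B ^ k" for k using B by simp
  have A0: "0 < A k i" for k i using \<alpha>g_pos[OF Bk] by (simp add: A_def)
  have b1: "1 \<le> b k j" for k j using \<beta>_ge[OF Bk] by (simp add: b_def)
  have b0: "0 < b k j" for k j using b1[of k j] by linarith
  have b_dbl: "2 * b k j \<le> b (Suc k) j" "b (Suc k) j \<le> C * b k j" for k j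
    using dbl[OF Bk0, of j k] scl[OF Bk0, of j k] by (auto simp: b_def)
  have prodA: "0 < (\<Prod>i\<in>UNIV. A k i)" and prodb: "0 < (\<Prod>j\<in>UNIV. b k j)" for k
    using A0 b0 by (auto intro: prod_pos)
  have s0: "0 < s k" for k using prodA prodb by (simp add: s_def)
  have block: "b k j \<le> \<beta> j (real l)" "\<beta> j (real l) \<le> C * b k j"
    "A (Suc k) i \<le> \<alpha> i (g (real l))" "\<alpha> i (g (real l)) \<le> A k i"
    "0 < \<alpha> i (g (real l))" "real B ^ k \<le> real l" "real l \<le> real B ^ Suc k"
    if l: "B ^ k \<le> l" "l < B ^ Suc k" for k l i j
  proof -
    show 1: "real B ^ k \<le> real l" using l(1) by (metis of_nat_le_iff of_nat_power)
    show 2: "real l \<le> real B ^ Suc k" using l(2) by (metis less_imp_le of_nat_le_iff of_nat_power)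
    have 3: "1 \<le> real l" using 1 Bk[of k] by linarith
    show "b k j \<le> \<beta> j (real l)" unfolding b_def by (rule \<beta>_mono[OF Bk0 1])
    have "\<beta> j (real l) \<le> b (Suc k) j" unfolding b_def using 3 by (intro \<beta>_mono 2) auto
    then show "\<beta> j (real l) \<le> C * b k j" using b_dbl(2)[of k j] by linarith
    show "A (Suc k) i \<le> \<alpha> i (g (real l))" unfolding A_def by (rule \<alpha>g_mono[OF 3 2])
    show "\<alpha> i (g (real l)) \<le> A k i" unfolding A_def by (rule \<alpha>g_mono[OF Bk 1])
    show "0 < \<alpha> i (g (real l))" by (rule \<alpha>g_pos[OF 3])
  qed
  have a_nonneg: "0 \<le> a l" if "1 \<le> l" for l
  proof -
    have "1 \<le> real l" using that by simp
    then show ?thesis unfolding a_def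
      by (intro divide_nonneg_nonneg mult_nonneg_nonneg prod_nonneg)
         (auto intro: less_imp_le[OF \<alpha>g_pos] order_trans[OF zero_le_one \<beta>_ge])
  qed
  \<comment> \<open>\<beta> can be moved to the right end of the block at the cost of
    \<open>C\<close>, whereas \<open>\<alpha> i (g l)\<close> is bounded below only by its value at
    that end; hence the index \<open>Suc k\<close>.\<close>
  have a_le: "a l \<le> C ^ CARD('m) * s (Suc k) / real (B ^ k)" if l: "B ^ k \<le> l" "l < B ^ Suc k" for k l
  proof -
    let ?L = "real B ^ k * ((\<Prod>j\<in>UNIV. b (Suc k) j / C) * (\<Prod>i\<in>UNIV. A (Suc k) i))"
    have pos: "0 < ?L" using b0 A0 C Bk0 by (intro mult_pos_pos prod_pos) auto
    have "?L \<le> real l * ((\<Prod>j\<in>UNIV. \<beta> j (real l)) * (\<Prod>i\<in>UNIV. \<alpha> i (g (real l))))"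
    proof (intro mult_mono prod_mono conjI)
      show "b (Suc k) j / C \<le> \<beta> j (real l)" for j
      proof -
        have "b (Suc k) j / C \<le> b k j" using b_dbl(2)[of k j] C by (simp add: field_simps)
        then show ?thesis using block(1)[OF l, of j] by linarith
      qed
      show "0 \<le> (\<Prod>j\<in>UNIV. \<beta> j (real l))"
        by (intro prod_nonneg) (use block(1)[OF l] less_imp_le[OF b0] in \<open>auto intro: order_trans\<close>)
      then show "0 \<le> (\<Prod>j\<in>UNIV. b (Suc k) j / C) * (\<Prod>i\<in>UNIV. A (Suc k) i)"
        using b0 A0 C by (intro mult_nonneg_nonneg prod_nonneg) (auto intro: less_imp_le)
    qed (use block[OF l] A0 b0 C in \<open>auto intro: less_imp_le intro!: prod_nonneg\<close>)
    then have "a l \<le> 1 / ?L"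
      unfolding a_def mult.assoc using pos by (intro divide_left_mono) (auto intro: mult_pos_pos less_le_trans)
    also have "\<dots> = C ^ CARD('m) * s (Suc k) / real (B ^ k)"
      by (simp add: s_def prod_dividef)
    finally show ?thesis .
  qed
  \<comment> \<open>For this direction the value of \<open>\<alpha> i (g l)\<close> is bounded above
    by the one at the left end, hence the index \<open>k\<close>.\<close>
  have a_ge: "s k / real (B ^ Suc k) \<le> C ^ CARD('m) * a l" if l: "B ^ k \<le> l" "l < B ^ Suc k" for k l
  proof -
    let ?U = "real B ^ Suc k * ((\<Prod>j\<in>UNIV. C * b k j) * (\<Prod>i\<in>UNIV. A k i))"
    let ?V = "real l * ((\<Prod>j\<in>UNIV. \<beta> j (real l)) * (\<Prod>i\<in>UNIV. \<alpha> i (g (real l))))"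
    have \<beta>0: "0 < \<beta> j (real l)" for j using block(1)[OF l, of j] b0[of k j] by linarith
    have "0 < real l" using block(6)[OF l] Bk0[of k] by linarith
    then have V: "0 < ?V" using \<beta>0 block(5)[OF l] by (intro mult_pos_pos prod_pos) auto
    have "?V \<le> ?U"
    proof (intro mult_mono prod_mono conjI)
      show "0 \<le> (\<Prod>j\<in>UNIV. C * b k j)" using C b0 by (intro prod_nonneg) (auto intro: less_imp_le)
      show "0 \<le> (\<Prod>i\<in>UNIV. \<alpha> i (g (real l)))" using block(5)[OF l] by (intro prod_nonneg) (auto intro: less_imp_le)
      then show "0 \<le> (\<Prod>j\<in>UNIV. \<beta> j (real l)) * (\<Prod>i\<in>UNIV. \<alpha> i (g (real l)))"
        using \<beta>0 block(5)[OF l] by (intro mult_nonneg_nonneg prod_nonneg) (auto intro: less_imp_le)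
    qed (use block[OF l] \<beta>0 in \<open>auto intro: less_imp_le\<close>)
    then have "1 / ?U \<le> a l"
      unfolding a_def mult.assoc using V by (intro divide_left_mono) (auto intro: mult_pos_pos less_le_trans)
    then have "C ^ CARD('m) * (1 / ?U) \<le> C ^ CARD('m) * a l" using C by (intro mult_left_mono) auto
    moreover have "C ^ CARD('m) * (1 / ?U) = s k / real (B ^ Suc k)"
      using C by (simp add: s_def prod.distrib)
    ultimately show ?thesis by simp
  qed
  show ?thesis
  proof (intro conjI impI)
    assume diverges: "\<not> summable (\<lambda>l. a (Suc l))"
    have ns: "\<not> summable s"
    proof
      assume "summable s"
      from summable_of_condensed[where a = a, OF B a_nonneg this less_imp_le[OF s0] _ a_le] C diverges
      show False by simp
    qed
    have lim: "filterlim (\<lambda>k. 1 / A k i) at_top sequentially" for i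
      unfolding filterlim_at_top_gt[where c = 0]
    proof (intro allI impI)
      fix Z :: real assume "0 < Z"
      then obtain \<epsilon> where \<epsilon>: "0 < \<epsilon>" "0 < \<alpha> i \<epsilon>" "Z \<le> 1 / \<alpha> i \<epsilon>"
        using weight_function_small[OF assms(3)] by blast
      \<comment> \<open>Otherwise all \<alpha> factors would stay bounded below while each \<beta>
        factor at least doubles, and \<open>s\<close> would be dominated by a geometric
        series.\<close>
      have "\<exists>K. g (real B ^ K) < \<epsilon>"
      proof (rule ccontr)
        assume "\<nexists>K. g (real B ^ K) < \<epsilon>"
        then have ge: "\<alpha> i \<epsilon> \<le> A k i" for i k
          unfolding A_def using \<epsilon>(1) by (intro \<alpha>_mono) (auto simp: not_less)
        have pow: "2 ^ k \<le> b k j" for k j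
        proof (induction k)
          case (Suc k)
          then show ?case using b_dbl(1)[of k j] by simp
        qed (use b1 in simp)
        define E where "E = (\<Prod>i\<in>UNIV. \<alpha> i \<epsilon>)"
        have E: "0 < E" unfolding E_def using \<alpha>_pos[OF \<epsilon>(1)] by (intro prod_pos) auto
        have le: "s k \<le> 1 / E * (1 / 2) ^ k" for k
        proof -
          have "(2::real) ^ k = (2 ^ k) ^ 1" by simp
          also have "\<dots> \<le> (2 ^ k) ^ CARD('m)"
            using zero_less_card_finite[where 'a='m] by (intro power_increasing) auto
          also have "\<dots> = (\<Prod>j\<in>(UNIV :: 'm set). 2 ^ k)" by simp
          also have "\<dots> \<le> (\<Prod>j\<in>UNIV. b k j)" using pow by (intro prod_mono) auto
          finally have 1: "2 ^ k \<le> (\<Prod>j\<in>UNIV. b k j)" .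
          have "E \<le> (\<Prod>i\<in>UNIV. A k i)"
            unfolding E_def using ge \<alpha>_pos[OF \<epsilon>(1)] by (intro prod_mono) (auto intro: less_imp_le)
          then have "2 ^ k * E \<le> (\<Prod>j\<in>UNIV. b k j) * (\<Prod>i\<in>UNIV. A k i)"
            using 1 E less_imp_le[OF prodb] by (intro mult_mono) auto
          then have "s k \<le> 1 / (2 ^ k * E)"
            unfolding s_def using E prodA prodb by (intro divide_left_mono) auto
          then show ?thesis by (simp add: power_one_over mult.commute)
        qed
        have "summable s"
          by (rule summable_comparison_test'[OF summable_mult[OF summable_geometric[of "1 / 2 :: real"], of "1 / E"]])
             (use le less_imp_le[OF s0] in auto)
        then show False using ns by simp
      qed
      then obtain K where K: "g (real B ^ K) < \<epsilon>" by blast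
      have "Z \<le> 1 / A k i" if "K \<le> k" for k
      proof -
        have "real B ^ K \<le> real B ^ k" using that B by (intro power_increasing) auto
        then have "g (real B ^ k) \<le> \<epsilon>" using g_mono[OF Bk] K by force
        then have "A k i \<le> \<alpha> i \<epsilon>" unfolding A_def using g_pos[OF Bk] by (intro \<alpha>_mono) auto
        then have "1 / \<alpha> i \<epsilon> \<le> 1 / A k i" using A0[of k i] \<epsilon>(2) by (intro divide_left_mono) auto
        then show ?thesis using \<epsilon>(3) by linarith
      qed
      then show "\<forall>\<^sub>F k in sequentially. Z \<le> 1 / A k i" unfolding eventually_sequentially by blast
    qed
    have "AE x in lborel. \<not> (\<forall>\<^sub>F k in sequentially. x \<in> solvable_set (A k) (b k))"
      by (rule AE_pair_not_eventually_solvable[where a = A and b = b, OF A0 lim b1 b_dbl(1)]) (use ns in \<open>simp add: s_def[abs_def]\<close>)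
    then have "AE x in lborel. x \<notin> D"
    proof (rule eventually_mono)
      fix x assume x: "\<not> (\<forall>\<^sub>F k in sequentially. x \<in> solvable_set (A k) (b k))"
      show "x \<notin> D"
      proof
        assume "x \<in> D"
        then have "\<forall>\<^sub>F T in at_top. x \<in> solvable_set (\<lambda>i. \<alpha> i (g T)) (\<lambda>j. \<beta> j T)"
          by (cases x) (simp add: D_def dirichlet_pair_iff)
        moreover have "filterlim (\<lambda>k. real B ^ k) at_top sequentially"
        proof (rule filterlim_at_top_mono[OF filterlim_real_sequentially], rule always_eventually, rule allI)
          fix k
          have "k < 2 ^ k" by (rule less_exp)
          also have "\<dots> \<le> B ^ k" using B by (rule power_mono) simp
          finally show "real k \<le> real B ^ k" by (metis less_imp_le of_nat_le_iff of_nat_power)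
        qed
        ultimately have "\<forall>\<^sub>F k in sequentially. x \<in> solvable_set (A k) (b k)"
          unfolding A_def b_def by (rule eventually_compose_filterlim)
        then show False using x by simp
      qed
    qed
    then show "D \<in> null_sets lebesgue" by (rule AE_lborel_null_sets_lebesgue)
  next
    assume "summable (\<lambda>l. a (Suc l))"
    from condensed_summable[where a = a, OF B a_nonneg this less_imp_le[OF s0] _ a_ge] C
    have "summable s" by simp
    then have ss: "summable (\<lambda>k. s (Suc k))" by (simp add: summable_Suc_iff)
    \<comment> \<open>As \<open>g\<close> is largest at 1, this bounds all the target widths at
      once.\<close>
    define M where "M = 1 + (\<Sum>i\<in>UNIV. \<alpha> i (g 1))"
    have \<alpha>1: "0 < \<alpha> i (g 1)" for i by (rule \<alpha>g_pos) simp
    have M: "1 \<le> M" unfolding M_def using less_imp_le[OF \<alpha>1] by (simp add: sum_nonneg)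
    have AM: "A k i \<le> M" for k i
    proof -
      have "A k i \<le> \<alpha> i (g 1)" unfolding A_def using Bk by (intro \<alpha>g_mono) auto
      also have "\<dots> \<le> (\<Sum>i\<in>UNIV. \<alpha> i (g 1))" using less_imp_le[OF \<alpha>1] by (intro member_le_sum) auto
      finally show ?thesis by (simp add: M_def)
    qed
    \<comment> \<open>The mixed indices give the hardest problem for \<open>T\<close> between
      \<open>B ^ k\<close> and \<open>B ^ Suc k\<close>: narrowest target from the right end,
      shortest range for \<open>q\<close> from the left end. Solving it settles every such
      \<open>T\<close>.\<close>
    have "AE x in torus. \<forall>\<^sub>F k in sequentially. x \<in> solvable_set (A (Suc k)) (b k)"
    proof (rule AE_eventually_solvable[where A = M])
      show "summable (\<lambda>k. 1 / ((\<Prod>j\<in>UNIV. b k j) * (\<Prod>i\<in>UNIV. A (Suc k) i)))"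
      \<comment> \<open>Replacing \<open>b k\<close> by \<open>b (Suc k)\<close> changes the product
        over \<open>j\<close> by at most \<open>C ^ m\<close>, which reduces the mixed series to the
        shifted \<open>s\<close>.\<close>
      proof (rule summable_comparison_test'[OF summable_mult[OF ss, of "C ^ CARD('m)"]])
        fix k
        have "(\<Prod>j\<in>UNIV. b (Suc k) j) \<le> (\<Prod>j\<in>UNIV. C * b k j)"
          using b_dbl(2) b0 by (intro prod_mono) (auto intro: less_imp_le)
        also have "\<dots> = C ^ CARD('m) * (\<Prod>j\<in>UNIV. b k j)" by (simp add: prod.distrib)
        finally have "(\<Prod>j\<in>UNIV. b (Suc k) j) / (\<Prod>j\<in>UNIV. b k j) \<le> C ^ CARD('m)"
          using prodb[of k] by (simp add: field_simps)
        from mult_right_mono[OF this less_imp_le[OF s0[of "Suc k"]]]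
        have "1 / ((\<Prod>j\<in>UNIV. b k j) * (\<Prod>i\<in>UNIV. A (Suc k) i)) \<le> C ^ CARD('m) * s (Suc k)"
          using b0[of "Suc k"] by (simp add: s_def less_imp_neq[THEN not_sym])
        then show "norm (1 / ((\<Prod>j\<in>UNIV. b k j) * (\<Prod>i\<in>UNIV. A (Suc k) i))) \<le> C ^ CARD('m) * s (Suc k)"
          using prodA[of "Suc k"] prodb[of k] by simp
      qed
    qed (use A0 AM b1 M in auto)
    then have "AE x in torus. x \<in> D"
    proof (rule eventually_mono)
      fix x assume "\<forall>\<^sub>F k in sequentially. x \<in> solvable_set (A (Suc k)) (b k)"
      then obtain K where K: "\<And>k. K \<le> k \<Longrightarrow> x \<in> solvable_set (A (Suc k)) (b k)"
        by (auto simp: eventually_sequentially)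
      have "x \<in> solvable_set (\<lambda>i. \<alpha> i (g T)) (\<lambda>j. \<beta> j T)" if T: "real B ^ K \<le> T" for T
      proof -
        have T1: "1 \<le> T" using T Bk[of K] by linarith
        obtain k where k: "real B ^ k \<le> T" "T < real B ^ Suc k" using nat_power_bracket[OF B T1] .
        have "K < Suc k"
          using le_less_trans[OF T k(2)] B by (simp add: power_less_imp_less_exp del: power_Suc)
        then have "x \<in> solvable_set (A (Suc k)) (b k)" by (intro K) simp
        moreover have "solvable_set (A (Suc k)) (b k) \<subseteq> solvable_set (\<lambda>i. \<alpha> i (g T)) (\<lambda>j. \<beta> j T)"
          unfolding A_def b_def using k T1 Bk0
          by (intro solvable_set_mono \<alpha>g_mono \<beta>_mono) auto
        ultimately show ?thesis by blast
      qed
      then have "\<forall>\<^sub>F T in at_top. x \<in> solvable_set (\<lambda>i. \<alpha> i (g T)) (\<lambda>j. \<beta> j T)"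
        unfolding eventually_at_top_linorder by blast
      then show "x \<in> D" by (cases x) (simp add: D_def dirichlet_pair_iff)
    qed
    moreover have "periodic (\<lambda>x. x \<in> D)"
    proof -
      have "x \<in> D \<longleftrightarrow> (\<forall>\<^sub>F T in at_top. x \<in> solvable_set (\<lambda>i. \<alpha> i (g T)) (\<lambda>j. \<beta> j T))" for x
        by (cases x) (simp add: D_def dirichlet_pair_iff)
      moreover have "x + z \<in> solvable_set u v \<longleftrightarrow> x \<in> solvable_set u v" if "z \<in> int_points"
        for x z and u :: "'n \<Rightarrow> real" and v :: "'m \<Rightarrow> real"
        using periodic_solvable_set[of u v] that unfolding periodic_def by blast
      ultimately show ?thesis by (simp add: periodic_def del: split_paired_All)
    qed
    ultimately have "AE x in lborel. x \<in> D" by (rule AE_lborel_of_torus)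
    then show "- D \<in> null_sets lebesgue" by (intro AE_lborel_null_sets_lebesgue) simp
  qed
qed

end
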